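(* Let $q\ge 1$ be an integer, let $X$ be a tree all of whose vertices have valency $q+1$, let $G$ be its automorphism group (with the topology and notation described in the context), and let $\Gamma\subset G$ be a discrete cocompact subgroup which acts freely on $X$. Then for every function $\varphi$ on $A^-$ such that $\sum_{a\in A^-}\varphi(a)\,q^{l(a)}<\infty$, $$\sum_{a\in A^-}\varphi(a)\,q^{l(a)}\,\mathrm{tr}(a\,|\,R_S)\;=\;\sum_{[\gamma]\in\mathcal{E}(\Gamma)} l(\gamma_0)\,\varphi(a_\gamma).$$
   Context: $X$ carries the path metric $d$ in which every edge has length one. $G=\mathrm{Aut}(X)$ is topologized so that the pointwise stabilizers of nonempty finite sets of vertices form a basis of neighbourhoods of the identity; it is a totally disconnected, locally compact, unimodular group. A line is a two-sided sequence $(\dots,v_{-1},v_0,v_1,\dots)$ of vertices with $v_j,v_{j+1}$ adjacent and $v_j\neq v_{j+2}$; a ray is a one-sided such sequence $(w_0,w_1,\dots)$; two rays are parallel if they agree eventually up to an index shift, and the parallelity classes are the cusps. Fix a line $(\dots,v_{-1},v_0,v_1,\dots)$, let $\infty$ be the cusp of $(v_0,v_1,\dots)$, and let $P$ be the stabilizer of $\infty$. For a vertex $x$ let $(x=x_0,x_1,\dots)$ be the unique ray from $x$ in the class $\infty$; two vertices $x,y$ lie in the same horosphere if $x_n=y_n$ for some $n$. Let $S\subset P$ be the subgroup of elements preserving every horosphere, $L\subset P$ the stabilizer of the line (as a set), and $M=L\cap S$ its pointwise stabilizer. Then $L/M$ is infinite cyclic; fix a splitting and let $A\subset L$ be its image,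 so $L=AM$. For $a\in A$ let $v(a)\in\mathbb Z$ be defined by $a v_j=v_{j+v(a)}$ for all $j$. For $g\in G$ put $l(g)=\min_x d(gx,x)$ (minimum over vertices), so $l(a)=|v(a)|$ for $a\in A$, and let $A^-=\{a\in A: v(a)<0\}$ (elements moving the line away from $\infty$). Let $C^\infty(\Gamma\backslash G)$ be the space of locally constant functions on $\Gamma\backslash G$ with $G$ acting by right translation, $R(y)f(x)=f(xy)$. Let $R[S]$ be the span of all $f-R(s)f$ with $f\in C^\infty(\Gamma\backslash G)$, $s\in S$, and $R_S=C^\infty(\Gamma\backslash G)/R[S]$; $A$ normalizes $S$, hence acts on $R_S$, which is finite dimensional. $\mathcal{E}(\Gamma)$ is the set of $\Gamma$-conjugacy classes $[\gamma]$ such that $\gamma$ is $G$-conjugate to an element $a_\gamma m_\gamma$ with $a_\gamma\in A^-$, $m_\gamma\in M$. For $\gamma\in\Gamma\setminus\{1\}$, $\gamma_0$ denotes the unique primitive element of $\Gamma$ with $\gamma=\gamma_0^\mu$ for some $\mu>0$; here $\tau\in\Gamma$ is primitive if $\tau=\sigma^n$ with $\sigma\in\Gamma$, $n\in\mathbb N$ implies $n=1$. *)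

theory Defs
  imports
    "HOL-Analysis.Analysis"
    "HOL-Algebra.Coset"
    "HOL-Algebra.AbelCoset"
    "HOL-Algebra.Module"
    "HOL-Library.Function_Algebras"
begin

section \<open>Trees, lines, rays and cusps\<close>

text \<open>A graph is given by its adjacency relation \<open>E\<close>; the vertex set is the whole type.\<close>

definition is_cycle :: "('v \<Rightarrow> 'v \<Rightarrow> bool) \<Rightarrow> 'v list \<Rightarrow> bool" where
  "is_cycle E xs \<longleftrightarrow> 3 \<le> length xs \<and> distinct xs \<and> successively E xs \<and> E (last xs) (hd xs)"

definition is_tree :: "('v \<Rightarrow> 'v \<Rightarrow> bool) \<Rightarrow> bool" where
  "is_tree E \<longleftrightarrow> symp E \<and> irreflp E \<and> (\<forall>x y. E\<^sup>*\<^sup>* x y) \<and> \<not> (\<exists>xs. is_cycle E xs)"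

definition regular_of_valency :: "('v \<Rightarrow> 'v \<Rightarrow> bool) \<Rightarrow> nat \<Rightarrow> bool" where
  "regular_of_valency E k \<longleftrightarrow> (\<forall>x. finite {y. E x y} \<and> card {y. E x y} = k)"

definition path_dist :: "('v \<Rightarrow> 'v \<Rightarrow> bool) \<Rightarrow> 'v \<Rightarrow> 'v \<Rightarrow> nat" where
  "path_dist E x y = (LEAST n. (E ^^ n) x y)"

definition is_line :: "('v \<Rightarrow> 'v \<Rightarrow> bool) \<Rightarrow> (int \<Rightarrow> 'v) \<Rightarrow> bool" where
  "is_line E v \<longleftrightarrow> (\<forall>j. E (v j) (v (j + 1)) \<and> v j \<noteq> v (j + 2))"

definition is_ray :: "('v \<Rightarrow> 'v \<Rightarrow> bool) \<Rightarrow> (nat \<Rightarrow> 'v) \<Rightarrow> bool" where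
  "is_ray E w \<longleftrightarrow> (\<forall>j. E (w j) (w (j + 1)) \<and> w j \<noteq> w (j + 2))"

definition parallel_rays :: "(nat \<Rightarrow> 'v) \<Rightarrow> (nat \<Rightarrow> 'v) \<Rightarrow> bool" where
  "parallel_rays w w' \<longleftrightarrow> (\<exists>k m. \<forall>n. w (n + k) = w' (n + m))"

definition cusp_of :: "('v \<Rightarrow> 'v \<Rightarrow> bool) \<Rightarrow> (nat \<Rightarrow> 'v) \<Rightarrow> (nat \<Rightarrow> 'v) set" where
  "cusp_of E w = {w'. is_ray E w' \<and> parallel_rays w w'}"

definition line_cusp :: "('v \<Rightarrow> 'v \<Rightarrow> bool) \<Rightarrow> (int \<Rightarrow> 'v) \<Rightarrow> (nat \<Rightarrow> 'v) set" where
  "line_cusp E v = cusp_of E (\<lambda>n. v (int n))"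

definition ray_from :: "('v \<Rightarrow> 'v \<Rightarrow> bool) \<Rightarrow> (int \<Rightarrow> 'v) \<Rightarrow> 'v \<Rightarrow> nat \<Rightarrow> 'v" where
  "ray_from E v x = (THE w. w \<in> line_cusp E v \<and> w 0 = x)"

definition horosphere :: "('v \<Rightarrow> 'v \<Rightarrow> bool) \<Rightarrow> (int \<Rightarrow> 'v) \<Rightarrow> 'v \<Rightarrow> 'v set" where
  "horosphere E v x = {y. \<exists>n. ray_from E v x n = ray_from E v y n}"


section \<open>The automorphism group and its topology\<close>

definition aut_group :: "('v \<Rightarrow> 'v \<Rightarrow> bool) \<Rightarrow> ('v \<Rightarrow> 'v) monoid" where
  "aut_group E = \<lparr>carrier = {g. bij g \<and> (\<forall>x y. E (g x) (g y) \<longleftrightarrow> E x y)}, mult = (\<circ>), one = id\<rparr>"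

definition pointwise_stabilizer :: "('v \<Rightarrow> 'v \<Rightarrow> bool) \<Rightarrow> 'v set \<Rightarrow> ('v \<Rightarrow> 'v) set" where
  "pointwise_stabilizer E F = {g \<in> carrier (aut_group E). \<forall>x\<in>F. g x = x}"

text \<open>The group topology in which the pointwise stabilizers of nonempty finite vertex sets form a
  basis of neighbourhoods of the identity.\<close>

definition aut_open :: "('v \<Rightarrow> 'v \<Rightarrow> bool) \<Rightarrow> ('v \<Rightarrow> 'v) set \<Rightarrow> bool" where
  "aut_open E U \<longleftrightarrow> U \<subseteq> carrier (aut_group E) \<and>
     (\<forall>g\<in>U. \<exists>F. finite F \<and> F \<noteq> {} \<and> g <#\<^bsub>aut_group E\<^esub> pointwise_stabilizer E F \<subseteq> U)"

definition aut_topology :: "('v \<Rightarrow> 'v \<Rightarrow> bool) \<Rightarrow> ('v \<Rightarrow> 'v) topology" where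
  "aut_topology E = topology (aut_open E)"

lemma istopology_aut_open: "istopology (aut_open E)"
  unfolding istopology_def
proof (intro conjI allI impI)
  fix U V assume U: "aut_open E U" and V: "aut_open E V"
  have "\<exists>F. finite F \<and> F \<noteq> {} \<and> g <#\<^bsub>aut_group E\<^esub> pointwise_stabilizer E F \<subseteq> U \<inter> V"
    if g: "g \<in> U \<inter> V" for g
  proof -
    obtain F where F: "finite F" "F \<noteq> {}" "g <#\<^bsub>aut_group E\<^esub> pointwise_stabilizer E F \<subseteq> U"
      using U g unfolding aut_open_def by blast
    obtain F' where F': "finite F'" "F' \<noteq> {}" "g <#\<^bsub>aut_group E\<^esub> pointwise_stabilizer E F' \<subseteq> V"
      using V g unfolding aut_open_def by blast
    have "g <#\<^bsub>aut_group E\<^esub> pointwise_stabilizer E (F \<union> F') \<subseteq> U \<inter> V"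
      using F(3) F'(3) by (fastforce simp: l_coset_def pointwise_stabilizer_def)
    then show ?thesis using F F' by (intro exI[of _ "F \<union> F'"]) auto
  qed
  then show "aut_open E (U \<inter> V)" using U unfolding aut_open_def by blast
next
  fix K assume "\<forall>U\<in>K. aut_open E U"
  then show "aut_open E (\<Union>K)" unfolding aut_open_def by (meson Sup_least UnionE Union_upper subset_trans)
qed

lemma openin_aut_topology: "openin (aut_topology E) U \<longleftrightarrow> aut_open E U"
  unfolding aut_topology_def by (simp add: istopology_aut_open)

lemma topspace_aut_topology: "topspace (aut_topology E) = carrier (aut_group E)"
proof -
  have "aut_open E (carrier (aut_group E))"
    unfolding aut_open_def
    by (auto simp: l_coset_def pointwise_stabilizer_def aut_group_def intro!: exI[of _ "{undefined}"] bij_comp)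
  then show ?thesis unfolding topspace_def by (auto simp: openin_aut_topology aut_open_def)
qed

definition quotient_topology :: "'a topology \<Rightarrow> ('a \<Rightarrow> 'b) \<Rightarrow> 'b topology" where
  "quotient_topology T p = topology (\<lambda>U. U \<subseteq> p ` topspace T \<and> openin T {x \<in> topspace T. p x \<in> U})"

lemma openin_quotient_topology:
  "openin (quotient_topology T p) U \<longleftrightarrow> U \<subseteq> p ` topspace T \<and> openin T {x \<in> topspace T. p x \<in> U}"
proof -
  have "istopology (\<lambda>U. U \<subseteq> p ` topspace T \<and> openin T {x \<in> topspace T. p x \<in> U})"
    unfolding istopology_def
  proof (intro conjI allI impI; (elim conjE)?)
    fix U V assume "openin T {x \<in> topspace T. p x \<in> U}" "openin T {x \<in> topspace T. p x \<in> V}"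
    moreover have "{x \<in> topspace T. p x \<in> U \<inter> V}
      = {x \<in> topspace T. p x \<in> U} \<inter> {x \<in> topspace T. p x \<in> V}" by auto
    ultimately show "openin T {x \<in> topspace T. p x \<in> U \<inter> V}" by auto
  next
    fix K assume "\<forall>U\<in>K. U \<subseteq> p ` topspace T \<and> openin T {x \<in> topspace T. p x \<in> U}"
    moreover have "{x \<in> topspace T. p x \<in> \<Union>K} = (\<Union>U\<in>K. {x \<in> topspace T. p x \<in> U})" by auto
    ultimately show "openin T {x \<in> topspace T. p x \<in> \<Union>K}" by auto
  qed auto
  then show ?thesis unfolding quotient_topology_def by simp
qed

text \<open>The space of cosets \<open>\<Gamma>g\<close>; its points are the elements of \<open>rcosets \<Gamma>\<close>.\<close>

definition coset_space :: "('v \<Rightarrow> 'v \<Rightarrow> bool) \<Rightarrow> ('v \<Rightarrow> 'v) set \<Rightarrow> ('v \<Rightarrow> 'v) set topology" where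
  "coset_space E \<Gamma> = quotient_topology (aut_topology E) (\<lambda>g. \<Gamma> #>\<^bsub>aut_group E\<^esub> g)"

lemma topspace_coset_space: "topspace (coset_space E \<Gamma>) = rcosets\<^bsub>aut_group E\<^esub> \<Gamma>"
proof -
  let ?R = "rcosets\<^bsub>aut_group E\<^esub> \<Gamma>"
  have R: "?R = (\<lambda>g. \<Gamma> #>\<^bsub>aut_group E\<^esub> g) ` topspace (aut_topology E)"
    by (auto simp: RCOSETS_def topspace_aut_topology)
  have "{g \<in> topspace (aut_topology E). \<Gamma> #>\<^bsub>aut_group E\<^esub> g \<in> ?R} = topspace (aut_topology E)"
    using R by auto
  then have "openin (coset_space E \<Gamma>) ?R"
    unfolding coset_space_def openin_quotient_topology using R by simp
  then show ?thesis
    using R unfolding topspace_def coset_space_def openin_quotient_topology by blast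
qed

definition discrete_in_aut :: "('v \<Rightarrow> 'v \<Rightarrow> bool) \<Rightarrow> ('v \<Rightarrow> 'v) set \<Rightarrow> bool" where
  "discrete_in_aut E \<Gamma> \<longleftrightarrow> subtopology (aut_topology E) \<Gamma> = discrete_topology \<Gamma>"

definition cocompact_in_aut :: "('v \<Rightarrow> 'v \<Rightarrow> bool) \<Rightarrow> ('v \<Rightarrow> 'v) set \<Rightarrow> bool" where
  "cocompact_in_aut E \<Gamma> \<longleftrightarrow> compact_space (coset_space E \<Gamma>)"

text \<open>The tree is a metric space including its edges, so a free action has no fixed vertices and
  no fixed interior points of edges. An automorphism fixes an interior point of an edge iff it
  fixes both endpoints or interchanges them (and then fixes the midpoint).\<close>

definition acts_freely :: "('v \<Rightarrow> 'v \<Rightarrow> bool) \<Rightarrow> ('v \<Rightarrow> 'v) set \<Rightarrow> bool" where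
  "acts_freely E \<Gamma> \<longleftrightarrow>
     (\<forall>g\<in>\<Gamma>. g \<noteq> id \<longrightarrow> (\<forall>x. g x \<noteq> x) \<and> (\<forall>x y. E x y \<longrightarrow> \<not> (g x = y \<and> g y = x)))"

definition displacement :: "('v \<Rightarrow> 'v \<Rightarrow> bool) \<Rightarrow> ('v \<Rightarrow> 'v) \<Rightarrow> nat" where
  "displacement E g = (LEAST n. \<exists>x. n = path_dist E (g x) x)"


section \<open>The subgroups attached to a line\<close>

definition cusp_stabilizer :: "('v \<Rightarrow> 'v \<Rightarrow> bool) \<Rightarrow> (int \<Rightarrow> 'v) \<Rightarrow> ('v \<Rightarrow> 'v) set" where
  "cusp_stabilizer E v =
     {g \<in> carrier (aut_group E). (\<lambda>w. g \<circ> w) ` line_cusp E v = line_cusp E v}"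

definition horo_subgroup :: "('v \<Rightarrow> 'v \<Rightarrow> bool) \<Rightarrow> (int \<Rightarrow> 'v) \<Rightarrow> ('v \<Rightarrow> 'v) set" where
  "horo_subgroup E v =
     {g \<in> cusp_stabilizer E v. \<forall>x. g ` horosphere E v x = horosphere E v x}"

definition line_subgroup :: "('v \<Rightarrow> 'v \<Rightarrow> bool) \<Rightarrow> (int \<Rightarrow> 'v) \<Rightarrow> ('v \<Rightarrow> 'v) set" where
  "line_subgroup E v = {g \<in> cusp_stabilizer E v. g ` range v = range v}"

definition line_fixer :: "('v \<Rightarrow> 'v \<Rightarrow> bool) \<Rightarrow> (int \<Rightarrow> 'v) \<Rightarrow> ('v \<Rightarrow> 'v) set" where
  "line_fixer E v = line_subgroup E v \<inter> horo_subgroup E v"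

text \<open>\<open>A\<close> is the image of a homomorphic section of the projection \<open>L \<rightarrow> L/M\<close>.\<close>

definition splitting_image :: "('v \<Rightarrow> 'v \<Rightarrow> bool) \<Rightarrow> (int \<Rightarrow> 'v) \<Rightarrow> ('v \<Rightarrow> 'v) set \<Rightarrow> bool" where
  "splitting_image E v A \<longleftrightarrow>
     (let L = (aut_group E)\<lparr>carrier := line_subgroup E v\<rparr>; M = line_fixer E v in
      \<exists>s \<in> hom (L Mod M) L.
        (\<forall>C \<in> carrier (L Mod M). M #>\<^bsub>L\<^esub> s C = C) \<and> A = s ` carrier (L Mod M))"

definition line_shift :: "(int \<Rightarrow> 'v) \<Rightarrow> ('v \<Rightarrow> 'v) \<Rightarrow> int" where
  "line_shift v a = (THE k. \<forall>j. a (v j) = v (j + k))"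

definition A_minus :: "(int \<Rightarrow> 'v) \<Rightarrow> ('v \<Rightarrow> 'v) set \<Rightarrow> ('v \<Rightarrow> 'v) set" where
  "A_minus v A = {a \<in> A. line_shift v a < 0}"


section \<open>Locally constant functions and their coinvariants\<close>

definition locally_constant_on_topspace :: "'a topology \<Rightarrow> ('a \<Rightarrow> 'b) \<Rightarrow> bool" where
  "locally_constant_on_topspace T f \<longleftrightarrow>
     (\<forall>c \<in> topspace T. \<exists>U. openin T U \<and> c \<in> U \<and> (\<forall>d\<in>U. f d = f c))"

text \<open>Functions on the coset space are extended by zero to all sets of automorphisms.\<close>

definition smooth_functions ::
  "('v \<Rightarrow> 'v \<Rightarrow> bool) \<Rightarrow> ('v \<Rightarrow> 'v) set \<Rightarrow> (('v \<Rightarrow> 'v) set \<Rightarrow> complex) set" where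
  "smooth_functions E \<Gamma> = {f. locally_constant_on_topspace (coset_space E \<Gamma>) f \<and>
     (\<forall>c. c \<notin> topspace (coset_space E \<Gamma>) \<longrightarrow> f c = 0)}"

definition right_translation ::
  "('v \<Rightarrow> 'v \<Rightarrow> bool) \<Rightarrow> ('v \<Rightarrow> 'v) \<Rightarrow> (('v \<Rightarrow> 'v) set \<Rightarrow> complex) \<Rightarrow> (('v \<Rightarrow> 'v) set \<Rightarrow> complex)" where
  "right_translation E y f = (\<lambda>c. f (c #>\<^bsub>aut_group E\<^esub> y))"

text \<open>Complex vector spaces are records of type \<^typ>\<open>(complex, 'b) module\<close>; the fields for the
  ring multiplication and its unit are not used.\<close>

definition function_module :: "('x \<Rightarrow> complex) set \<Rightarrow> (complex, 'x \<Rightarrow> complex) module" where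
  "function_module V = \<lparr>carrier = V, monoid.mult = undefined, one = undefined, zero = 0, add = (+),
     smult = (\<lambda>c f x. c * f x)\<rparr>"

definition quotient_module :: "(complex, 'b) module \<Rightarrow> 'b set \<Rightarrow> (complex, 'b set) module" where
  "quotient_module V W = \<lparr>carrier = a_rcosets\<^bsub>V\<^esub> W, monoid.mult = undefined, one = undefined,
     zero = W, add = (\<lambda>C D. C <+>\<^bsub>V\<^esub> D), smult = (\<lambda>c C. \<Union>f\<in>C. W +>\<^bsub>V\<^esub> (c \<odot>\<^bsub>V\<^esub> f))\<rparr>"

definition is_finite_basis :: "(complex, 'b) module \<Rightarrow> 'b set \<Rightarrow> bool" where
  "is_finite_basis V B \<longleftrightarrow> finite B \<and> B \<subseteq> carrier V \<and>
     (\<forall>x \<in> carrier V. \<exists>!u. u \<in> extensional B \<and> x = (\<Oplus>\<^bsub>V\<^esub>b\<in>B. u b \<odot>\<^bsub>V\<^esub> b))"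

definition basis_coeffs :: "(complex, 'b) module \<Rightarrow> 'b set \<Rightarrow> 'b \<Rightarrow> 'b \<Rightarrow> complex" where
  "basis_coeffs V B x = (THE u. u \<in> extensional B \<and> x = (\<Oplus>\<^bsub>V\<^esub>b\<in>B. u b \<odot>\<^bsub>V\<^esub> b))"

text \<open>Meaningful for a linear endomorphism \<open>T\<close> of a finite dimensional space \<open>V\<close>, where it does
  not depend on the choice of the basis.\<close>

definition endo_trace :: "(complex, 'b) module \<Rightarrow> ('b \<Rightarrow> 'b) \<Rightarrow> complex" where
  "endo_trace V T = (let B = (SOME B. is_finite_basis V B) in \<Sum>b\<in>B. basis_coeffs V B (T b) b)"

definition coinvariant_relations ::
  "('v \<Rightarrow> 'v \<Rightarrow> bool) \<Rightarrow> (int \<Rightarrow> 'v) \<Rightarrow> ('v \<Rightarrow> 'v) set \<Rightarrow> (('v \<Rightarrow> 'v) set \<Rightarrow> complex) set" where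
  "coinvariant_relations E v \<Gamma> = module.span (\<lambda>(c::complex) f x. c * f x)
     {f - right_translation E s f |f s. f \<in> smooth_functions E \<Gamma> \<and> s \<in> horo_subgroup E v}"

definition coinvariants ::
  "('v \<Rightarrow> 'v \<Rightarrow> bool) \<Rightarrow> (int \<Rightarrow> 'v) \<Rightarrow> ('v \<Rightarrow> 'v) set \<Rightarrow> (complex, (('v \<Rightarrow> 'v) set \<Rightarrow> complex) set) module" where
  "coinvariants E v \<Gamma> =
     quotient_module (function_module (smooth_functions E \<Gamma>)) (coinvariant_relations E v \<Gamma>)"

text \<open>Since \<open>a\<close> normalizes \<open>S\<close>, the operator \<open>R(a)\<close> maps each coset modulo the relations onto such
  a coset, so the induced map on the quotient is given by taking images.\<close>

definition trace_on_coinvariants ::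
  "('v \<Rightarrow> 'v \<Rightarrow> bool) \<Rightarrow> (int \<Rightarrow> 'v) \<Rightarrow> ('v \<Rightarrow> 'v) set \<Rightarrow> ('v \<Rightarrow> 'v) \<Rightarrow> complex" where
  "trace_on_coinvariants E v \<Gamma> a =
     endo_trace (coinvariants E v \<Gamma>) (\<lambda>C. right_translation E a ` C)"


section \<open>Conjugacy classes and primitive elements\<close>

definition conjugate_via :: "('g, 'm) monoid_scheme \<Rightarrow> 'g set \<Rightarrow> 'g \<Rightarrow> 'g \<Rightarrow> bool" where
  "conjugate_via G H x y \<longleftrightarrow> (\<exists>h\<in>H. y = h \<otimes>\<^bsub>G\<^esub> x \<otimes>\<^bsub>G\<^esub> inv\<^bsub>G\<^esub> h)"

definition split_part_cond ::
  "('v \<Rightarrow> 'v \<Rightarrow> bool) \<Rightarrow> (int \<Rightarrow> 'v) \<Rightarrow> ('v \<Rightarrow> 'v) set \<Rightarrow> ('v \<Rightarrow> 'v) \<Rightarrow> ('v \<Rightarrow> 'v) \<Rightarrow> bool" where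
  "split_part_cond E v A \<gamma> a \<longleftrightarrow> a \<in> A_minus v A \<and>
     (\<exists>m \<in> line_fixer E v.
        conjugate_via (aut_group E) (carrier (aut_group E)) \<gamma> (a \<otimes>\<^bsub>aut_group E\<^esub> m))"

text \<open>The element written \<open>a\<^sub>\<gamma>\<close> in the trace formula.\<close>

definition split_part ::
  "('v \<Rightarrow> 'v \<Rightarrow> bool) \<Rightarrow> (int \<Rightarrow> 'v) \<Rightarrow> ('v \<Rightarrow> 'v) set \<Rightarrow> ('v \<Rightarrow> 'v) \<Rightarrow> ('v \<Rightarrow> 'v)" where
  "split_part E v A \<gamma> = (THE a. split_part_cond E v A \<gamma> a)"

definition split_classes ::
  "('v \<Rightarrow> 'v \<Rightarrow> bool) \<Rightarrow> (int \<Rightarrow> 'v) \<Rightarrow> ('v \<Rightarrow> 'v) set \<Rightarrow> ('v \<Rightarrow> 'v) set \<Rightarrow> ('v \<Rightarrow> 'v) set set" where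
  "split_classes E v A \<Gamma> = {{\<tau> \<in> \<Gamma>. conjugate_via (aut_group E) \<Gamma> \<gamma> \<tau>} |\<gamma>.
     \<gamma> \<in> \<Gamma> \<and> (\<exists>a. split_part_cond E v A \<gamma> a)}"

definition primitive_in :: "('g, 'm) monoid_scheme \<Rightarrow> 'g set \<Rightarrow> 'g \<Rightarrow> bool" where
  "primitive_in G \<Gamma> \<tau> \<longleftrightarrow> \<tau> \<in> \<Gamma> \<and> (\<forall>\<sigma>\<in>\<Gamma>. \<forall>n::nat. \<tau> = \<sigma> [^]\<^bsub>G\<^esub> n \<longrightarrow> n = 1)"

definition primitive_root :: "('g, 'm) monoid_scheme \<Rightarrow> 'g set \<Rightarrow> 'g \<Rightarrow> 'g" where
  "primitive_root G \<Gamma> \<gamma> =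
     (THE \<tau>. primitive_in G \<Gamma> \<tau> \<and> (\<exists>\<mu>::nat. 0 < \<mu> \<and> \<gamma> = \<tau> [^]\<^bsub>G\<^esub> \<mu>))"

end

theory Submission
  imports Defs
begin

text \<open>
  For a directed edge \<open>e = (x, y)\<close> a step leads to an edge \<open>(y, z)\<close> with \<open>z \<noteq> x\<close>. The transfer
  operator \<open>N\<close>, which sums a \<open>\<Gamma>\<close>-invariant function of directed edges over the predecessors of an
  edge, is invertible. A locally constant function on the space of cosets \<open>\<Gamma>g\<close>, averaged over the stabilizer in \<open>S\<close> of
  \<open>v n, v (n + 1), \<dots>\<close> for large \<open>n\<close>, depends at \<open>g\<close> only on the edge from \<open>g (v n)\<close> to
  \<open>g (v (n + 1))\<close>, because the stabilizer of an edge is the product of its actions on the two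
  half-trees. Passing from \<open>n\<close> to \<open>n + 1\<close> amounts to applying \<open>N / q\<close>. Hence \<open>R\<^sub>S\<close> is isomorphic to
  the space of \<open>\<Gamma>\<close>-invariant edge functions, and \<open>a \<in> A\<^sup>-\<close> with \<open>l(a) = k\<close> acts on it as \<open>(N / q)\<^sup>k\<close>.
  So \<open>q\<^sup>k tr(a | R\<^sub>S) = tr N\<^sup>k\<close> is the number of \<open>\<Gamma>\<close>-orbits of pairs \<open>(e, \<gamma>)\<close> for which \<open>k\<close> steps lead
  from \<open>e\<close> to \<open>\<gamma> e\<close>. Then \<open>e\<close> lies on the axis of \<open>\<gamma>\<close>, on which the centralizer of \<open>\<gamma>\<close>, generated by
  \<open>\<gamma>\<^sub>0\<close>, has \<open>l(\<gamma>\<^sub>0)\<close> orbits of edges.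
\<close>

section \<open>Nonbacktracking paths in trees\<close>

text \<open>Averages are not taken over \<open>S\<close> itself but over the groups
  \<open>ray_fixer n\<close>, whose increasing union is \<open>S\<close>; finitely many relations
  all come from one of them. At one level averaging decides everything: it kills the relations of
  that level and changes a function only by such a relation. Thus \<open>R_S\<close> is the direct
  limit of the edge functions over the levels \<open>n\<close> with connecting map
  \<open>N / q\<close>, and invertibility of \<open>N\<close> lets level 0 stand for the whole
  limit. Invertibility is a computation at one vertex: on the \<open>q + 1\<close> edges there,
  \<open>N\<close> is the all-ones matrix minus the identity, up to reversing edges, with
  eigenvalues \<open>q\<close> and -1. The trace is found without eigenvalues: the diagonal entries
  of a power of \<open>N\<close> count paths from the orbit of an edge to the edge itself. Freeness
  attaches a unique group element to each such path, and the path forces this element to have an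
  axis.\<close>

definition nb_step :: "('v \<Rightarrow> 'v \<Rightarrow> bool) \<Rightarrow> 'v \<times> 'v \<Rightarrow> 'v \<times> 'v \<Rightarrow> bool" where
  "nb_step E e f \<longleftrightarrow> E (fst e) (snd e) \<and> E (fst f) (snd f) \<and> snd e = fst f \<and> fst e \<noteq> snd f"

text \<open>Steps are counted, not edges: in a tree \<open>n\<close> steps connect vertices at
  distance \<open>n + 1\<close>. The adjacency condition bites only at \<open>n = 0\<close>, where
  it excludes pairs that are not edges.\<close>

definition nb_path :: "('v \<Rightarrow> 'v \<Rightarrow> bool) \<Rightarrow> nat \<Rightarrow> 'v \<times> 'v \<Rightarrow> 'v \<times> 'v \<Rightarrow> bool" where
  "nb_path E n e f \<longleftrightarrow> E (fst e) (snd e) \<and> (nb_step E ^^ n) e f"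

lemma nb_path_0 [simp]: "nb_path E 0 e f \<longleftrightarrow> e = f \<and> E (fst e) (snd e)"
  by (auto simp: nb_path_def)

lemma nb_path_Suc: "nb_path E (Suc n) e f \<longleftrightarrow> (\<exists>g. nb_path E n e g \<and> nb_step E g f)"
  by (auto simp: nb_path_def relcompp_apply)

lemma nb_path_Suc_first: "nb_path E (Suc n) e f \<longleftrightarrow> (\<exists>g. nb_step E e g \<and> nb_path E n g f)"
  unfolding nb_path_def relpowp_commute [symmetric] relpowp.simps
  by (auto simp: relcompp_apply nb_step_def)

lemma nb_path_edges: "nb_path E n e f \<Longrightarrow> E (fst e) (snd e) \<and> E (fst f) (snd f)"
  by (cases n) (auto simp: nb_path_Suc nb_step_def nb_path_def)

lemma nb_path_1: "nb_path E (Suc 0) e f \<longleftrightarrow> nb_step E e f"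
  by (auto simp: nb_path_Suc nb_step_def)

lemma nb_path_add: "nb_path E (m + n) e f \<longleftrightarrow> (\<exists>g. nb_path E m e g \<and> nb_path E n g f)"
proof (induction n arbitrary: f)
  case 0
  then show ?case by (metis nb_path_0 nb_path_edges add_0_right)
next
  case (Suc n)
  then show ?case unfolding add_Suc_right nb_path_Suc by blast
qed

lemma nb_path_join:
  assumes "nb_path E m e f" "nb_step E f f'" "nb_path E n f' e'"
  shows "nb_path E (m + n + 1) e e'"
proof -
  have "nb_path E (m + Suc n) e e'"
    using assms unfolding nb_path_add nb_path_Suc_first by blast
  then show ?thesis by simp
qed

lemma nb_step_swap: "symp E \<Longrightarrow> nb_step E e f \<Longrightarrow> nb_step E (prod.swap f) (prod.swap e)"
  by (auto simp: nb_step_def dest: sympD)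

lemma nb_path_swap: "symp E \<Longrightarrow> nb_path E n e f \<Longrightarrow> nb_path E n (prod.swap f) (prod.swap e)"
proof (induction n arbitrary: f)
  case 0
  then show ?case by (auto dest: sympD)
next
  case (Suc n)
  then obtain g where "nb_path E n e g" "nb_step E g f" by (auto simp: nb_path_Suc)
  with Suc show ?case unfolding nb_path_Suc_first using nb_step_swap by blast
qed

text \<open>A step forbids only the immediate return, so injectivity on the neighbours of each
  vertex suffices. This allows maps that are not yet known to be automorphisms.\<close>

lemma nb_path_map:
  assumes "nb_path E n e f" "\<And>x y. E x y \<Longrightarrow> E (g x) (g y)"
    and "\<And>x y z. E x y \<Longrightarrow> E y z \<Longrightarrow> x \<noteq> z \<Longrightarrow> g x \<noteq> g z"
  shows "nb_path E n (map_prod g g e) (map_prod g g f)"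
  using assms(1)
proof (induction n arbitrary: f)
  case (Suc n)
  then obtain h where h: "nb_path E n e h" "nb_step E h f" by (auto simp: nb_path_Suc)
  then have "nb_step E (map_prod g g h) (map_prod g g f)"
    using assms(2,3) by (auto simp: nb_step_def)
  then show ?case using Suc.IH[OF h(1)] unfolding nb_path_Suc by blast
qed (use assms in auto)

lemma nb_path_seq:
  assumes "\<And>i. i \<le> n \<Longrightarrow> E (p i) (p (Suc i))" "\<And>i. i < n \<Longrightarrow> p i \<noteq> p (Suc (Suc i))"
  shows "nb_path E n (p 0, p (Suc 0)) (p n, p (Suc n))"
  using assms
proof (induction n)
  case (Suc n)
  then have "nb_path E n (p 0, p (Suc 0)) (p n, p (Suc n))" by simp
  moreover have "nb_step E (p n, p (Suc n)) (p (Suc n), p (Suc (Suc n)))"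
    using Suc.prems by (simp add: nb_step_def)
  ultimately show ?case by (auto simp: nb_path_Suc)
qed simp

lemma nb_path_obtain_seq:
  assumes "nb_path E n e f"
  obtains p where "e = (p 0, p (Suc 0))" "f = (p n, p (Suc n))"
    "\<And>i. i \<le> n \<Longrightarrow> E (p i) (p (Suc i))" "\<And>i. i < n \<Longrightarrow> p i \<noteq> p (Suc (Suc i))"
proof -
  obtain h where h: "h 0 = e" "h n = f" "\<And>i. i < n \<Longrightarrow> nb_step E (h i) (h (Suc i))"
    using assms unfolding nb_path_def relpowp_fun_conv by auto
  define p where "p i = (if i \<le> n then fst (h i) else snd f)" for i
  have p: "h i = (p i, p (Suc i))" if "i \<le> n" for i
  proof (cases "i = n")
    case True
    then show ?thesis using h by (auto simp: p_def prod_eq_iff)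
  next
    case False
    then show ?thesis using h(3)[of i] that by (auto simp: p_def prod_eq_iff nb_step_def)
  qed
  show thesis
  proof
    show "e = (p 0, p (Suc 0))" "f = (p n, p (Suc n))" using p[of 0] p[of n] h by auto
    show "E (p i) (p (Suc i))" if "i \<le> n" for i
    proof (cases "i < n")
      case True
      then show ?thesis using h(3)[of i] p[of i] by (metis nb_step_def fst_conv snd_conv that)
    next
      case False
      then have "i = n" using that by simp
      then show ?thesis using nb_path_edges[OF assms] p[of n] h(2) by simp
    qed
    show "p i \<noteq> p (Suc (Suc i))" if "i < n" for i
      using h(3)[of i] p[of i] p[of "Suc i"] that by (simp add: nb_step_def)
  qed
qed

locale tree =
  fixes E :: "'v \<Rightarrow> 'v \<Rightarrow> bool"
  assumes tree: "is_tree E"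
begin

lemma symp_E: "symp E" and irreflp_E: "irreflp E" and connected_E: "E\<^sup>*\<^sup>* x y"
  and acyclic_E: "\<not> is_cycle E xs"
  using tree by (auto simp: is_tree_def)

lemma E_sym: "E x y \<Longrightarrow> E y x" using symp_E by (rule sympD)

lemma E_neq: "E x y \<Longrightarrow> x \<noteq> y" using irreflp_E by (auto simp: irreflp_def)

lemma nb_path_rev: "nb_path E n e f \<Longrightarrow> nb_path E n (prod.swap f) (prod.swap e)"
  by (rule nb_path_swap[OF symp_E])

text \<open>By strong induction all proper segments have distinct ends, so a path that closes up is
  a closed walk without repeated vertices, a cycle.\<close>

lemma nb_path_no_return: "nb_path E n e f \<Longrightarrow> fst e \<noteq> snd f"
proof (induction n arbitrary: e f rule: less_induct)
  case (less n)
  obtain p where p: "e = (p 0, p (Suc 0))" "f = (p n, p (Suc n))"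
    "\<And>i. i \<le> n \<Longrightarrow> E (p i) (p (Suc i))" "\<And>i. i < n \<Longrightarrow> p i \<noteq> p (Suc (Suc i))"
    using nb_path_obtain_seq[OF less.prems] by metis
  show ?case
  proof
    assume "fst e = snd f"
    then have ret: "p 0 = p (Suc n)" using p by simp
    have neq: "p i \<noteq> p j" if "i < j" "j \<le> n" for i j
    proof -
      obtain d where d: "j = i + Suc d" using \<open>i < j\<close> less_iff_Suc_add by auto
      have "nb_path E d (p (0 + i), p (Suc 0 + i)) (p (d + i), p (Suc d + i))"
        using nb_path_seq[where p = "\<lambda>l. p (l + i)" and n = d] p(3,4) that d by simp
      then have "fst (p i, p (Suc i)) \<noteq> snd (p (d + i), p j)"
        using less.IH[of d] that d by (metis add_0 add_Suc add_Suc_right add.commute less_Suc_eq_le Suc_le_lessD le_add1 le_trans)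
      then show ?thesis by simp
    qed
    \<comment> \<open>A cycle needs three vertices: \<open>n = 0\<close> would be a loop,
      \<open>n = 1\<close> a backtrack.\<close>
    have "n \<noteq> 0" using ret p(3)[of 0] E_neq by (metis le0)
    moreover have "n \<noteq> 1" using ret p(4)[of 0] by auto
    ultimately have n: "n \<ge> 2" by simp
    have "is_cycle E (map p [0..<Suc n])"
      unfolding is_cycle_def
    proof (intro conjI)
      show "3 \<le> length (map p [0..<Suc n])" using n by simp
      show "distinct (map p [0..<Suc n])"
        unfolding distinct_map
      proof (intro conjI inj_onI)
        fix i j assume "i \<in> set [0..<Suc n]" "j \<in> set [0..<Suc n]" "p i = p j"
        then show "i = j" using neq[of i j] neq[of j i] by (cases i j rule: linorder_cases) auto
      qed simp
      show "successively E (map p [0..<Suc n])"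
        unfolding successively_conv_nth using p(3) by (auto simp del: upt_Suc)
      show "E (last (map p [0..<Suc n])) (hd (map p [0..<Suc n]))"
        using p(3)[of n] ret by (simp add: last_map hd_map hd_append del: upt.simps(2)) 
    qed
    then show False using acyclic_E by blast
  qed
qed

text \<open>If the last edges differed, the first path followed by the reverse of the second would
  be a nonbacktracking closed path. Hence they agree and can be peeled off.\<close>

lemma nb_path_unique:
  assumes "nb_path E n e f" "nb_path E m e' f'" "fst e = fst e'" "snd f = snd f'"
  shows "n = m \<and> e = e' \<and> f = f'"
  using assms
proof (induction n arbitrary: m f f')
  case 0
  then have ef: "e = f" by simp
  have ff: "f = f'"
  proof (rule ccontr)
    assume "f \<noteq> f'"
    then have "nb_step E f (prod.swap f')"
      using 0 nb_path_edges[OF 0(1)] nb_path_edges[OF 0(2)] E_sym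
      by (auto simp: nb_step_def prod_eq_iff)
    then have "nb_path E (0 + m + 1) e (prod.swap e')"
      using nb_path_join 0(1) nb_path_rev[OF 0(2)] by blast
    then show False using nb_path_no_return 0(3) by fastforce
  qed
  show ?case
  proof (cases m)
    case 0
    then show ?thesis using \<open>nb_path E m e' f'\<close> ef ff by simp
  next
    case (Suc l)
    then obtain g where "nb_path E l e' g" "nb_step E g f'" using 0(2) by (auto simp: nb_path_Suc)
    then have "snd g = fst e'" using ff ef 0(3) by (auto simp: nb_step_def)
    then show ?thesis using nb_path_no_return[OF \<open>nb_path E l e' g\<close>] by simp
  qed
next
  case (Suc n)
  have ff: "f = f'"
  proof (rule ccontr)
    assume "f \<noteq> f'"
    then have "nb_step E f (prod.swap f')"
      using Suc.prems(4) nb_path_edges[OF Suc.prems(1)] nb_path_edges[OF Suc.prems(2)] E_sym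
      by (auto simp: nb_step_def prod_eq_iff)
    then have "nb_path E (Suc n + m + 1) e (prod.swap e')"
      using nb_path_join Suc.prems(1) nb_path_rev[OF Suc.prems(2)] by blast
    then show False using nb_path_no_return Suc.prems(3) by fastforce
  qed
  obtain g where g: "nb_path E n e g" "nb_step E g f" using Suc.prems(1) by (auto simp: nb_path_Suc)
  show ?case
  proof (cases m)
    case 0
    then have "snd g = fst e" using g(2) ff Suc.prems by (auto simp: nb_step_def)
    then show ?thesis using nb_path_no_return[OF g(1)] by simp
  next
    case (Suc l)
    then obtain g' where g': "nb_path E l e' g'" "nb_step E g' f'"
      using Suc.prems(2) by (auto simp: nb_path_Suc)
    have "snd g = snd g'" using g g' ff by (auto simp: nb_step_def)
    then show ?thesis using Suc.IH[OF g(1) g'(1)] Suc.prems(3) ff Suc by blast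
  qed
qed

text \<open>Backtracks are cancelled one at a time at the start of the walk. The bound on
  \<open>n\<close> is kept so that \<open>path_dist\<close>, a minimum over all walks, can be read
  off.\<close>

lemma nb_path_of_walk:
  "(E ^^ m) x y \<Longrightarrow> x = y \<or> (\<exists>n e f. n < m \<and> nb_path E n e f \<and> fst e = x \<and> snd f = y)"
proof (induction m arbitrary: x)
  case (Suc m)
  then obtain z where z: "E x z" "(E ^^ m) z y"
    by (metis relpowp_Suc_E2)
  consider "z = y" | n e f where "n < m" "nb_path E n e f" "fst e = z" "snd f = y"
    using Suc.IH[OF z(2)] by blast
  then show ?case
  proof cases
    case 1
    then have "nb_path E 0 (x, y) (x, y)" using z by simp
    then show ?thesis by (metis fst_conv snd_conv zero_less_Suc)
  next
    case (2 n e f)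
    show ?thesis
    proof (cases "snd e = x")
      case True
      show ?thesis
      proof (cases n)
        case 0
        then show ?thesis using 2 True by simp
      next
        case (Suc l)
        then obtain g where "nb_step E e g" "nb_path E l g f" using 2 by (auto simp: nb_path_Suc_first)
        moreover have "l < Suc m" using Suc 2 by simp
        ultimately show ?thesis using True 2 by (metis nb_step_def)
      qed
    next
      case False
      then have "nb_step E (x, z) e" using 2 z nb_path_edges[OF 2(2)] by (auto simp: nb_step_def)
      then have "nb_path E (Suc n) (x, z) f" using 2 unfolding nb_path_Suc_first by blast
      then show ?thesis using 2 by (metis fst_conv Suc_mono)
    qed
  qed
qed simp

lemma nb_path_exists:
  assumes "x \<noteq> y"
  obtains n e f where "nb_path E n e f" "fst e = x" "snd f = y"
  using nb_path_of_walk connected_E[of x y] assms rtranclp_imp_relpowp by metis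

lemma path_dist_nb_path:
  assumes "nb_path E n e f"
  shows "path_dist E (fst e) (snd f) = Suc n"
proof -
  have walk: "(E ^^ Suc n) (fst e) (snd f)" using assms
  proof (induction n arbitrary: f)
    case (Suc n)
    then obtain g where g: "nb_path E n e g" "nb_step E g f" by (auto simp: nb_path_Suc)
    then have "(E ^^ Suc n) (fst e) (snd g)" "E (snd g) (snd f)" using Suc.IH[OF g(1)] by (simp_all add: nb_step_def del: relpowp.simps)
    then show ?case by (metis relpowp_Suc_I)
  qed auto
  have min: "Suc n \<le> m" if "(E ^^ m) (fst e) (snd f)" for m
    using nb_path_of_walk[OF that] nb_path_no_return[OF assms] nb_path_unique[OF assms]
    by (metis Suc_leI)
  show ?thesis unfolding path_dist_def using walk min by (rule Least_equality)
qed

lemma path_dist_eq_0 [simp]: "path_dist E x x = 0"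
  unfolding path_dist_def by (rule Least_eq_0) simp

lemma path_dist_eq_Suc_iff:
  "path_dist E x y = Suc n \<longleftrightarrow> (\<exists>e f. nb_path E n e f \<and> fst e = x \<and> snd f = y)"
proof
  assume d: "path_dist E x y = Suc n"
  then have "x \<noteq> y" by auto
  then obtain m e f where p: "nb_path E m e f" "fst e = x" "snd f = y" by (rule nb_path_exists)
  then have "m = n" using path_dist_nb_path[OF p(1)] d by simp
  with p show "\<exists>e f. nb_path E n e f \<and> fst e = x \<and> snd f = y" by blast
next
  assume "\<exists>e f. nb_path E n e f \<and> fst e = x \<and> snd f = y"
  then show "path_dist E x y = Suc n" using path_dist_nb_path by blast
qed

end

section \<open>Automorphisms and the extension of partial isomorphisms\<close>

lemma carrier_aut_group: "carrier (aut_group E) = {g. bij g \<and> (\<forall>x y. E (g x) (g y) \<longleftrightarrow> E x y)}"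
  and mult_aut_group [simp]: "x \<otimes>\<^bsub>aut_group E\<^esub> y = x \<circ> y"
  and one_aut_group [simp]: "\<one>\<^bsub>aut_group E\<^esub> = id"
  by (simp_all add: aut_group_def)

lemma aut_bij: "g \<in> carrier (aut_group E) \<Longrightarrow> bij g"
  and aut_inj: "g \<in> carrier (aut_group E) \<Longrightarrow> inj g"
  and aut_adj: "g \<in> carrier (aut_group E) \<Longrightarrow> E (g x) (g y) \<longleftrightarrow> E x y"
  by (auto simp: carrier_aut_group bij_is_inj)

lemma aut_id [simp]: "id \<in> carrier (aut_group E)"
  by (auto simp: carrier_aut_group)

lemma aut_comp: "g \<in> carrier (aut_group E) \<Longrightarrow> h \<in> carrier (aut_group E) \<Longrightarrow> g \<circ> h \<in> carrier (aut_group E)"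
  by (auto simp: carrier_aut_group bij_comp)

lemma aut_inv: "g \<in> carrier (aut_group E) \<Longrightarrow> inv_into UNIV g \<in> carrier (aut_group E)"
  unfolding carrier_aut_group
  by (auto simp: bij_imp_bij_inv) (metis bij_inv_eq_iff)+

lemma aut_inv_apply [simp]:
  "g \<in> carrier (aut_group E) \<Longrightarrow> inv_into UNIV g (g x) = x"
  "g \<in> carrier (aut_group E) \<Longrightarrow> g (inv_into UNIV g x) = x"
  by (auto simp: carrier_aut_group bij_is_inj bij_is_surj surj_f_inv_f)

lemma group_aut_group: "group (aut_group E)"
proof (rule groupI)
  fix x assume "x \<in> carrier (aut_group E)"
  then have "inv_into UNIV x \<in> carrier (aut_group E)" "inv_into UNIV x \<circ> x = id"
    by (auto simp: aut_inv)
  then show "\<exists>y\<in>carrier (aut_group E). y \<otimes>\<^bsub>aut_group E\<^esub> x = \<one>\<^bsub>aut_group E\<^esub>"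
    by auto
qed (auto simp: comp_assoc intro: aut_comp)

lemma inv_aut_group: "g \<in> carrier (aut_group E) \<Longrightarrow> inv\<^bsub>aut_group E\<^esub> g = inv_into UNIV g"
proof (rule group.inv_equality[OF group_aut_group])
  assume "g \<in> carrier (aut_group E)"
  then show "inv_into UNIV g \<otimes>\<^bsub>aut_group E\<^esub> g = \<one>\<^bsub>aut_group E\<^esub>" by auto
qed (auto intro: aut_inv)

lemma pow_aut_group: "g [^]\<^bsub>aut_group E\<^esub> (n::nat) = g ^^ n"
proof (induction n)
  case (Suc n)
  interpret group "aut_group E" by (rule group_aut_group)
  show ?case using Suc by (simp add: nat_pow_Suc funpow_swap1 fun_eq_iff)
qed (simp add: nat_pow_def)

lemma nb_path_aut:
  "g \<in> carrier (aut_group E) \<Longrightarrow> nb_path E n e f \<Longrightarrow> nb_path E n (map_prod g g e) (map_prod g g f)"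
  by (rule nb_path_map) (auto simp: aut_adj inj_eq[OF aut_inj])

locale regular_tree = tree E for E :: "'v \<Rightarrow> 'v \<Rightarrow> bool" +
  fixes q :: nat
  assumes q_pos: "1 \<le> q" and regular: "regular_of_valency E (q + 1)"
begin

lemma finite_nbrs: "finite {y. E x y}" and card_nbrs: "card {y. E x y} = q + 1"
  using regular by (auto simp: regular_of_valency_def)

text \<open>Injective since the image of a nonbacktracking path is one again and cannot close up;
  surjective since \<open>q + 1\<close> neighbours go injectively to \<open>q + 1\<close>
  neighbours, so the range is closed under adjacency.\<close>

lemma local_injection_aut:
  assumes adj: "\<And>x y. E x y \<Longrightarrow> E (g x) (g y)"
    and inj: "\<And>x y z. E x y \<Longrightarrow> E y z \<Longrightarrow> x \<noteq> z \<Longrightarrow> g x \<noteq> g z"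
  shows "g \<in> carrier (aut_group E)"
proof -
  have path: "nb_path E n (map_prod g g e) (map_prod g g f)" if "nb_path E n e f" for n e f
    using nb_path_map that adj inj by metis
  have nbrs: "g ` {y. E x y} = {y. E (g x) y}" for x
  proof (rule card_subset_eq)
    have "inj_on g {y. E x y}" using inj E_sym by (intro inj_onI) blast
    then show "card (g ` {y. E x y}) = card {y. E (g x) y}"
      using card_nbrs by (simp add: card_image)
  qed (use finite_nbrs adj in auto)
  have "inj g"
  proof (rule injI, rule ccontr)
    fix x y assume "g x = g y" "x \<noteq> y"
    then obtain n e f where "nb_path E n e f" "fst e = x" "snd f = y" by (metis nb_path_exists)
    then show False using nb_path_no_return[OF path, of n e f] \<open>g x = g y\<close> by simp
  qed
  moreover have "E x y" if "E (g x) (g y)" for x y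
  proof -
    have "g y \<in> g ` {z. E x z}" using that nbrs by simp
    then show ?thesis using \<open>inj g\<close> by (auto simp: inj_eq)
  qed
  moreover have "y \<in> range g" for y
    using connected_E[of "g undefined" y]
  proof (induction rule: rtranclp_induct)
    case (step y z)
    then obtain x where "y = g x" by auto
    then have "z \<in> g ` {z. E x z}" using step nbrs by simp
    then show ?case by auto
  qed simp
  ultimately show ?thesis using adj unfolding carrier_aut_group bij_def by blast
qed

text \<open>Partial maps are relations, so that inclusion serves as the order for Zorn's lemma. The
  second clause is convexity of the domain: the first step of a geodesic stays inside, and iteration
  covers the rest. The last is injectivity on neighbours.\<close>

definition partial_iso :: "('v \<times> 'v) set \<Rightarrow> bool" where
  "partial_iso R \<longleftrightarrow> single_valued R \<and>
     (\<forall>n e f. nb_path E n e f \<longrightarrow> fst e \<in> Domain R \<longrightarrow> snd f \<in> Domain R \<longrightarrow> snd e \<in> Domain R) \<and>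
     (\<forall>x x' y y'. (x, x') \<in> R \<longrightarrow> (y, y') \<in> R \<longrightarrow> E x y \<longrightarrow> E x' y') \<and>
     (\<forall>x x' y z z'. (x, x') \<in> R \<longrightarrow> (z, z') \<in> R \<longrightarrow> y \<in> Domain R \<longrightarrow> E x y \<longrightarrow> E y z \<longrightarrow> x \<noteq> z \<longrightarrow> x' \<noteq> z')"

lemma partial_isoD:
  assumes "partial_iso R"
  shows "(x, x') \<in> R \<Longrightarrow> (x, x'') \<in> R \<Longrightarrow> x' = x''"
    and "nb_path E n e f \<Longrightarrow> fst e \<in> Domain R \<Longrightarrow> snd f \<in> Domain R \<Longrightarrow> snd e \<in> Domain R"
    and "(x, x') \<in> R \<Longrightarrow> (y, y') \<in> R \<Longrightarrow> E x y \<Longrightarrow> E x' y'"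
    and "(x, x') \<in> R \<Longrightarrow> (z, z') \<in> R \<Longrightarrow> y \<in> Domain R \<Longrightarrow> E x y \<Longrightarrow> E y z \<Longrightarrow> x \<noteq> z \<Longrightarrow> x' \<noteq> z'"
  using assms unfolding partial_iso_def by (blast dest: single_valuedD)+

text \<open>Each clause involves at most three pairs, and these lie in a common member of the
  chain.\<close>

lemma partial_iso_chain:
  assumes "subset.chain (Collect partial_iso) C"
  shows "partial_iso (\<Union>C)"
proof -
  have iso: "partial_iso R" if "R \<in> C" for R
    using assms that by (auto simp: subset.chain_def)
  have two: "\<exists>R\<in>C. p \<in> R \<and> p' \<in> R" if pp: "p \<in> \<Union>C" "p' \<in> \<Union>C" for p p'
  proof -
    obtain R R' where R: "R \<in> C" "p \<in> R" "R' \<in> C" "p' \<in> R'" using pp by blast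
    then have "R \<subseteq> R' \<or> R' \<subseteq> R" using subset.chain_total[OF assms] by blast
    then show ?thesis using R by blast
  qed
  have three: "\<exists>R\<in>C. p \<in> R \<and> p' \<in> R \<and> p'' \<in> R" if pp: "p \<in> \<Union>C" "p' \<in> \<Union>C" "p'' \<in> \<Union>C" for p p' p''
  proof -
    obtain R where R: "R \<in> C" "p \<in> R" "p' \<in> R" using two[OF pp(1,2)] by blast
    obtain R' where R': "R' \<in> C" "p'' \<in> R'" using pp(3) by blast
    have "R \<subseteq> R' \<or> R' \<subseteq> R" using R R' subset.chain_total[OF assms] by blast
    then show ?thesis using R R' by blast
  qed
  show ?thesis
    unfolding partial_iso_def
  proof (intro conjI allI impI single_valuedI)
    show "x' = x''" if "(x, x') \<in> \<Union>C" "(x, x'') \<in> \<Union>C" for x x' x''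
      using two[OF that] iso partial_isoD(1) by metis
    show "snd e \<in> Domain (\<Union>C)"
      if p: "nb_path E n e f" and e: "fst e \<in> Domain (\<Union>C)" and f: "snd f \<in> Domain (\<Union>C)" for n e f
    proof -
      obtain x y where "(fst e, x) \<in> \<Union>C" "(snd f, y) \<in> \<Union>C" using e f by (meson DomainE)
      from two[OF this] obtain R where "R \<in> C" "(fst e, x) \<in> R" "(snd f, y) \<in> R" by blast
      then have "snd e \<in> Domain R" using partial_isoD(2)[OF iso p] by blast
      then show ?thesis using \<open>R \<in> C\<close> by blast
    qed
    show "E x' y'" if "(x, x') \<in> \<Union>C" "(y, y') \<in> \<Union>C" "E x y" for x x' y y'
      using two[OF that(1,2)] iso partial_isoD(3) that(3) by metis
    show "x' \<noteq> z'" if xz: "(x, x') \<in> \<Union>C" "(z, z') \<in> \<Union>C" and y: "y \<in> Domain (\<Union>C)"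
      and E: "E x y" "E y z" "x \<noteq> z" for x x' y z z'
    proof -
      obtain y' where "(y, y') \<in> \<Union>C" using y by (meson DomainE)
      from three[OF xz this] obtain R where R: "R \<in> C" "(x, x') \<in> R" "(z, z') \<in> R" "(y, y') \<in> R"
        by blast
      show ?thesis by (rule partial_isoD(4)[OF iso[OF R(1)] R(2,3) _ E]) (use R(4) in blast)
    qed
  qed
qed

lemma partial_iso_extend:
  assumes iso: "partial_iso R" and x: "x \<notin> Domain R" and y: "(y, y') \<in> R" and xy: "E y x"
  obtains x' where "partial_iso (insert (x, x') R)"
proof -
  have yD: "y \<in> Domain R" using y by blast
  \<comment> \<open>The images already used up around \<open>y'\<close>. They come from neighbours
    of \<open>y\<close> other than \<open>x\<close>, so there are at most \<open>q\<close> of them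
    and some neighbour of \<open>y'\<close> is free.\<close>
  define U where "U = {z'. \<exists>z. E y z \<and> (z, z') \<in> R}"
  have "U \<subseteq> (\<lambda>z. THE z'. (z, z') \<in> R) ` ({z. E y z} - {x})"
  proof
    fix z' assume "z' \<in> U"
    then obtain z where z: "E y z" "(z, z') \<in> R" by (auto simp: U_def)
    then have "(THE z'. (z, z') \<in> R) = z'" "z \<noteq> x" using partial_isoD(1)[OF iso] x by auto
    with z show "z' \<in> (\<lambda>z. THE z'. (z, z') \<in> R) ` ({z. E y z} - {x})" by force
  qed
  then have "card U \<le> card ({z. E y z} - {x})"
    using finite_nbrs by (meson card_image_le card_mono finite_Diff finite_imageI le_trans)
  also have "\<dots> < card {z. E y' z}"
    using card_nbrs finite_nbrs xy by simp
  finally have "\<not> {z. E y' z} \<subseteq> U" 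
    using \<open>U \<subseteq> _\<close> finite_nbrs by (meson card_mono finite_Diff finite_imageI finite_subset leD)
  then obtain x' where x': "E y' x'" "x' \<notin> U" by blast
  \<comment> \<open>By convexity the new vertex has a single neighbour in the domain: with two of
    them it would lie on the geodesic between them.\<close>
  have only: "u = y" if "u \<in> Domain R" "E x u" for u
  proof (rule ccontr)
    assume "u \<noteq> y"
    then have "nb_path E (Suc 0) (y, x) (x, u)" using that xy by (auto simp: nb_path_1 nb_step_def)
    then have "x \<in> Domain R" using partial_isoD(2)[OF iso] that yD by fastforce
    with x show False by blast
  qed
  show thesis
  proof
    let ?R = "insert (x, x') R"
    show "partial_iso ?R"
      unfolding partial_iso_def
    proof (intro conjI allI impI single_valuedI)
      show "a' = a''" if "(a, a') \<in> ?R" "(a, a'') \<in> ?R" for a a' a''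
        using that x partial_isoD(1)[OF iso] by blast
      show "snd e \<in> Domain ?R"
        if p: "nb_path E n e f" and e: "fst e \<in> Domain ?R" and f: "snd f \<in> Domain ?R" for n e f
      proof -
        consider "fst e = x" "snd f = x" | "fst e = x" "snd f \<in> Domain R" | "fst e \<in> Domain R" "snd f = x"
          | "fst e \<in> Domain R" "snd f \<in> Domain R" using e f by auto
        then show ?thesis
        proof cases
          case 1
          then show ?thesis using nb_path_no_return[OF p] by simp
        next
          case 2
          show ?thesis
          proof (cases "snd e = y")
            case False
            \<comment> \<open>A geodesic leaving \<open>x\<close> otherwise than through
              \<open>y\<close> could be prolonged back to \<open>y\<close>, which would put
              \<open>x\<close> in the domain.\<close>
            then have "nb_step E (y, x) e" using 2 xy nb_path_edges[OF p] by (auto simp: nb_step_def)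
            then have "nb_path E (Suc n) (y, x) f" using p unfolding nb_path_Suc_first by blast
            then have "x \<in> Domain R" using partial_isoD(2)[OF iso] 2 yD by fastforce
            with x show ?thesis by blast
          qed (use yD in blast)
        next
          case 3
          show ?thesis
          proof (cases "fst f = y")
            case True
            show ?thesis
            proof (cases n)
              case 0
              then show ?thesis using p 3 by auto
            next
              case (Suc m)
              then obtain g where g: "nb_path E m e g" "nb_step E g f" using p nb_path_Suc by blast
              then have "snd g = y" using True by (simp add: nb_step_def)
              then show ?thesis using partial_isoD(2)[OF iso g(1)] 3 yD by blast
            qed
          next
            case False
            then have "nb_step E f (x, y)" using 3 xy nb_path_edges[OF p] E_sym by (auto simp: nb_step_def)
            then have "nb_path E (Suc n) e (x, y)" using p unfolding nb_path_Suc by blast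
            then show ?thesis using partial_isoD(2)[OF iso] 3 yD by fastforce
          qed
        next
          case 4
          then show ?thesis using partial_isoD(2)[OF iso p] by blast
        qed
      qed
      show "E a' b'" if ab: "(a, a') \<in> ?R" "(b, b') \<in> ?R" "E a b" for a a' b b'
      proof -
        consider "(a, a') \<in> R" "(b, b') \<in> R" | "a = x" "a' = x'" "(b, b') \<in> R" | "b = x" "b' = x'" "(a, a') \<in> R"
          using ab E_neq by blast
        then show ?thesis
        proof cases
          case 1
          then show ?thesis using partial_isoD(3)[OF iso] that by blast
        next
          case 2
          then have "b = y" using only that by blast
          then show ?thesis using 2 x' y partial_isoD(1)[OF iso] E_sym by blast
        next
          case 3
          then have "a = y" using only that E_sym by blast
          then show ?thesis using 3 x' y partial_isoD(1)[OF iso] by blast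
        qed
      qed
      show "a' \<noteq> c'" if ac: "(a, a') \<in> ?R" "(c, c') \<in> ?R" and b: "b \<in> Domain ?R"
        and E: "E a b" "E b c" "a \<noteq> c" for a a' b c c'
      proof -
        consider "b = x" | "b \<noteq> x" "a = x" "a' = x'" "(c, c') \<in> R" | "b \<noteq> x" "c = x" "c' = x'" "(a, a') \<in> R"
          | "b \<in> Domain R" "(a, a') \<in> R" "(c, c') \<in> R" using ac b E by blast
        then show ?thesis
        proof cases
          case 1
          then have "a = y" "c = y" using only E ac E_neq E_sym by blast+
          then show ?thesis using E by blast
        next
          case 2
          then have "b = y" using only[of b] b E by blast
          then show ?thesis using 2 x'(2) E unfolding U_def by blast
        next
          case 3
          then have "b = y" using only[of b] b E E_sym by blast
          then show ?thesis using 3 x'(2) E E_sym unfolding U_def by blast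
        next
          case 4
          then show ?thesis using partial_isoD(4)[OF iso] E by blast
        qed
      qed
    qed
  qed
qed

text \<open>Regularity leaves room to extend a partial isomorphism by one more neighbour, so a maximal one
  is total.\<close>

lemma extend_to_aut:
  assumes Y: "Y \<noteq> {}"
    and convex: "\<And>n e f. nb_path E n e f \<Longrightarrow> fst e \<in> Y \<Longrightarrow> snd f \<in> Y \<Longrightarrow> snd e \<in> Y"
    and adj: "\<And>x y. x \<in> Y \<Longrightarrow> y \<in> Y \<Longrightarrow> E x y \<Longrightarrow> E (h x) (h y)"
    and inj: "\<And>x y z. x \<in> Y \<Longrightarrow> y \<in> Y \<Longrightarrow> z \<in> Y \<Longrightarrow> E x y \<Longrightarrow> E y z \<Longrightarrow> x \<noteq> z \<Longrightarrow> h x \<noteq> h z"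
  obtains g where "g \<in> carrier (aut_group E)" "\<And>x. x \<in> Y \<Longrightarrow> g x = h x"
proof -
  define R0 where "R0 = (\<lambda>x. (x, h x)) ` Y"
  have D0: "Domain R0 = Y" by (auto simp: R0_def)
  have R0: "(x, x') \<in> R0 \<longleftrightarrow> x \<in> Y \<and> x' = h x" for x x' by (auto simp: R0_def)
  have "single_valued R0" by (rule single_valuedI) (simp add: R0)
  then have "partial_iso R0"
    unfolding partial_iso_def D0 R0 using convex adj inj by blast
  define \<A> where "\<A> = {R. partial_iso R \<and> R0 \<subseteq> R}"
  have "\<exists>M\<in>\<A>. \<forall>R\<in>\<A>. M \<subseteq> R \<longrightarrow> R = M"
  proof (rule subset_Zorn_nonempty)
    show "\<A> \<noteq> {}" using \<open>partial_iso R0\<close> by (auto simp: \<A>_def)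
    fix C assume C: "C \<noteq> {}" "subset.chain \<A> C"
    then have "subset.chain (Collect partial_iso) C" by (auto simp: subset.chain_def \<A>_def)
    then have "partial_iso (\<Union>C)" by (rule partial_iso_chain)
    moreover have "R0 \<subseteq> \<Union>C" using C unfolding subset.chain_def \<A>_def by blast
    ultimately show "\<Union>C \<in> \<A>" by (simp add: \<A>_def)
  qed
  then obtain R where RA: "R \<in> \<A>" and maxA: "\<forall>R'\<in>\<A>. R \<subseteq> R' \<longrightarrow> R' = R" ..
  then have R: "partial_iso R" "R0 \<subseteq> R" by (simp_all add: \<A>_def)
  have max: "R' = R" if "partial_iso R'" "R \<subseteq> R'" for R'
    using maxA that R(2) by (simp add: \<A>_def)
  have total: "x \<in> Domain R" for x
  proof -
    obtain y where "y \<in> Domain R" using Y R D0 by blast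
    with connected_E[of y x] show ?thesis
    proof (induction rule: rtranclp_induct)
      case (step y z)
      show ?case
      proof (rule ccontr)
        assume z: "z \<notin> Domain R"
        obtain y' where "(y, y') \<in> R" using step by blast
        then obtain z' where "partial_iso (insert (z, z') R)"
          using partial_iso_extend[OF R(1) z _ step(2)] by blast
        then show False using max[of "insert (z, z') R"] z by blast
      qed
    qed
  qed
  define g where "g x = (THE x'. (x, x') \<in> R)" for x
  have g: "(x, x') \<in> R \<longleftrightarrow> x' = g x" for x x'
    unfolding g_def using total[of x] partial_isoD(1)[OF R(1)] by (metis DomainE the_equality)
  show thesis
  proof
    show "g \<in> carrier (aut_group E)"
    proof (rule local_injection_aut)
      show "E (g x) (g y)" if "E x y" for x y
        by (rule partial_isoD(3)[OF R(1) _ _ that]) (simp_all add: g)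
      show "g x \<noteq> g z" if "E x y" "E y z" "x \<noteq> z" for x y z
        by (rule partial_isoD(4)[OF R(1) _ _ total that]) (simp_all add: g)
    qed
    show "g x = h x" if "x \<in> Y" for x using that R(2) g[of x "h x"] by (auto simp: R0_def)
  qed
qed

end

section \<open>Lines, rays and the subgroups attached to them\<close>

context tree
begin

lemma line_nb_path:
  assumes "is_line E w"
  shows "nb_path E n (w j, w (j + 1)) (w (j + int n), w (j + int n + 1))"
proof -
  have E: "E (w i) (w (i + 1))" and N: "w i \<noteq> w (i + 2)" for i
    using assms by (auto simp: is_line_def)
  have "nb_path E n (w (j + int 0), w (j + int (Suc 0))) (w (j + int n), w (j + int (Suc n)))"
  proof (rule nb_path_seq)
    fix i
    show "E (w (j + int i)) (w (j + int (Suc i)))" using E[of "j + int i"] by (simp add: ac_simps)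
    show "w (j + int i) \<noteq> w (j + int (Suc (Suc i)))" using N[of "j + int i"] by (simp add: algebra_simps)
  qed
  then show ?thesis by (simp add: ac_simps)
qed

lemma line_inj: "is_line E w \<Longrightarrow> inj w"
proof (rule injI, rule ccontr)
  fix i j assume w: "is_line E w" and ij: "w i = w j" "i \<noteq> j"
  have "w i' \<noteq> w j'" if "i' < j'" for i' j'
  proof -
    have "nb_path E (nat (j' - i' - 1)) (w i', w (i' + 1)) (w (j' - 1), w j')"
      using line_nb_path[OF w, of "nat (j' - i' - 1)" i'] that by simp
    then show ?thesis using nb_path_no_return by fastforce
  qed
  from this[of i j] this[of j i] ij show False by (metis linorder_neqE)
qed

lemma line_eq_iff: "is_line E w \<Longrightarrow> w i = w j \<longleftrightarrow> i = j"
  using line_inj by (auto dest: injD)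

lemma line_adj_iff:
  assumes w: "is_line E w"
  shows "E (w i) (w j) \<longleftrightarrow> j = i + 1 \<or> i = j + 1"
proof
  have *: "j' = i' + 1" if "i' < j'" "E (w i') (w j')" for i' j'
  proof -
    have "nb_path E (nat (j' - i' - 1)) (w i', w (i' + 1)) (w (j' - 1), w j')"
      using line_nb_path[OF w, of "nat (j' - i' - 1)" i'] that by simp
    moreover have "nb_path E 0 (w i', w j') (w i', w j')" using that by simp
    ultimately have "nat (j' - i' - 1) = 0" by (metis nb_path_unique fst_conv snd_conv)
    then show ?thesis using that by simp
  qed
  assume E: "E (w i) (w j)"
  then have "i \<noteq> j" using E_neq by blast
  then show "j = i + 1 \<or> i = j + 1" using *[of i j] *[of j i] E E_sym by (cases i j rule: linorder_cases) auto
next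
  assume "j = i + 1 \<or> i = j + 1"
  then show "E (w i) (w j)" using w E_sym unfolding is_line_def by blast
qed

lemma ray_nb_path:
  assumes "is_ray E w"
  shows "nb_path E n (w j, w (Suc j)) (w (j + n), w (Suc (j + n)))"
  using nb_path_seq[of n E "\<lambda>i. w (j + i)"] assms
  by (simp add: is_ray_def)

lemma ray_Suc: "is_ray E w \<Longrightarrow> is_ray E (\<lambda>n. w (n + k))"
  by (simp add: is_ray_def)

text \<open>Geodesics from the common start to a common later vertex agree, hence so do the first
  edges; the rest is induction on the shifted rays.\<close>

lemma rays_merging_eq:
  assumes "is_ray E w" "is_ray E w'" "w 0 = w' 0" "\<And>n. w (n + a) = w' (n + b)"
  shows "w = w'"
proof
  fix i
  show "w i = w' i"
    using assms
  proof (induction i arbitrary: w w')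
    case (Suc i)
    have "nb_path E a (w 0, w (Suc 0)) (w a, w (Suc a))" "nb_path E b (w' 0, w' (Suc 0)) (w' b, w' (Suc b))"
      using ray_nb_path[OF Suc.prems(1), of a 0] ray_nb_path[OF Suc.prems(2), of b 0] by simp_all
    moreover have "w (Suc a) = w' (Suc b)" using Suc.prems(4)[of 1] by simp
    ultimately have "w (Suc 0) = w' (Suc 0)" using nb_path_unique Suc.prems(3) by fastforce
    then have "w (i + 1) = w' (i + 1)"
      using Suc.IH[OF ray_Suc[OF Suc.prems(1), of 1] ray_Suc[OF Suc.prems(2), of 1]]
        Suc.prems(4)[of "Suc n" for n] by simp
    then show ?case by simp
  qed auto
qed

lemma aut_line: "g \<in> carrier (aut_group E) \<Longrightarrow> is_line E w \<Longrightarrow> is_line E (\<lambda>j. g (w j))"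
  unfolding is_line_def by (simp add: aut_adj inj_eq[OF aut_inj])

lemma aut_ray: "g \<in> carrier (aut_group E) \<Longrightarrow> is_ray E w \<Longrightarrow> is_ray E (g \<circ> w)"
  unfolding is_ray_def by (simp add: aut_adj inj_eq[OF aut_inj])

end

locale tree_line = regular_tree E q for E :: "'v \<Rightarrow> 'v \<Rightarrow> bool" and q +
  fixes v :: "int \<Rightarrow> 'v"
  assumes line: "is_line E v"
begin

abbreviation Aut :: "('v \<Rightarrow> 'v) set" where "Aut \<equiv> carrier (aut_group E)"

lemma v_eq_iff [simp]: "v i = v j \<longleftrightarrow> i = j"
  using line_eq_iff[OF line] .

text \<open>One signed shift replaces the two offsets in \<open>parallel_rays\<close>, so that
  translations in either direction simply add to \<open>c\<close>.\<close>

lemma line_cusp_iff: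
  "w \<in> line_cusp E v \<longleftrightarrow> is_ray E w \<and> (\<exists>c i0. \<forall>i\<ge>i0. w i = v (int i + c))"
proof -
  have "(\<exists>k m. \<forall>n. v (int (n + k)) = w (n + m)) \<longleftrightarrow> (\<exists>c i0. \<forall>i\<ge>i0. w i = v (int i + c))"
  proof (intro iffI; elim exE)
    fix k m assume km: "\<forall>n. v (int (n + k)) = w (n + m)"
    have "w i = v (int i + (int k - int m))" if "m \<le> i" for i
      using km[rule_format, of "i - m"] that by (simp add: algebra_simps)
    then show "\<exists>c i0. \<forall>i\<ge>i0. w i = v (int i + c)" by blast
  next
    fix c i0 assume c: "\<forall>i\<ge>i0. w i = v (int i + c)"
    define m where "m = i0 + nat (- c)"
    have "v (int (n + nat (int m + c))) = w (n + m)" for n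
      using c[rule_format, of "n + m"] by (simp add: m_def algebra_simps)
    then show "\<exists>k m. \<forall>n. v (int (n + k)) = w (n + m)" by blast
  qed
  then show ?thesis by (simp add: line_cusp_def cusp_of_def parallel_rays_def)
qed

lemma line_cusp_unique:
  assumes "w \<in> line_cusp E v" "w' \<in> line_cusp E v" "w 0 = w' 0"
  shows "w = w'"
proof -
  obtain c i c' i' where w: "\<And>n. n \<ge> i \<Longrightarrow> w n = v (int n + c)" "\<And>n. n \<ge> i' \<Longrightarrow> w' n = v (int n + c')"
    using assms(1,2) unfolding line_cusp_iff by metis
  define a where "a = i + i' + nat (c' - c)"
  define b where "b = i + i' + nat (c - c')"
  have "w (n + a) = w' (n + b)" for n
    using w(1)[of "n + a"] w(2)[of "n + b"] by (simp add: a_def b_def)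
  then show ?thesis using rays_merging_eq assms line_cusp_iff by metis
qed

lemma line_ray: "(\<lambda>n. v (int n + c)) \<in> line_cusp E v"
proof -
  have "E (v (int n + c)) (v (int n + c + 1))" "v (int n + c) \<noteq> v (int n + c + 2)" for n
    using line by (auto simp: is_line_def)
  then have "is_ray E (\<lambda>n. v (int n + c))"
    unfolding is_ray_def by (simp add: ac_simps)
  then show ?thesis unfolding line_cusp_iff by blast
qed

lemma line_cusp_tail:
  assumes "w \<in> line_cusp E v"
  shows "(\<lambda>n. w (n + k)) \<in> line_cusp E v"
proof -
  obtain c i where "\<And>n. n \<ge> i \<Longrightarrow> w n = v (int n + c)" using assms line_cusp_iff by metis
  then have "w (n + k) = v (int n + (c + int k))" if "n \<ge> i" for n
    using that by (simp add: algebra_simps)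
  then show ?thesis using assms ray_Suc unfolding line_cusp_iff by blast
qed

text \<open>Induction along a walk from the line: for a neighbour \<open>x\<close> of
  \<open>y\<close>, either the ray from \<open>y\<close> passes through \<open>x\<close> first and
  loses its start, or \<open>x\<close> is put in front of it.\<close>

lemma line_cusp_exists: "\<exists>w \<in> line_cusp E v. w 0 = x"
  using connected_E[of "v 0" x]
proof (induction rule: rtranclp_induct)
  case base
  show ?case using line_ray[of 0] by (intro bexI[of _ "\<lambda>n. v (int n + 0)"]) simp_all
next
  case (step y x)
  then obtain w where w: "w \<in> line_cusp E v" "w 0 = y" by blast
  show ?case
  proof (cases "x = w 1")
    case True
    then show ?thesis using line_cusp_tail[OF w(1), of 1] by force
  next
    case False
    define w' where "w' = case_nat x w"
    obtain c i where ci: "\<And>n. n \<ge> i \<Longrightarrow> w n = v (int n + c)" using w line_cusp_iff by metis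
    have "w' n = v (int n + (c - 1))" if n: "n \<ge> Suc i" for n
    proof -
      obtain m where "n = Suc m" "m \<ge> i" using n by (metis Suc_le_D Suc_le_mono)
      then show ?thesis using ci[of m] by (simp add: w'_def)
    qed
    moreover have "is_ray E w'"
      unfolding is_ray_def
    proof
      fix j
      have "is_ray E w" using w line_cusp_iff by blast
      then show "E (w' j) (w' (j + 1)) \<and> w' j \<noteq> w' (j + 2)"
        using False step(2) w(2) E_sym by (cases j) (auto simp: w'_def is_ray_def)
    qed
    ultimately have "w' \<in> line_cusp E v" unfolding line_cusp_iff by blast
    then show ?thesis by (intro bexI[of _ w']) (simp_all add: w'_def)
  qed
qed

lemma ray_from_eqI: "w \<in> line_cusp E v \<Longrightarrow> w 0 = x \<Longrightarrow> ray_from E v x = w"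
  unfolding ray_from_def using line_cusp_unique by (intro the_equality) auto

lemma ray_from: "ray_from E v x \<in> line_cusp E v" "ray_from E v x 0 = x"
  using line_cusp_exists[of x] ray_from_eqI by auto

lemma ray_from_tail: "ray_from E v (ray_from E v x k) = (\<lambda>n. ray_from E v x (n + k))"
  by (rule ray_from_eqI) (simp_all add: line_cusp_tail ray_from)

lemma line_cusp_shift:
  assumes g: "g \<in> Aut" and c: "\<And>m. m \<ge> n \<Longrightarrow> g (v m) = v (m + c)" and w: "w \<in> line_cusp E v"
  shows "g \<circ> w \<in> line_cusp E v"
proof -
  obtain d i where w': "\<And>l. l \<ge> i \<Longrightarrow> w l = v (int l + d)" using w line_cusp_iff by metis
  have "(g \<circ> w) l = v (int l + (d + c))" if "l \<ge> i + nat (n - d)" for l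
    using w'[of l] c[of "int l + d"] that by (simp add: ac_simps)
  moreover have "is_ray E (g \<circ> w)" using aut_ray[OF g] w line_cusp_iff by blast
  ultimately show ?thesis unfolding line_cusp_iff by blast
qed

lemma cusp_stabilizer_iff:
  "g \<in> cusp_stabilizer E v \<longleftrightarrow> g \<in> Aut \<and> (\<exists>c n. \<forall>m\<ge>n. g (v m) = v (m + c))"
proof (intro iffI; (elim conjE exE)?)
  assume g: "g \<in> cusp_stabilizer E v"
  then have "g \<circ> (\<lambda>n. v (int n + 0)) \<in> line_cusp E v"
    using line_ray[of 0] unfolding cusp_stabilizer_def by blast
  then obtain c i where ci: "\<And>n. n \<ge> i \<Longrightarrow> g (v (int n)) = v (int n + c)"
    unfolding line_cusp_iff by auto
  have "g (v m) = v (m + c)" if "m \<ge> int i" for m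
    using ci[of "nat m"] that by simp
  then show "g \<in> Aut \<and> (\<exists>c n. \<forall>m\<ge>n. g (v m) = v (m + c))"
    using g unfolding cusp_stabilizer_def by blast
next
  fix c n assume g: "g \<in> Aut" and c: "\<forall>m\<ge>n. g (v m) = v (m + c)"
  have inv: "inv_into UNIV g (v m) = v (m + (- c))" if "m \<ge> n + c" for m
  proof -
    have "g (v (m - c)) = v m" using c that by (auto dest: spec[of _ "m - c"])
    then show ?thesis using aut_inv_apply(1)[OF g, of "v (m - c)"] by simp
  qed
  have "(\<lambda>w. g \<circ> w) ` line_cusp E v = line_cusp E v"
  proof (intro equalityI subsetI)
    fix w assume "w \<in> (\<lambda>w. g \<circ> w) ` line_cusp E v"
    then show "w \<in> line_cusp E v" using line_cusp_shift[OF g] c by blast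
  next
    fix w assume "w \<in> line_cusp E v"
    then have "inv_into UNIV g \<circ> w \<in> line_cusp E v"
      using line_cusp_shift[OF aut_inv[OF g] inv] by blast
    moreover have "w = g \<circ> (inv_into UNIV g \<circ> w)" using g by (simp add: fun_eq_iff)
    ultimately show "w \<in> (\<lambda>w. g \<circ> w) ` line_cusp E v" by blast
  qed
  then show "g \<in> cusp_stabilizer E v" using g by (simp add: cusp_stabilizer_def)
qed

section \<open>Stabilizers of rays and the subgroups \<open>S\<close>, \<open>L\<close> and
  \<open>M\<close>\<close>

definition ray_fixer :: "int \<Rightarrow> ('v \<Rightarrow> 'v) set" where
  "ray_fixer n = {g \<in> Aut. \<forall>m\<ge>n. g (v m) = v m}"

lemma ray_fixerD: "g \<in> ray_fixer n \<Longrightarrow> g \<in> Aut" "g \<in> ray_fixer n \<Longrightarrow> n \<le> m \<Longrightarrow> g (v m) = v m"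
  by (auto simp: ray_fixer_def)

lemma ray_fixer_comp: "g \<in> ray_fixer n \<Longrightarrow> h \<in> ray_fixer n \<Longrightarrow> g \<circ> h \<in> ray_fixer n"
  by (auto simp: ray_fixer_def aut_comp)

lemma ray_fixer_inv:
  assumes "g \<in> ray_fixer n"
  shows "inv_into UNIV g \<in> ray_fixer n"
proof -
  have "inv_into UNIV g (v m) = v m" if "m \<ge> n" for m
    using aut_inv_apply(1)[OF ray_fixerD(1)[OF assms], of "v m"] ray_fixerD(2)[OF assms that] by simp
  then show ?thesis using aut_inv[OF ray_fixerD(1)[OF assms]] by (simp add: ray_fixer_def)
qed

lemma ray_fixer_mono: "n \<le> m \<Longrightarrow> ray_fixer n \<subseteq> ray_fixer m"
  by (auto simp: ray_fixer_def)

text \<open>If \<open>g\<close> preserves horospheres, the ray from \<open>v 0\<close> and its image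
  coincide at some common index, which excludes a nonzero shift; so \<open>g\<close> fixes the line
  from there on.\<close>

lemma horo_subgroup_eq: "horo_subgroup E v = (\<Union>n. ray_fixer n)"
proof (intro equalityI subsetI)
  fix g assume g: "g \<in> horo_subgroup E v"
  then have G: "g \<in> Aut" and st: "g \<in> cusp_stabilizer E v"
    by (auto simp: horo_subgroup_def cusp_stabilizer_iff)
  have ray: "ray_from E v (g x) = g \<circ> ray_from E v x" for x
  proof (rule ray_from_eqI)
    show "g \<circ> ray_from E v x \<in> line_cusp E v"
      using st ray_from(1)[of x] unfolding cusp_stabilizer_def by blast
  qed (simp add: ray_from)
  have "v 0 \<in> horosphere E v (v 0)" by (simp add: horosphere_def)
  then have "g (v 0) \<in> horosphere E v (v 0)" using g by (auto simp: horo_subgroup_def)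
  then obtain n where "ray_from E v (v 0) n = g (ray_from E v (v 0) n)"
    using ray by (auto simp: horosphere_def)
  moreover have "ray_from E v (v c) = (\<lambda>n. v (int n + c))" for c
    by (rule ray_from_eqI) (simp_all add: line_ray)
  ultimately have "g (v (int i + int n)) = v (int i + int n)" for i
    using fun_cong[OF ray[of "v (int n)"], of i] by simp
  then have "g (v m) = v m" if "m \<ge> int n" for m
    using that by (metis add.commute le_add_diff_inverse2 nat_0_le diff_ge_0_iff_ge)
  then show "g \<in> (\<Union>n. ray_fixer n)" using G by (auto simp: ray_fixer_def)
next
  fix g assume "g \<in> (\<Union>n. ray_fixer n)"
  then obtain n where g: "g \<in> ray_fixer n" by blast
  have sub: "h ` horosphere E v x \<subseteq> horosphere E v x" if h: "h \<in> ray_fixer n" for h x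
  proof
    fix z assume "z \<in> h ` horosphere E v x"
    then obtain y where y: "z = h y" "y \<in> horosphere E v x" by blast
    then obtain k where "ray_from E v x k = ray_from E v y k" by (auto simp: horosphere_def)
    then have k: "ray_from E v x (i + k) = ray_from E v y (i + k)" for i
      using ray_from_tail[of x k] ray_from_tail[of y k] by metis
    obtain c i0 where c: "\<And>i. i \<ge> i0 \<Longrightarrow> ray_from E v x i = v (int i + c)"
      using ray_from(1)[of x] line_cusp_iff by metis
    have "ray_from E v z = h \<circ> ray_from E v y" unfolding y(1)
    proof (rule ray_from_eqI)
      show "h \<circ> ray_from E v y \<in> line_cusp E v"
        using line_cusp_shift[of h n 0] h ray_from(1) by (simp add: ray_fixer_def)
    qed (simp add: ray_from)
    \<comment> \<open>Late enough that the ray from \<open>x\<close> has reached the line beyond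
      \<open>v n\<close>, where \<open>h\<close> is the identity.\<close>
    moreover define i where "i = i0 + nat (n - c)"
    have "h (ray_from E v y (i + k)) = ray_from E v x (i + k)"
      unfolding k[symmetric] using c[of "i + k"] by (simp add: i_def ray_fixerD(2)[OF h])
    ultimately show "z \<in> horosphere E v x" by (auto simp: horosphere_def intro!: exI[of _ "i + k"])
  qed
  have "g ` horosphere E v x = horosphere E v x" for x
  proof
    show "horosphere E v x \<subseteq> g ` horosphere E v x"
    proof
      fix y assume "y \<in> horosphere E v x"
      then have "inv_into UNIV g y \<in> horosphere E v x" using sub[OF ray_fixer_inv[OF g]] by blast
      then show "y \<in> g ` horosphere E v x" using ray_fixerD(1)[OF g] by (metis aut_inv_apply(2) imageI)
    qed
  qed (rule sub[OF g])
  moreover have "g \<in> cusp_stabilizer E v"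
  proof -
    have "\<forall>m\<ge>n. g (v m) = v (m + 0)" using g by (simp add: ray_fixer_def)
    then show ?thesis using ray_fixerD(1)[OF g] unfolding cusp_stabilizer_iff by blast
  qed
  ultimately show "g \<in> horo_subgroup E v" by (simp add: horo_subgroup_def)
qed

text \<open>Fixing the cusp excludes reflections. An element translates the line far out, and
  backwards along the line each image is forced, being the neighbour on the line that is not already
  taken.\<close>

lemma line_subgroup_iff: "g \<in> line_subgroup E v \<longleftrightarrow> g \<in> Aut \<and> (\<exists>c. \<forall>j. g (v j) = v (j + c))"
proof (intro iffI; (elim conjE exE)?)
  assume g: "g \<in> line_subgroup E v"
  then obtain c n where G: "g \<in> Aut" and c: "\<And>m. m \<ge> n \<Longrightarrow> g (v m) = v (m + c)"
    unfolding line_subgroup_def mem_Collect_eq cusp_stabilizer_iff by blast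
  have backwards: "g (v (n - int i)) = v (n - int i + c) \<and> g (v (n - int i + 1)) = v (n - int i + 1 + c)" for i
  proof (induction i)
    case 0
    then show ?case using c by simp
  next
    case (Suc i)
    let ?j = "n - int i"
    have "g (v (?j - 1)) \<in> range v" using g by (auto simp: line_subgroup_def)
    then obtain l where l: "g (v (?j - 1)) = v l" by blast
    have "E (v (?j - 1)) (v ?j)" using line_adj_iff[OF line] by simp
    then have "E (v l) (v (?j + c))" using aut_adj[OF G, of "v (?j - 1)" "v ?j"] l Suc by simp
    then have "l = ?j + c - 1 \<or> l = ?j + c + 1" using line_adj_iff[OF line] by auto
    moreover have "g (v (?j - 1)) \<noteq> g (v (?j + 1))" by (simp add: inj_eq[OF aut_inj[OF G]])
    ultimately have "l = ?j + c - 1" using l Suc by (auto simp: ac_simps)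
    then show ?case using l Suc by (simp add: algebra_simps)
  qed
  have "g (v j) = v (j + c)" for j
    using backwards[of "nat (n - j)"] c[of j] by (cases "j \<ge> n") auto
  then show "g \<in> Aut \<and> (\<exists>c. \<forall>j. g (v j) = v (j + c))" using G by blast
next
  fix c assume g: "g \<in> Aut" and c: "\<forall>j. g (v j) = v (j + c)"
  have "g ` range v = range v"
  proof
    show "range v \<subseteq> g ` range v"
    proof
      fix x assume "x \<in> range v"
      then obtain j where "x = v j" by blast
      then have "x = g (v (j - c))" using c by simp
      then show "x \<in> g ` range v" by blast
    qed
  qed (use c in auto)
  moreover have "g \<in> cusp_stabilizer E v" unfolding cusp_stabilizer_iff using g c by blast
  ultimately show "g \<in> line_subgroup E v" by (simp add: line_subgroup_def)
qed

lemma line_shift_eqI: "(\<And>j. a (v j) = v (j + c)) \<Longrightarrow> line_shift v a = c"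
  unfolding line_shift_def by (rule the_equality) auto

lemma line_subgroup_shift: "a \<in> line_subgroup E v \<Longrightarrow> a (v j) = v (j + line_shift v a)"
  using line_subgroup_iff line_shift_eqI by metis

lemma line_fixer_iff: "g \<in> line_fixer E v \<longleftrightarrow> g \<in> Aut \<and> (\<forall>j. g (v j) = v j)"
proof
  assume "g \<in> line_fixer E v"
  then have L: "g \<in> line_subgroup E v" and "g \<in> horo_subgroup E v" by (auto simp: line_fixer_def)
  then obtain n where "g \<in> ray_fixer n" by (auto simp: horo_subgroup_eq)
  then have "g (v n) = v n" by (auto simp: ray_fixer_def)
  then have "line_shift v g = 0" using line_subgroup_shift[OF L, of n] by simp
  then show "g \<in> Aut \<and> (\<forall>j. g (v j) = v j)"
    using L line_subgroup_shift[OF L] line_subgroup_iff by auto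
next
  assume g: "g \<in> Aut \<and> (\<forall>j. g (v j) = v j)"
  then have "g \<in> line_subgroup E v" unfolding line_subgroup_iff by (auto intro!: exI[of _ 0])
  moreover have "g \<in> ray_fixer 0" using g by (auto simp: ray_fixer_def)
  ultimately show "g \<in> line_fixer E v" by (auto simp: line_fixer_def horo_subgroup_eq)
qed

text \<open>Cosets of \<open>M\<close> in \<open>L\<close> are classified by the shift, so
  \<open>line_shift\<close> is injective on the image of a section. The carrier \<open>L\<close> is
  arbitrary because a right coset uses only the multiplication.\<close>

lemma line_fixer_coset:
  assumes a: "a \<in> line_subgroup E v"
  shows "line_fixer E v #>\<^bsub>(aut_group E)\<lparr>carrier := L\<rparr>\<^esub> a = {g \<in> Aut. \<forall>j. g (v j) = v (j + line_shift v a)}"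
proof -
  have G: "a \<in> Aut" using a line_subgroup_iff by blast
  show ?thesis
  proof (intro equalityI subsetI)
    fix g assume "g \<in> line_fixer E v #>\<^bsub>(aut_group E)\<lparr>carrier := L\<rparr>\<^esub> a"
    then obtain m where "m \<in> line_fixer E v" "g = m \<circ> a" by (auto simp: r_coset_def)
    then show "g \<in> {g \<in> Aut. \<forall>j. g (v j) = v (j + line_shift v a)}"
      using G line_subgroup_shift[OF a] by (auto simp: line_fixer_iff aut_comp)
  next
    fix g assume g: "g \<in> {g \<in> Aut. \<forall>j. g (v j) = v (j + line_shift v a)}"
    define m where "m = g \<circ> inv_into UNIV a"
    have "m (v j) = v j" for j
    proof -
      have "a (v (j - line_shift v a)) = v j" using line_subgroup_shift[OF a] by simp
      then have "inv_into UNIV a (v j) = v (j - line_shift v a)" using aut_inv_apply(1)[OF G] by metis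
      then show ?thesis using g by (simp add: m_def)
    qed
    then have "m \<in> line_fixer E v" using g G by (auto simp: line_fixer_iff m_def aut_comp aut_inv)
    moreover have "g = m \<circ> a" using G by (auto simp: m_def fun_eq_iff)
    ultimately show "g \<in> line_fixer E v #>\<^bsub>(aut_group E)\<lparr>carrier := L\<rparr>\<^esub> a" by (auto simp: r_coset_def)
  qed
qed

lemma splitting_image_shift:
  assumes A: "splitting_image E v A"
  shows "A \<subseteq> line_subgroup E v" and "inj_on (line_shift v) A"
proof -
  define L where "L = (aut_group E)\<lparr>carrier := line_subgroup E v\<rparr>"
  obtain s where s: "s \<in> hom (L Mod line_fixer E v) L"
    and sec: "\<And>C. C \<in> carrier (L Mod line_fixer E v) \<Longrightarrow> line_fixer E v #>\<^bsub>L\<^esub> s C = C"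
    and As: "A = s ` carrier (L Mod line_fixer E v)"
    using A unfolding splitting_image_def Let_def L_def by blast
  show sub: "A \<subseteq> line_subgroup E v"
    using s unfolding As hom_def by (auto simp: L_def)
  show "inj_on (line_shift v) A"
  proof (rule inj_onI)
    fix a b assume ab: "a \<in> A" "b \<in> A" "line_shift v a = line_shift v b"
    then obtain C D where C: "C \<in> carrier (L Mod line_fixer E v)" "a = s C"
      and D: "D \<in> carrier (L Mod line_fixer E v)" "b = s D" by (auto simp: As)
    have coset: "line_fixer E v #>\<^bsub>L\<^esub> c = {g \<in> Aut. \<forall>j. g (v j) = v (j + line_shift v c)}" if "c \<in> A" for c
      unfolding L_def by (rule line_fixer_coset) (use sub that in blast)
    have "line_fixer E v #>\<^bsub>L\<^esub> a = line_fixer E v #>\<^bsub>L\<^esub> b"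
      using coset[OF ab(1)] coset[OF ab(2)] ab(3) by simp
    then show "a = b" using sec[OF C(1)] sec[OF D(1)] C(2) D(2) by simp
  qed
qed

end

section \<open>Axes of translations\<close>

context tree
begin

lemma path_dist_commute: "path_dist E x y = path_dist E y x"
proof (cases "path_dist E x y")
  case 0
  show ?thesis
  proof (cases "x = y")
    case False
    then obtain n e f where "nb_path E n e f" "fst e = x" "snd f = y" by (rule nb_path_exists)
    then show ?thesis using 0 path_dist_nb_path by fastforce
  qed simp
next
  case (Suc n)
  then obtain e f where "nb_path E n e f" "fst e = x" "snd f = y" using path_dist_eq_Suc_iff by blast
  then show ?thesis
    using Suc path_dist_nb_path[OF nb_path_rev[of n e f]] by simp
qed

lemma line_reverse: "is_line E w \<Longrightarrow> is_line E (\<lambda>j. w (- j))"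
  unfolding is_line_def
proof
  fix j assume w: "\<forall>j. E (w j) (w (j + 1)) \<and> w j \<noteq> w (j + 2)"
  then have "E (w (- (j + 1))) (w (- (j + 1) + 1))" "w (- (j + 2)) \<noteq> w (- (j + 2) + 2)" by blast+
  then show "E (w (- j)) (w (- (j + 1))) \<and> w (- j) \<noteq> w (- (j + 2))" using E_sym by auto
qed

lemma nb_path_between_line:
  assumes w: "is_line E w" and p: "nb_path E n e f" "fst e = w i" "snd f = w j"
  shows "i < j \<and> snd e = w (i + 1) \<and> j = i + int n + 1 \<or> j < i \<and> snd e = w (i - 1)"
proof (cases i j rule: linorder_cases)
  case less
  have "nb_path E (nat (j - i - 1)) (w i, w (i + 1)) (w (j - 1), w j)"
    using line_nb_path[OF w, of "nat (j - i - 1)" i] less by simp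
  from nb_path_unique[OF p(1) this] p show ?thesis using less by auto
next
  case equal
  then show ?thesis using nb_path_no_return[OF p(1)] p by simp
next
  case greater
  have "nb_path E (nat (i - j - 1)) (w i, w (i - 1)) (w (j + 1), w j)"
    using line_nb_path[OF line_reverse[OF w], of "nat (i - j - 1)" "- i"] greater
    by (simp add: add.commute)
  from nb_path_unique[OF p(1) this] p show ?thesis using greater by auto
qed

lemma path_dist_on_axis:
  assumes w: "is_line E w" and shift: "\<And>j. g (w j) = w (j + int k)" and k: "0 < k"
  shows "path_dist E (w j) (g (w j)) = k"
  using path_dist_nb_path[OF line_nb_path[OF w, of "k - 1" j]] k
  by (simp add: shift of_nat_diff)

text \<open>The geodesic from \<open>x\<close> to \<open>g x\<close> goes \<open>n + 1\<close> edges
  to the axis, \<open>k\<close> along it, and \<open>n + 1\<close> away again; nothing cancels at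
  the two junctions, so its length is \<open>k + 2 (n + 1)\<close>.\<close>

lemma path_dist_off_axis:
  assumes g: "g \<in> carrier (aut_group E)" and w: "is_line E w"
    and shift: "\<And>j. g (w j) = w (j + int k)" and k: "0 < k" and x: "x \<notin> range w"
  shows "path_dist E x (g x) > k"
proof -
  define P where "P n \<longleftrightarrow> (\<exists>e f. nb_path E n e f \<and> fst e = x \<and> snd f \<in> range w)" for n
  have "x \<noteq> w 0" using x by blast
  then obtain n0 e0 f0 where "nb_path E n0 e0 f0" "fst e0 = x" "snd f0 = w 0" by (rule nb_path_exists)
  then have "P n0" unfolding P_def by blast
  \<comment> \<open>Minimality keeps the last vertex before the axis off the axis, which is what
    excludes backtracking at the junctions.\<close>
  define n where "n = (LEAST n. P n)"
  have "P n" unfolding n_def using \<open>P n0\<close> by (rule LeastI)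
  then obtain e f i where p: "nb_path E n e f" "fst e = x" "snd f = w i" unfolding P_def by blast
  have off: "fst f \<notin> range w"
  proof (cases n)
    case 0
    then show ?thesis using p x by auto
  next
    case (Suc m)
    then obtain h where "nb_path E m e h" "nb_step E h f" using p nb_path_Suc by blast
    then have "P m" if "fst f \<in> range w"
      unfolding P_def using that p(2) by (metis nb_step_def)
    moreover have "\<not> P m" using Suc not_less_Least[of m P] by (simp add: n_def)
    ultimately show ?thesis by blast
  qed
  let ?g = "map_prod g g"
  have offg: "g (fst f) \<notin> range w"
  proof
    assume "g (fst f) \<in> range w"
    then obtain j where "g (fst f) = w j" by blast
    then have "g (fst f) = g (w (j - int k))" using shift by simp
    then show False using off inj_eq[OF aut_inj[OF g]] by auto
  qed
  have Ef: "E (fst f) (snd f)" using nb_path_edges[OF p(1)] by blast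
  then have Egf: "E (g (fst f)) (g (snd f))" by (simp add: aut_adj[OF g])
  have 1: "nb_step E f (w i, w (i + 1))"
    using Ef p off line_adj_iff[OF w] by (auto simp: nb_step_def)
  have 2: "nb_path E (k - 1) (w i, w (i + 1)) (w (i + int k - 1), w (i + int k))"
    using line_nb_path[OF w, of "k - 1" i] k by (simp add: of_nat_diff algebra_simps)
  have 3: "nb_step E (w (i + int k - 1), w (i + int k)) (prod.swap (?g f))"
  proof -
    have "w (i + int k - 1) \<noteq> g (fst f)" using offg by (metis rangeI)
    then show ?thesis
      using p shift Egf E_sym line_adj_iff[OF w] by (auto simp: nb_step_def)
  qed
  have 4: "nb_path E n (prod.swap (?g f)) (prod.swap (?g e))"
    by (intro nb_path_rev nb_path_aut[OF g] p)
  have "nb_path E (n + (k - 1) + 1 + n + 1) e (prod.swap (?g e))"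
    by (rule nb_path_join[OF nb_path_join[OF p(1) 1 2] 3 4])
  from path_dist_nb_path[OF this] show ?thesis using p by simp
qed

lemma displacement_axis:
  assumes "g \<in> carrier (aut_group E)" "is_line E w" "\<And>j. g (w j) = w (j + int k)" "0 < k"
  shows "displacement E g = k"
  unfolding displacement_def
proof (rule Least_equality)
  show "\<exists>x. k = path_dist E (g x) x"
    using path_dist_on_axis[OF assms(2-4)] path_dist_commute by metis
  show "k \<le> n" if "\<exists>x. n = path_dist E (g x) x" for n
    using that path_dist_on_axis[OF assms(2-4)] path_dist_off_axis[OF assms] path_dist_commute
    by (metis less_imp_le order_refl rangeE)
qed

text \<open>With \<open>k\<close> steps from \<open>e\<close> to its translate, the first vertex of
  \<open>e\<close> is moved by exactly \<open>k\<close>, so it is on the axis; the direction of the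
  path makes \<open>e\<close> point along the translation.\<close>

lemma nb_path_translate_on_axis:
  assumes g: "g \<in> carrier (aut_group E)" and w: "is_line E w"
    and shift: "\<And>j. g (w j) = w (j + int k)" and k: "0 < k"
    and p: "nb_path E k e (map_prod g g e)"
  obtains j where "e = (w j, w (j + 1))"
proof -
  obtain m where m: "k = Suc m" using k by (cases k) auto
  obtain h where h: "nb_path E m e h" "nb_step E h (map_prod g g e)" using p m nb_path_Suc by blast
  then have "path_dist E (fst e) (g (fst e)) = k" and sh: "snd h = g (fst e)"
    using path_dist_nb_path[OF h(1)] m by (simp_all add: nb_step_def)
  then have "fst e \<in> range w" using path_dist_off_axis[OF g w shift k] by fastforce
  then obtain j where j: "fst e = w j" by blast
  then have "snd h = w (j + int k)" using sh shift by simp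
  then have "snd e = w (j + 1)" using nb_path_between_line[OF w h(1) j, of "j + int k"] by simp
  with j show thesis using that by (metis prod.collapse)
qed

text \<open>The translates of the given path under the powers of \<open>g\<close> fit together to a
  line: the last edge of each piece is the first edge of the next, so no backtracking arises where
  they meet.\<close>

lemma axis_exists:
  assumes g: "g \<in> carrier (aut_group E)" and k: "0 < k" and p: "nb_path E k e (map_prod g g e)"
  obtains w where "is_line E w" "\<And>j. g (w j) = w (j + int k)" "e = (w 0, w 1)"
proof -
  obtain p where p: "e = (p 0, p (Suc 0))" "map_prod g g e = (p k, p (Suc k))"
    "\<And>i. i \<le> k \<Longrightarrow> E (p i) (p (Suc i))" "\<And>i. i < k \<Longrightarrow> p i \<noteq> p (Suc (Suc i))"
    using nb_path_obtain_seq[OF p] by metis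
  then have pk: "p k = g (p 0)" "p (Suc k) = g (p 1)" by auto
  interpret group "aut_group E" by (rule group_aut_group)
  define G where "G z = g [^]\<^bsub>aut_group E\<^esub> z" for z :: int
  have G: "G z \<in> carrier (aut_group E)" for z using g by (simp add: G_def)
  have G1: "G (z + 1) x = G z (g x)" "G (1 + z) x = g (G z x)" for z x
    using int_pow_mult[OF g, of z 1] int_pow_mult[OF g, of 1 z] g
    by (simp_all add: G_def int_pow_1)
  have G0: "G 0 = id" by (simp add: G_def)
  define w where "w j = G (j div int k) (p (nat (j mod int k)))" for j
  have w0: "w (int k * z + int r) = G z (p r)" if "r < k" for z r
    using that by (simp add: w_def)
  \<comment> \<open>The formula is needed up to \<open>r = k + 1\<close>, because the conditions on
    a line look two vertices ahead. For \<open>k = 1\<close> this advances by two periods, hence the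
    separate case.\<close>
  have wk: "w (int k * z + int r) = G z (p r)" if r: "r \<le> Suc k" for z r
  proof -
    consider "r < k" | "r = k" | "r = Suc k" using r by linarith
    then show ?thesis
    proof cases
      case 1
      then show ?thesis by (rule w0)
    next
      case 2
      have "w (int k * z + int r) = w (int k * (z + 1) + int 0)" using 2 by (simp add: algebra_simps)
      then show ?thesis using w0[of 0 "z + 1"] k G1(1) pk 2 by simp
    next
      case 3
      show ?thesis
      proof (cases "k = 1")
        case True
        have "int k * z + int r = int k * (z + 1 + 1) + int 0" using 3 True by simp
        then have "w (int k * z + int r) = G (z + 1 + 1) (p 0)" using w0[OF k] by presburger
        also have "\<dots> = G z (g (g (p 0)))" by (simp only: G1)
        finally show ?thesis using pk 3 True by simp
      next
        case False
        then have "1 < k" using k by simp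
        have "int k * z + int r = int k * (z + 1) + int 1" using 3 by (simp add: algebra_simps)
        then have "w (int k * z + int r) = G (z + 1) (p 1)" using w0[OF \<open>1 < k\<close>] by presburger
        also have "\<dots> = G z (g (p 1))" by (simp only: G1)
        finally show ?thesis using pk 3 by simp
      qed
    qed
  qed
  have w_shift: "g (w j) = w (j + int k)" for j
  proof -
    have "(j + int k) div int k = 1 + j div int k" "(j + int k) mod int k = j mod int k" using k by simp_all
    then show ?thesis by (simp add: w_def G1)
  qed
  have "is_line E w"
    unfolding is_line_def
  proof
    fix j
    define z where "z = j div int k"
    define r where "r = nat (j mod int k)"
    have r: "r < k" "j = int k * z + int r" using k by (simp_all add: r_def z_def nat_less_iff)
    then have "w j = G z (p r)" "w (j + 1) = G z (p (Suc r))" "w (j + 2) = G z (p (Suc (Suc r)))"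
      using wk[of r z] wk[of "Suc r" z] wk[of "Suc (Suc r)" z] by (simp_all add: ac_simps)
    then show "E (w j) (w (j + 1)) \<and> w j \<noteq> w (j + 2)"
      using p(3)[of r] p(4)[of r] r(1) by (simp add: aut_adj[OF G] inj_eq[OF aut_inj[OF G]])
  qed
  moreover have "e = (w 0, w 1)" using wk[of 0 0] wk[of 1 0] p(1) G0 by simp
  ultimately show thesis using that w_shift by blast
qed

lemma line_translate_path:
  assumes "is_line E w" "\<And>j. g (w j) = w (j + int k)"
  shows "nb_path E k (w j, w (j + 1)) (map_prod g g (w j, w (j + 1)))"
  using line_nb_path[OF assms(1), of k j] assms(2) by (simp add: ac_simps)

text \<open>\<open>h\<close> carries a path from an edge to its \<open>g\<close>-translate to
  another such path, so axis edges go to axis edges with their direction kept. A map of the line of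
  this kind is a shift.\<close>

lemma commuting_shift:
  assumes g: "g \<in> carrier (aut_group E)" and w: "is_line E w"
    and shift: "\<And>j. g (w j) = w (j + int k)" and k: "0 < k"
    and h: "h \<in> carrier (aut_group E)" and comm: "g \<circ> h = h \<circ> g"
  obtains i where "\<And>j. h (w j) = w (j + i)"
proof -
  have "\<exists>l. h (w j) = w l \<and> h (w (j + 1)) = w (l + 1)" for j
  proof -
    have "nb_path E k (map_prod h h (w j, w (j + 1))) (map_prod h h (map_prod g g (w j, w (j + 1))))"
      by (intro nb_path_aut[OF h] line_translate_path w shift)
    then have "nb_path E k (h (w j), h (w (j + 1))) (map_prod g g (h (w j), h (w (j + 1))))"
      using fun_cong[OF comm] by simp
    from nb_path_translate_on_axis[OF g w shift k this] show ?thesis by (metis prod.inject)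
  qed
  then obtain l where l: "\<And>j. h (w j) = w (l j)" "\<And>j. h (w (j + 1)) = w (l j + 1)" by metis
  have step: "l (j + 1) = l j + 1" for j
    using l(1)[of "j + 1"] l(2)[of j] line_eq_iff[OF w] by simp
  have "l j = j + l 0" for j
  proof (induction j rule: int_induct[where k = 0])
    case (step2 i)
    then show ?case using step[of "i - 1"] by simp
  qed (simp_all add: step)
  then show thesis using that[of "l 0"] l(1) by metis
qed

end

context regular_tree
begin

text \<open>The index sets \<open>UNIV\<close>, \<open>{r, r + 1}\<close> and \<open>{r..}\<close>
  give transitivity on lines, on directed edges and on the backward extensions of a ray. Convexity
  of \<open>I\<close> is convexity of the subtree.\<close>

lemma line_extend_aut:
  assumes w: "is_line E w" and I: "I \<noteq> {}"
    and conv: "\<And>i j l. i \<in> I \<Longrightarrow> j \<in> I \<Longrightarrow> i \<le> l \<Longrightarrow> l \<le> j \<Longrightarrow> l \<in> I"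
    and adj: "\<And>i. i \<in> I \<Longrightarrow> i + 1 \<in> I \<Longrightarrow> E (u i) (u (i + 1))"
    and neq: "\<And>i. i \<in> I \<Longrightarrow> i + 1 \<in> I \<Longrightarrow> i + 2 \<in> I \<Longrightarrow> u i \<noteq> u (i + 2)"
  obtains g where "g \<in> carrier (aut_group E)" "\<And>i. i \<in> I \<Longrightarrow> g (w i) = u i"
proof -
  define h where "h x = u (inv_into UNIV w x)" for x
  have h: "h (w i) = u i" for i by (simp add: h_def inv_f_f[OF line_inj[OF w]])
  obtain g where "g \<in> carrier (aut_group E)" "\<And>x. x \<in> w ` I \<Longrightarrow> g x = h x"
  proof (rule extend_to_aut[of "w ` I" h])
    show "snd e \<in> w ` I" if p: "nb_path E n e f" and ef: "fst e \<in> w ` I" "snd f \<in> w ` I" for n e f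
    proof -
      obtain i j where ij: "i \<in> I" "j \<in> I" "fst e = w i" "snd f = w j" using ef by blast
      show ?thesis
        using nb_path_between_line[OF w p ij(3,4)] conv[OF ij(1,2), of "i + 1"] conv[OF ij(2,1), of "i - 1"]
        by auto
    qed
    show "E (h x) (h y)" if xy: "x \<in> w ` I" "y \<in> w ` I" "E x y" for x y
    proof -
      obtain i j where "i \<in> I" "j \<in> I" "x = w i" "y = w j" using xy by blast
      then show ?thesis using xy(3) line_adj_iff[OF w] adj[of i] adj[of j] E_sym by (auto simp: h)
    qed
    show "h x \<noteq> h z" if xyz: "x \<in> w ` I" "y \<in> w ` I" "z \<in> w ` I" "E x y" "E y z" "x \<noteq> z" for x y z
    proof -
      obtain i j l where ijl: "i \<in> I" "j \<in> I" "l \<in> I" "x = w i" "y = w j" "z = w l" using xyz by blast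
      then have "j = i + 1 \<and> l = i + 2 \<or> j = l + 1 \<and> i = l + 2"
        using xyz line_adj_iff[OF w] by auto
      then show ?thesis using neq[of i] neq[of l] ijl by (auto simp: h)
    qed
  qed (use I in auto)
  then show thesis using that h by auto
qed

end

context tree_line
begin

lemma lines_transitive:
  assumes "is_line E w" "is_line E u"
  obtains g where "g \<in> Aut" "\<And>i. g (w i) = u i"
proof -
  obtain g where "g \<in> Aut" "\<And>i. i \<in> UNIV \<Longrightarrow> g (w i) = u i"
    by (rule line_extend_aut[OF assms(1), of UNIV u]) (use assms(2) in \<open>auto simp: is_line_def\<close>)
  then show thesis using that by blast
qed

lemma edges_transitive:
  assumes "E x y"
  obtains g where "g \<in> Aut" "g (v r) = x" "g (v (r + 1)) = y"
proof -
  define u where "u i = (if i = r then x else y)" for i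
  obtain g where "g \<in> Aut" "\<And>i. i \<in> {r, r + 1} \<Longrightarrow> g (v i) = u i"
    by (rule line_extend_aut[OF line, of "{r, r + 1}" u]) (use assms in \<open>auto simp: u_def\<close>)
  then show thesis using that by (simp add: u_def)
qed

lemma ray_fixer_moves:
  assumes "E y (v (r + 1))" "y \<noteq> v (r + 2)"
  obtains s where "s \<in> ray_fixer (r + 1)" "s (v r) = y"
proof -
  define u where "u i = (if i = r then y else v i)" for i
  obtain g where g: "g \<in> Aut" "\<And>i. i \<in> {r..} \<Longrightarrow> g (v i) = u i"
  proof (rule line_extend_aut[OF line, of "{r..}" u])
    show "E (u i) (u (i + 1))" if "i \<in> {r..}" "i + 1 \<in> {r..}" for i
      using assms(1) line_adj_iff[OF line] that by (auto simp: u_def)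
    show "u i \<noteq> u (i + 2)" if "i \<in> {r..}" "i + 1 \<in> {r..}" "i + 2 \<in> {r..}" for i
      using assms(2) that by (auto simp: u_def)
  qed auto
  show thesis
  proof (rule that)
    show "g \<in> ray_fixer (r + 1)" using g by (simp add: ray_fixer_def u_def)
    show "g (v r) = y" using g(2)[of r] by (simp add: u_def)
  qed
qed

lemma A_minus_shift:
  assumes "splitting_image E v A" "a \<in> A_minus v A"
  shows "a \<in> A" "a \<in> Aut" "line_shift v a < 0" "a (v j) = v (j + line_shift v a)"
  using assms splitting_image_shift(1)[OF assms(1)] line_subgroup_shift[of a j]
  by (auto simp: A_minus_def line_subgroup_iff)

lemma displacement_A_minus:
  assumes "splitting_image E v A" "a \<in> A_minus v A"
  shows "displacement E a = nat (- line_shift v a)"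
proof (rule displacement_axis)
  \<comment> \<open>\<open>a\<close> moves towards negative indices, away from the cusp, so its axis
    is the line reversed.\<close>
  show "is_line E (\<lambda>j. v (- j))" using line by (rule line_reverse)
  show "a (v (- j)) = v (- (j + int (nat (- line_shift v a))))" for j
    using A_minus_shift[OF assms] by (simp add: ac_simps)
qed (use A_minus_shift[OF assms] in auto)

lemma conjugate_via_aut:
  "conjugate_via (aut_group E) H x y \<longleftrightarrow> (\<exists>h\<in>H. y = h \<circ> x \<circ> inv\<^bsub>aut_group E\<^esub> h)"
  by (simp add: conjugate_via_def)

text \<open>The conjugates of the elements \<open>a m\<close> are exactly the automorphisms
  translating some line by \<open>l(a)\<close>: the group is transitive on lines, and two elements
  that shift a line equally differ by an element of its pointwise stabilizer.\<close>

lemma split_part_cond_iff: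
  assumes A: "splitting_image E v A" and g: "g \<in> Aut"
  shows "split_part_cond E v A g a \<longleftrightarrow>
    a \<in> A_minus v A \<and> (\<exists>w. is_line E w \<and> (\<forall>j. g (w j) = w (j + int (displacement E a))))"
proof (intro iffI; (elim conjE exE)?)
  assume "split_part_cond E v A g a"
  then obtain m h where a: "a \<in> A_minus v A" and m: "m \<in> line_fixer E v" and h: "h \<in> Aut"
    and eq: "a \<circ> m = h \<circ> g \<circ> inv_into UNIV h"
    by (auto simp: split_part_cond_def conjugate_via_aut inv_aut_group)
  have a': "a (v j) = v (j - int (displacement E a))" for j
    using A_minus_shift(3,4)[OF A a] displacement_A_minus[OF A a] by simp
  define w where "w j = inv_into UNIV h (v (- j))" for j
  have "is_line E w" unfolding w_def by (rule aut_line[OF aut_inv[OF h] line_reverse[OF line]])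
  moreover have "g (w j) = w (j + int (displacement E a))" for j
  proof -
    have "h (g (w j)) = a (m (v (- j)))" using fun_cong[OF eq, of "v (- j)"] by (simp add: w_def)
    also have "\<dots> = v (- (j + int (displacement E a)))" using m a' by (simp add: line_fixer_iff)
    finally show ?thesis unfolding w_def using aut_inv_apply(1)[OF h] by metis
  qed
  ultimately show "a \<in> A_minus v A \<and> (\<exists>w. is_line E w \<and> (\<forall>j. g (w j) = w (j + int (displacement E a))))"
    using a by blast
next
  fix w assume a: "a \<in> A_minus v A" and w: "is_line E w" and shift: "\<forall>j. g (w j) = w (j + int (displacement E a))"
  have a': "a (v j) = v (j - int (displacement E a))" for j
    using A_minus_shift(3,4)[OF A a] displacement_A_minus[OF A a] by simp
  have aG: "a \<in> Aut" using A_minus_shift[OF A a] by blast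
  obtain h where h: "h \<in> Aut" "\<And>i. h (w i) = v (- i)"
    using lines_transitive[OF w line_reverse[OF line]] by metis
  define m where "m = inv_into UNIV a \<circ> (h \<circ> g \<circ> inv_into UNIV h)"
  have "m (v j) = v j" for j
  proof -
    have "inv_into UNIV h (v j) = w (- j)" using h(2)[of "- j"] aut_inv_apply(1)[OF h(1)] by (metis minus_minus)
    then have "m (v j) = inv_into UNIV a (v (j - int (displacement E a)))"
      using shift h(2) by (simp add: m_def)
    then show ?thesis using a'[of j] aut_inv_apply(1)[OF aG] by metis
  qed
  moreover have "m \<in> Aut" unfolding m_def using aG h g by (intro aut_comp aut_inv)
  ultimately have "m \<in> line_fixer E v" by (simp add: line_fixer_iff)
  moreover have "a \<circ> m = h \<circ> g \<circ> inv\<^bsub>aut_group E\<^esub> h"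
    using aG h by (simp add: m_def fun_eq_iff inv_aut_group)
  ultimately show "split_part_cond E v A g a"
    using a h by (auto simp: split_part_cond_def conjugate_via_aut)
qed

text \<open>The translation length is a conjugation invariant; on \<open>A_minus v A\<close> it
  determines the shift, and the shift determines the element of \<open>A\<close>.\<close>

lemma split_part_unique:
  assumes A: "splitting_image E v A" and g: "g \<in> Aut"
    and "split_part_cond E v A g a" "split_part_cond E v A g b"
  shows "a = b"
proof -
  have d: "displacement E g = displacement E c" "c \<in> A_minus v A" if c: "split_part_cond E v A g c" for c
  proof -
    from c obtain w where w: "c \<in> A_minus v A" "is_line E w" "\<And>j. g (w j) = w (j + int (displacement E c))"
      unfolding split_part_cond_iff[OF A g] by blast
    moreover have "0 < displacement E c"
      using A_minus_shift(3)[OF A w(1)] displacement_A_minus[OF A w(1)] by simp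
    ultimately show "displacement E g = displacement E c" "c \<in> A_minus v A"
      using displacement_axis[OF g] by blast+
  qed
  have "line_shift v a = line_shift v b"
    using d[OF assms(3)] d[OF assms(4)] displacement_A_minus[OF A] A_minus_shift(3)[OF A]
    by (metis eq_nat_nat_iff neg_equal_iff_equal less_imp_le neg_0_less_iff_less)
  then show ?thesis
    using splitting_image_shift(2)[OF A] A_minus_shift(1)[OF A] d(2) assms(3,4) by (meson inj_onD)
qed

lemma split_part_eqI:
  assumes "splitting_image E v A" "g \<in> Aut" "split_part_cond E v A g a"
  shows "split_part E v A g = a"
  unfolding split_part_def using split_part_unique[OF assms(1,2)] assms(3) by blast

end

section \<open>Translations in the lattice\<close>

context regular_tree
begin

text \<open>An inequality, since \<open>e\<close> need not be an edge. Besides finiteness it gives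
  the domination by \<open>q ^ l(a)\<close> in the final summation.\<close>

lemma nb_path_targets: "finite {f. nb_path E n e f} \<and> card {f. nb_path E n e f} \<le> q ^ n"
proof (induction n)
  case 0
  have "{f. nb_path E 0 e f} \<subseteq> {e}" by auto
  then show ?case by (metis card.empty card.insert card_mono empty_iff finite.emptyI finite.insertI finite_subset power_0 One_nat_def)
next
  case (Suc n)
  have step: "finite {f. nb_step E g f} \<and> card {f. nb_step E g f} \<le> q" for g
  proof (cases "E (fst g) (snd g)")
    case True
    have "{f. nb_step E g f} = Pair (snd g) ` ({y. E (snd g) y} - {fst g})"
      using True by (auto simp: nb_step_def image_iff)
    moreover have "card ({y. E (snd g) y} - {fst g}) = q"
      using True E_sym finite_nbrs card_nbrs by simp
    ultimately show ?thesis using finite_nbrs by (metis card_image_le finite_Diff finite_imageI)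
  next
    case False
    then have "{f. nb_step E g f} = {}" by (auto simp: nb_step_def)
    then show ?thesis by (simp only: finite.emptyI card.empty le0)
  qed
  have eq: "{f. nb_path E (Suc n) e f} = (\<Union>g\<in>{g. nb_path E n e g}. {f. nb_step E g f})"
    by (auto simp: nb_path_Suc)
  have "card (\<Union>g\<in>{g. nb_path E n e g}. {f. nb_step E g f}) \<le> (\<Sum>g\<in>{g. nb_path E n e g}. card {f. nb_step E g f})"
    using Suc by (intro card_UN_le) auto
  also have "\<dots> \<le> card {g. nb_path E n e g} * q"
    using sum_bounded_above[of "{g. nb_path E n e g}" "\<lambda>g. card {f. nb_step E g f}" q] step by simp
  also have "\<dots> \<le> q ^ n * q" using Suc by simp
  finally show ?case unfolding eq using Suc step by (auto simp: mult.commute)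
qed

end

locale tree_lattice = tree_line E q v for E :: "'v \<Rightarrow> 'v \<Rightarrow> bool" and q v +
  fixes \<Gamma> :: "('v \<Rightarrow> 'v) set"
  assumes subgroup: "subgroup \<Gamma> (aut_group E)"
    and cocompact: "cocompact_in_aut E \<Gamma>"
    and free: "acts_freely E \<Gamma>"
begin

lemma Gamma_aut: "g \<in> \<Gamma> \<Longrightarrow> g \<in> Aut"
  using subgroup.subset[OF subgroup] by blast

lemma Gamma_id: "id \<in> \<Gamma>"
  using subgroup.one_closed[OF subgroup] by simp

lemma Gamma_comp: "g \<in> \<Gamma> \<Longrightarrow> h \<in> \<Gamma> \<Longrightarrow> g \<circ> h \<in> \<Gamma>"
  using subgroup.m_closed[OF subgroup] by simp

lemma Gamma_inv: "g \<in> \<Gamma> \<Longrightarrow> inv_into UNIV g \<in> \<Gamma>"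
  using subgroup.m_inv_closed[OF subgroup] Gamma_aut inv_aut_group by metis

lemma Gamma_eqI:
  assumes "g \<in> \<Gamma>" "h \<in> \<Gamma>" "g x = h x"
  shows "g = h"
proof -
  have "(inv_into UNIV g \<circ> h) x = x"
    using aut_inv_apply(1)[OF Gamma_aut[OF assms(1)], of x] assms(3) by simp
  then have "inv_into UNIV g \<circ> h = id"
    using free assms Gamma_comp[OF Gamma_inv] by (auto simp: acts_freely_def)
  then have "inv_into UNIV g (h y) = y" for y by (metis comp_apply id_apply)
  then have "h y = g y" for y using aut_inv_apply(2)[OF Gamma_aut[OF assms(1)], of "h y"] by simp
  then show ?thesis by auto
qed

lemma Gamma_pow: "g \<in> \<Gamma> \<Longrightarrow> g ^^ n \<in> \<Gamma>"
  by (induction n) (auto intro: Gamma_comp Gamma_id)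

lemma funpow_shift:
  assumes "\<And>j. g (w j) = w (j + i)"
  shows "(g ^^ n) (w j) = w (j + int n * i)"
  by (induction n) (simp_all add: assms algebra_simps)

text \<open>The elements of the lattice translating a given axis form a cyclic group, and the generator
  of least positive translation length is the primitive root.\<close>

lemma primitive_root_axis:
  assumes g: "\<gamma> \<in> \<Gamma>" and w: "is_line E w"
    and shift: "\<And>j. \<gamma> (w j) = w (j + int k)" and k: "0 < k"
  defines "l \<equiv> displacement E (primitive_root (aut_group E) \<Gamma> \<gamma>)"
  shows "0 < l"
    and "\<And>\<sigma> i. \<sigma> \<in> \<Gamma> \<Longrightarrow> (\<And>j. \<sigma> (w j) = w (j + i)) \<Longrightarrow> int l dvd i"
    and "\<And>z. \<exists>\<sigma>\<in>\<Gamma>. \<forall>j. \<sigma> (w j) = w (j + int l * z)"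
proof -
  define T where "T n \<longleftrightarrow> 0 < n \<and> (\<exists>\<sigma>\<in>\<Gamma>. \<forall>j. \<sigma> (w j) = w (j + int n))" for n
  define t where "t = (LEAST n. T n)"
  have "T k" using g shift k by (auto simp: T_def)
  then have "T t" unfolding t_def by (rule LeastI)
  then obtain \<tau> where t: "0 < t" and \<tau>: "\<tau> \<in> \<Gamma>" and \<tau>s: "\<And>j. \<tau> (w j) = w (j + int t)"
    unfolding T_def by blast
  have min: "t \<le> n" if "T n" for n unfolding t_def using that by (rule Least_le)
  have mult: "\<exists>\<sigma>\<in>\<Gamma>. \<forall>j. \<sigma> (w j) = w (j + int t * z)" for z
  proof (cases "z \<ge> 0")
    case True
    then have "(\<tau> ^^ nat z) (w j) = w (j + int t * z)" for j
      using funpow_shift[of \<tau> w, OF \<tau>s] by (simp add: mult.commute)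
    then show ?thesis using Gamma_pow[OF \<tau>] by blast
  next
    case False
    let ?\<sigma> = "\<tau> ^^ nat (- z)"
    have "?\<sigma> (w (j + int t * z)) = w j" for j
      using funpow_shift[of \<tau> w, OF \<tau>s] False by (simp add: algebra_simps)
    then have "inv_into UNIV ?\<sigma> (w j) = w (j + int t * z)" for j
      using aut_inv_apply(1)[OF Gamma_aut[OF Gamma_pow[OF \<tau>]]] by metis
    then show ?thesis using Gamma_inv[OF Gamma_pow[OF \<tau>]] by blast
  qed
  \<comment> \<open>Otherwise division with remainder would produce a lattice element with positive
    translation length below the minimal \<open>t\<close>.\<close>
  have dvd: "int t dvd i" if \<sigma>: "\<sigma> \<in> \<Gamma>" "\<And>j. \<sigma> (w j) = w (j + i)" for \<sigma> i
  proof (rule ccontr)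
    assume "\<not> int t dvd i"
    then have pos: "0 < i mod int t" using t by (simp add: dvd_eq_mod_eq_0 order_neq_le_trans[OF _ pos_mod_sign])
    obtain \<rho> where \<rho>: "\<rho> \<in> \<Gamma>" "\<And>j. \<rho> (w j) = w (j + int t * (- (i div int t)))" using mult by metis
    have "(\<sigma> \<circ> \<rho>) (w j) = w (j + int (nat (i mod int t)))" for j
      using pos by (simp add: \<rho>(2) \<sigma>(2) minus_mult_div_eq_mod [symmetric] algebra_simps)
    then have "T (nat (i mod int t))"
      unfolding T_def using pos Gamma_comp[OF \<sigma>(1) \<rho>(1)] by (metis zero_less_nat_eq)
    from min[OF this] have "int t \<le> i mod int t" using pos by linarith
    moreover have "i mod int t < int t" using t by simp
    ultimately show False by linarith
  qed
  have same: "\<sigma> = \<rho>" if "\<sigma> \<in> \<Gamma>" "\<rho> \<in> \<Gamma>" "\<And>j. \<sigma> (w j) = w (j + i)" "\<And>j. \<rho> (w j) = w (j + i)" for \<sigma> \<rho> i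
    using Gamma_eqI[of \<sigma> \<rho> "w 0"] that by simp
  \<comment> \<open>A root of a translation commutes with it and therefore shifts the same axis, by
    a fraction of the length.\<close>
  have power_root: "\<exists>i. (\<forall>j. \<sigma> (w j) = w (j + i)) \<and> int n * i = l"
    if \<sigma>: "\<sigma> \<in> \<Gamma>" and \<rho>: "\<And>j. (\<sigma> ^^ n) (w j) = w (j + l)" and l: "0 < l" for \<sigma> n and l :: int
  proof -
    have "\<sigma> ^^ n \<circ> \<sigma> = \<sigma> \<circ> \<sigma> ^^ n" by (simp add: fun_eq_iff funpow_swap1)
    moreover have "(\<sigma> ^^ n) (w j) = w (j + int (nat l))" for j using \<rho> l by simp
    ultimately obtain i where i: "\<And>j. \<sigma> (w j) = w (j + i)"
      using commuting_shift[OF Gamma_aut[OF Gamma_pow[OF \<sigma>]] w _ _ Gamma_aut[OF \<sigma>], of n "nat l"] l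
      by auto
    then have "w (0 + int n * i) = w (0 + l)" using funpow_shift[of \<sigma> w i n 0] \<rho>[of 0] by simp
    then show ?thesis using i line_eq_iff[OF w] by auto
  qed
  have pos: "0 < y" if "int n * y = z" "0 < z" for n y z
    using that zero_less_mult_iff[of "int n" y] by auto
  have prim: "primitive_in (aut_group E) \<Gamma> \<tau>"
    unfolding primitive_in_def pow_aut_group
  proof (intro conjI ballI allI impI)
    fix \<sigma> n assume \<sigma>: "\<sigma> \<in> \<Gamma>" and eq: "\<tau> = \<sigma> ^^ n"
    then obtain i where i: "\<And>j. \<sigma> (w j) = w (j + i)" "int n * i = int t"
      using power_root[OF \<sigma>, of n "int t"] \<tau>s t by auto
    have "0 < i" by (rule pos[OF i(2)]) (use t in simp)
    moreover have "int t \<le> i" using dvd[OF \<sigma> i(1)] \<open>0 < i\<close> by (rule zdvd_imp_le)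
    ultimately have "int n \<le> 1" using i(2) mult_le_cancel_right_pos[of i "int n" 1] by simp
    moreover have "n \<noteq> 0"
    proof
      assume "n = 0"
      then show False using i(2) t by simp
    qed
    ultimately show "n = 1" by simp
  qed (rule \<tau>)
  have root: "primitive_root (aut_group E) \<Gamma> \<gamma> = \<tau>"
    unfolding primitive_root_def pow_aut_group
  proof (rule the_equality)
    obtain m where m: "int k = int t * m" using dvd[OF g shift] unfolding dvd_def by blast
    have "0 < m" by (rule pos[OF m[symmetric]]) (use k in simp)
    have "\<gamma> = \<tau> ^^ nat m"
    proof (rule same[OF g Gamma_pow[OF \<tau>] shift])
      show "(\<tau> ^^ nat m) (w j) = w (j + int k)" for j
        using funpow_shift[of \<tau> w, OF \<tau>s] m \<open>0 < m\<close> by (simp add: mult.commute)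
    qed
    then show "primitive_in (aut_group E) \<Gamma> \<tau> \<and> (\<exists>\<mu>>0. \<gamma> = \<tau> ^^ \<mu>)"
      using prim \<open>0 < m\<close> by (auto intro!: exI[of _ "nat m"])
  next
    fix \<sigma> assume \<sigma>: "primitive_in (aut_group E) \<Gamma> \<sigma> \<and> (\<exists>\<mu>>0. \<gamma> = \<sigma> ^^ \<mu>)"
    then obtain \<mu> where \<mu>: "\<gamma> = \<sigma> ^^ \<mu>" and \<sigma>G: "\<sigma> \<in> \<Gamma>" by (auto simp: primitive_in_def)
    then obtain i where i: "\<And>j. \<sigma> (w j) = w (j + i)" "int \<mu> * i = int k"
      using power_root[OF \<sigma>G, of \<mu> "int k"] shift k by auto
    have "0 < i" by (rule pos[OF i(2)]) (use k in simp)
    obtain m where m: "i = int t * m" using dvd[OF \<sigma>G i(1)] unfolding dvd_def by blast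
    have "0 < m" by (rule pos[OF m[symmetric]]) fact
    have "\<sigma> = \<tau> ^^ nat m"
    proof (rule same[OF \<sigma>G Gamma_pow[OF \<tau>] i(1)])
      show "(\<tau> ^^ nat m) (w j) = w (j + i)" for j
        using funpow_shift[of \<tau> w, OF \<tau>s] m \<open>0 < m\<close> by (simp add: mult.commute)
    qed
    moreover from this have "nat m = 1" using \<sigma> \<tau> unfolding primitive_in_def pow_aut_group by blast
    ultimately show "\<sigma> = \<tau>" by simp
  qed
  have "l = t"
    unfolding l_def root by (rule displacement_axis[OF Gamma_aut[OF \<tau>] w \<tau>s t])
  then show "0 < l" and "\<And>\<sigma> i. \<sigma> \<in> \<Gamma> \<Longrightarrow> (\<And>j. \<sigma> (w j) = w (j + i)) \<Longrightarrow> int l dvd i"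
    and "\<And>z. \<exists>\<sigma>\<in>\<Gamma>. \<forall>j. \<sigma> (w j) = w (j + int l * z)"
    using t dvd mult by auto
qed

section \<open>Lattice orbits of directed edges\<close>

definition edge_orbit :: "'v \<times> 'v \<Rightarrow> ('v \<times> 'v) set" where
  "edge_orbit e = (\<lambda>g. map_prod g g e) ` \<Gamma>"

text \<open>The choice is made from the orbit as a set, so equal orbits have equal representatives;
  \<open>edge_rep\<close> makes the same choice.\<close>

definition edge_reps :: "('v \<times> 'v) set" where
  "edge_reps = (\<lambda>Q. SOME e. e \<in> Q) ` edge_orbit ` {e. E (fst e) (snd e)}"

lemma edge_orbit_refl: "e \<in> edge_orbit e"
  unfolding edge_orbit_def using Gamma_id by (auto intro!: image_eqI[of _ _ id] simp: prod.map_id0)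

lemma edge_orbit_eq:
  assumes "f \<in> edge_orbit e"
  shows "edge_orbit f = edge_orbit e"
proof -
  obtain g where g: "g \<in> \<Gamma>" "f = map_prod g g e" using assms by (auto simp: edge_orbit_def)
  show ?thesis
  proof (intro equalityI subsetI)
    fix x assume "x \<in> edge_orbit f"
    then obtain h where "h \<in> \<Gamma>" "x = map_prod h h f" by (auto simp: edge_orbit_def)
    then show "x \<in> edge_orbit e"
      using g Gamma_comp unfolding edge_orbit_def by (auto simp: prod.map_comp intro!: image_eqI[of _ _ "h \<circ> g"])
  next
    fix x assume "x \<in> edge_orbit e"
    then obtain h where h: "h \<in> \<Gamma>" "x = map_prod h h e" by (auto simp: edge_orbit_def)
    have "e = map_prod (inv_into UNIV g) (inv_into UNIV g) f"
      using g aut_inv_apply(1)[OF Gamma_aut[OF g(1)]] by (cases e) simp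
    then have "x = map_prod (h \<circ> inv_into UNIV g) (h \<circ> inv_into UNIV g) f"
      using h by (cases f) simp
    then show "x \<in> edge_orbit f"
      using g h Gamma_comp Gamma_inv unfolding edge_orbit_def by blast
  qed
qed

lemma edge_reps_edge: "d \<in> edge_reps \<Longrightarrow> E (fst d) (snd d)"
proof -
  assume "d \<in> edge_reps"
  then obtain e where e: "E (fst e) (snd e)" "d = (SOME d. d \<in> edge_orbit e)"
    unfolding edge_reps_def by blast
  have "d \<in> edge_orbit e" unfolding e(2) using edge_orbit_refl by (rule someI)
  then obtain g where "g \<in> \<Gamma>" "d = map_prod g g e" by (auto simp: edge_orbit_def)
  then show ?thesis using e(1) aut_adj[OF Gamma_aut] by simp
qed

lemma edge_reps_unique:
  assumes "d \<in> edge_reps" "d' \<in> edge_reps" "g \<in> \<Gamma>" "h \<in> \<Gamma>" "map_prod g g d = map_prod h h d'"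
  shows "d = d' \<and> g = h"
proof -
  have *: "(SOME x. x \<in> edge_orbit d) = d" if "d \<in> edge_reps" for d
  proof -
    obtain e where e: "d = (SOME d. d \<in> edge_orbit e)" using \<open>d \<in> edge_reps\<close> unfolding edge_reps_def by blast
    have "d \<in> edge_orbit e" unfolding e using edge_orbit_refl by (rule someI)
    then show ?thesis unfolding edge_orbit_eq[OF \<open>d \<in> edge_orbit e\<close>] using e by simp
  qed
  have "edge_orbit d = edge_orbit d'"
  proof -
    have "map_prod g g d \<in> edge_orbit d" "map_prod h h d' \<in> edge_orbit d'"
      using assms(3,4) unfolding edge_orbit_def by blast+
    then have "map_prod g g d \<in> edge_orbit d" "map_prod g g d \<in> edge_orbit d'" using assms(5) by simp_all
    then show ?thesis using edge_orbit_eq by blast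
  qed
  then have "(SOME x. x \<in> edge_orbit d) = (SOME x. x \<in> edge_orbit d')" by (rule arg_cong)
  then have "d = d'" unfolding *[OF assms(1)] *[OF assms(2)] .
  moreover have "g (fst d) = h (fst d')" using assms(5) by (metis fst_map_prod)
  ultimately show ?thesis using Gamma_eqI assms(3,4) by blast
qed

definition edge_rep :: "'v \<times> 'v \<Rightarrow> 'v \<times> 'v" where
  "edge_rep e = (SOME d. d \<in> edge_orbit e)"

definition edge_elt :: "'v \<times> 'v \<Rightarrow> 'v \<Rightarrow> 'v" where
  "edge_elt e = (SOME g. g \<in> \<Gamma> \<and> e = map_prod g g (edge_rep e))"

lemma edge_decomp:
  assumes "E (fst e) (snd e)"
  shows "edge_rep e \<in> edge_reps" "edge_elt e \<in> \<Gamma>" "map_prod (edge_elt e) (edge_elt e) (edge_rep e) = e"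
proof -
  show "edge_rep e \<in> edge_reps" using assms unfolding edge_rep_def edge_reps_def by blast
  have "edge_rep e \<in> edge_orbit e" unfolding edge_rep_def using edge_orbit_refl by (rule someI)
  then have "e \<in> edge_orbit (edge_rep e)" using edge_orbit_eq edge_orbit_refl by blast
  then have "\<exists>g. g \<in> \<Gamma> \<and> e = map_prod g g (edge_rep e)" by (auto simp: edge_orbit_def)
  then have "edge_elt e \<in> \<Gamma> \<and> e = map_prod (edge_elt e) (edge_elt e) (edge_rep e)"
    unfolding edge_elt_def by (rule someI_ex)
  then show "edge_elt e \<in> \<Gamma>" "map_prod (edge_elt e) (edge_elt e) (edge_rep e) = e" by simp_all
qed

text \<open>Freeness turns edges into unique pairs of a representative and a lattice
  element.\<close>

lemma edge_decomp_eqI: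
  assumes "d \<in> edge_reps" "g \<in> \<Gamma>" "e = map_prod g g d"
  shows "edge_rep e = d" "edge_elt e = g"
proof -
  have "E (fst e) (snd e)" using edge_reps_edge[OF assms(1)] aut_adj[OF Gamma_aut[OF assms(2)]] assms(3) by simp
  from edge_reps_unique[OF edge_decomp(1)[OF this] assms(1) edge_decomp(2)[OF this] assms(2)]
    edge_decomp(3)[OF this] assms(3)
  show "edge_rep e = d" "edge_elt e = g" by auto
qed

section \<open>Cosets and the topology of the quotient\<close>

abbreviation coset :: "('v \<Rightarrow> 'v) \<Rightarrow> ('v \<Rightarrow> 'v) set" where
  "coset g \<equiv> \<Gamma> #>\<^bsub>aut_group E\<^esub> g"

lemma coset_eq: "coset g = {h \<circ> g |h. h \<in> \<Gamma>}"
  by (auto simp: r_coset_def)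

lemma coset_self: "g \<in> coset g"
proof -
  have "id \<circ> g \<in> coset g" unfolding coset_eq using Gamma_id by blast
  then show ?thesis by simp
qed

lemma coset_eqD:
  assumes "coset g = coset h"
  obtains \<gamma> where "\<gamma> \<in> \<Gamma>" "g = \<gamma> \<circ> h"
proof -
  have "g \<in> coset h" using coset_self[of g] assms by simp
  then show thesis using that unfolding coset_eq by blast
qed

text \<open>Openness in the quotient is tested on the preimage. Left invariance of \<open>P\<close>
  under the lattice makes this preimage the set of automorphisms with \<open>P\<close>
  itself.\<close>

lemma open_cosets:
  assumes inv: "\<And>\<gamma> g. \<gamma> \<in> \<Gamma> \<Longrightarrow> g \<in> Aut \<Longrightarrow> P g \<Longrightarrow> P (\<gamma> \<circ> g)"
    and "open": "\<And>g. g \<in> Aut \<Longrightarrow> P g \<Longrightarrow> \<exists>F. finite F \<and> F \<noteq> {} \<and> (\<forall>k\<in>pointwise_stabilizer E F. P (g \<circ> k))"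
  shows "openin (coset_space E \<Gamma>) (coset ` {g \<in> Aut. P g})"
proof -
  let ?U = "coset ` {g \<in> Aut. P g}"
  have eq: "{g \<in> Aut. coset g \<in> ?U} = {g \<in> Aut. P g}"
  proof (intro equalityI subsetI)
    fix g assume "g \<in> {g \<in> Aut. coset g \<in> ?U}"
    then obtain h where g: "g \<in> Aut" and h: "h \<in> Aut" "P h" "coset g = coset h" by blast
    obtain \<gamma> where "\<gamma> \<in> \<Gamma>" "g = \<gamma> \<circ> h" by (rule coset_eqD[OF h(3)])
    then show "g \<in> {g \<in> Aut. P g}" using inv g h by blast
  qed blast
  have "aut_open E {g \<in> Aut. P g}"
    unfolding aut_open_def
  proof (intro conjI ballI)
    fix g assume "g \<in> {g \<in> Aut. P g}"
    then have g: "g \<in> Aut" "P g" by auto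
    from "open"[OF this] obtain F where F: "finite F" "F \<noteq> {}" "\<And>k. k \<in> pointwise_stabilizer E F \<Longrightarrow> P (g \<circ> k)"
      by blast
    have "g <#\<^bsub>aut_group E\<^esub> pointwise_stabilizer E F \<subseteq> {g \<in> Aut. P g}"
      using F(3) g aut_comp by (auto simp: l_coset_def pointwise_stabilizer_def)
    then show "\<exists>F. finite F \<and> F \<noteq> {} \<and> g <#\<^bsub>aut_group E\<^esub> pointwise_stabilizer E F \<subseteq> {g \<in> Aut. P g}"
      using F by blast
  qed blast
  then show ?thesis
    unfolding coset_space_def openin_quotient_topology topspace_aut_topology eq
    by (auto simp: openin_aut_topology)
qed

text \<open>Sorting cosets by the orbit of the edge from \<open>g (v 0)\<close> to
  \<open>g (v 1)\<close> gives an open cover of the compact quotient. Every orbit occurs by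
  transitivity on edges, and a coset belongs to one orbit only, so a finite subcover uses all
  orbits.\<close>

lemma finite_edge_reps: "finite edge_reps"
proof -
  define U where "U Q = coset ` {g \<in> Aut. (g (v 0), g (v 1)) \<in> Q}" for Q
  let ?O = "edge_orbit ` {e. E (fst e) (snd e)}"
  have inv: "(\<gamma> (g (v 0)), \<gamma> (g (v 1))) \<in> Q" if Q: "Q \<in> ?O" "\<gamma> \<in> \<Gamma>" "(g (v 0), g (v 1)) \<in> Q" for Q \<gamma> g
  proof -
    obtain e where e: "Q = edge_orbit e" using Q(1) by blast
    have "edge_orbit (g (v 0), g (v 1)) = Q" unfolding e by (rule edge_orbit_eq) (use Q(3) e in simp)
    moreover have "map_prod \<gamma> \<gamma> (g (v 0), g (v 1)) \<in> edge_orbit (g (v 0), g (v 1))"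
      unfolding edge_orbit_def using Q(2) by blast
    ultimately show ?thesis by simp
  qed
  have "openin (coset_space E \<Gamma>) (U Q)" if "Q \<in> ?O" for Q
    unfolding U_def
  proof (rule open_cosets)
    show "\<exists>F. finite F \<and> F \<noteq> {} \<and> (\<forall>k\<in>pointwise_stabilizer E F. ((g \<circ> k) (v 0), (g \<circ> k) (v 1)) \<in> Q)"
      if "(g (v 0), g (v 1)) \<in> Q" for g
      using that by (intro exI[of _ "{v 0, v 1}"]) (simp add: pointwise_stabilizer_def)
  qed (use inv[OF that] in simp)
  then have op: "\<forall>X\<in>U ` ?O. openin (coset_space E \<Gamma>) X" by blast
  have edge: "E (g (v 0)) (g (v 1))" if "g \<in> Aut" for g
    using aut_adj[OF that] line_adj_iff[OF line] by simp
  have "topspace (coset_space E \<Gamma>) \<subseteq> \<Union>(U ` ?O)"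
  proof
    fix c assume "c \<in> topspace (coset_space E \<Gamma>)"
    then obtain g where g: "g \<in> Aut" "c = coset g"
      unfolding topspace_coset_space by (auto simp: RCOSETS_def)
    then have "c \<in> U (edge_orbit (g (v 0), g (v 1)))" using edge_orbit_refl by (auto simp: U_def)
    then show "c \<in> \<Union>(U ` ?O)" using edge[OF g(1)] by force
  qed
  then obtain \<F> where F: "finite \<F>" "\<F> \<subseteq> U ` ?O" "topspace (coset_space E \<Gamma>) \<subseteq> \<Union>\<F>"
    using cocompact op unfolding cocompact_in_aut_def compact_space_def compactin_def by meson
  then obtain \<O> where O: "finite \<O>" "\<O> \<subseteq> ?O" "\<F> = U ` \<O>" by (meson finite_subset_image)
  have "?O \<subseteq> \<O>"
  proof
    fix Q assume "Q \<in> ?O"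
    then obtain e where e: "E (fst e) (snd e)" "Q = edge_orbit e" by blast
    obtain g where g: "g \<in> Aut" "g (v 0) = fst e" "g (v (0 + 1)) = snd e"
      using edges_transitive[OF e(1)] by metis
    have "coset g \<in> topspace (coset_space E \<Gamma>)"
      unfolding topspace_coset_space using g by (auto simp: RCOSETS_def)
    then obtain Q' where Q': "Q' \<in> \<O>" "coset g \<in> U Q'" using F(3) O(3) by blast
    then obtain h where h: "(h (v 0), h (v 1)) \<in> Q'" "coset g = coset h"
      by (auto simp: U_def)
    obtain \<gamma> where "\<gamma> \<in> \<Gamma>" "g = \<gamma> \<circ> h" by (rule coset_eqD[OF h(2)])
    then have "e \<in> Q'" using inv[of Q' \<gamma> h] Q'(1) O(2) h(1) g by (cases e) auto
    moreover obtain e' where "Q' = edge_orbit e'" using Q'(1) O(2) by blast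
    ultimately show "Q \<in> \<O>" using edge_orbit_eq e(2) Q'(1) by simp
  qed
  then have "finite ?O" using O(1) finite_subset by blast
  then show ?thesis unfolding edge_reps_def by (rule finite_imageI)
qed

section \<open>Conjugacy classes in the lattice\<close>

definition conj_class :: "('v \<Rightarrow> 'v) \<Rightarrow> ('v \<Rightarrow> 'v) set" where
  "conj_class \<gamma> = {\<tau> \<in> \<Gamma>. conjugate_via (aut_group E) \<Gamma> \<gamma> \<tau>}"

lemma conj_class_iff: "\<tau> \<in> conj_class \<gamma> \<longleftrightarrow> \<tau> \<in> \<Gamma> \<and> (\<exists>h\<in>\<Gamma>. \<tau> = h \<circ> \<gamma> \<circ> inv_into UNIV h)"
  by (simp add: conj_class_def conjugate_via_aut inv_aut_group Gamma_aut cong: bex_cong)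

lemma Gamma_inv_comp:
  assumes "g \<in> \<Gamma>" "h \<in> \<Gamma>"
  shows "inv_into UNIV (g \<circ> h) = inv_into UNIV h \<circ> inv_into UNIV g"
  using o_inv_distrib[OF aut_bij[OF Gamma_aut[OF assms(1)]] aut_bij[OF Gamma_aut[OF assms(2)]]] .

lemma Gamma_inv_inv: "g \<in> \<Gamma> \<Longrightarrow> inv_into UNIV (inv_into UNIV g) = g"
  using inv_inv_eq[OF aut_bij[OF Gamma_aut]] .

lemma conj_class_self: "\<gamma> \<in> \<Gamma> \<Longrightarrow> \<gamma> \<in> conj_class \<gamma>"
  unfolding conj_class_iff using Gamma_id by (auto intro!: bexI[of _ id] simp: inv_id)

lemma conj_class_eq:
  assumes "\<tau> \<in> conj_class \<gamma>"
  shows "conj_class \<tau> = conj_class \<gamma>"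
proof -
  obtain h where h: "h \<in> \<Gamma>" "\<tau> = h \<circ> \<gamma> \<circ> inv_into UNIV h" using assms by (auto simp: conj_class_iff)
  have hA: "h \<in> Aut" using h Gamma_aut by blast
  show ?thesis
  proof (intro equalityI subsetI)
    fix x assume "x \<in> conj_class \<tau>"
    then obtain l where l: "l \<in> \<Gamma>" "x = l \<circ> \<tau> \<circ> inv_into UNIV l" "x \<in> \<Gamma>" by (auto simp: conj_class_iff)
    have "x = (l \<circ> h) \<circ> \<gamma> \<circ> inv_into UNIV (l \<circ> h)"
      using l h by (simp add: Gamma_inv_comp comp_assoc)
    then show "x \<in> conj_class \<gamma>" using l(3) Gamma_comp[OF l(1) h(1)] unfolding conj_class_iff by blast
  next
    fix x assume "x \<in> conj_class \<gamma>"
    then obtain l where l: "l \<in> \<Gamma>" "x = l \<circ> \<gamma> \<circ> inv_into UNIV l" "x \<in> \<Gamma>" by (auto simp: conj_class_iff)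
    have "x = (l \<circ> inv_into UNIV h) \<circ> \<tau> \<circ> inv_into UNIV (l \<circ> inv_into UNIV h)"
      using l h hA by (simp add: Gamma_inv_comp Gamma_inv Gamma_inv_inv fun_eq_iff)
    then show "x \<in> conj_class \<tau>" using l(3) Gamma_comp[OF l(1) Gamma_inv[OF h(1)]] unfolding conj_class_iff by blast
  qed
qed

text \<open>Every pair arises from an axis edge of \<gamma>: carry the edge to its representative
  and conjugate \<gamma> along. Two axis edges give the same pair exactly when a lattice element
  commuting with \<gamma> carries one to the other, and such elements shift the axis by multiples of
  the primitive translation length.\<close>

lemma card_conj_class_paths:
  assumes g: "\<gamma> \<in> \<Gamma>" and w: "is_line E w" and shift: "\<And>j. \<gamma> (w j) = w (j + int k)" and k: "0 < k"
  shows "card {(d, \<sigma>). d \<in> edge_reps \<and> \<sigma> \<in> conj_class \<gamma> \<and> nb_path E k d (map_prod \<sigma> \<sigma> d)}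
    = displacement E (primitive_root (aut_group E) \<Gamma> \<gamma>)"
proof -
  define t where "t = displacement E (primitive_root (aut_group E) \<Gamma> \<gamma>)"
  note root = primitive_root_axis[OF g w shift k, folded t_def]
  note t = root(1) and dvd = root(2) and mult = root(3)
  note gA = Gamma_aut[OF g]
  define e where "e j = (w j, w (j + 1))" for j
  define h where "h j = edge_elt (e j)" for j
  define d where "d j = edge_rep (e j)" for j
  have Ee: "E (fst (e j)) (snd (e j))" for j using w by (simp add: e_def is_line_def)
  have d: "d j \<in> edge_reps" and hG: "h j \<in> \<Gamma>" and hd: "map_prod (h j) (h j) (d j) = e j" for j
    using edge_decomp[OF Ee] by (simp_all add: d_def h_def)
  note hA = Gamma_aut[OF hG]
  have h_inv [simp]: "inv_into UNIV (h j) (h j x) = x" "h j (inv_into UNIV (h j) x) = x" for j x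
    by (rule aut_inv_apply[OF hA])+
  define f where "f j = (d j, inv_into UNIV (h j) \<circ> \<gamma> \<circ> h j)" for j
  have "bij_betw f {0..<int t} {(d, \<sigma>). d \<in> edge_reps \<and> \<sigma> \<in> conj_class \<gamma> \<and> nb_path E k d (map_prod \<sigma> \<sigma> d)}"
  proof (rule bij_betw_imageI)
    show "inj_on f {0..<int t}"
    proof (rule inj_onI)
      fix i j assume ij: "i \<in> {0..<int t}" "j \<in> {0..<int t}" "f i = f j"
      then have dij: "d i = d j" and c: "inv_into UNIV (h i) \<circ> \<gamma> \<circ> h i = inv_into UNIV (h j) \<circ> \<gamma> \<circ> h j"
        by (simp_all add: f_def)
      \<comment> \<open>\<open>s\<close> carries the \<open>i\<close>-th axis edge to the
        \<open>j\<close>-th, and it commutes with \<gamma> because the two conjugates of \<gamma>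
        are equal.\<close>
      define s where "s = h j \<circ> inv_into UNIV (h i)"
      have sG: "s \<in> \<Gamma>" unfolding s_def using hG by (intro Gamma_comp Gamma_inv)
      have "\<gamma> \<circ> s = s \<circ> \<gamma>"
      proof
        fix x
        define y where "y = inv_into UNIV (h i) x"
        have x: "x = h i y" by (simp add: y_def)
        have "inv_into UNIV (h i) (\<gamma> (h i y)) = inv_into UNIV (h j) (\<gamma> (h j y))" using fun_cong[OF c, of y] by simp
        then have "h j (inv_into UNIV (h i) (\<gamma> x)) = \<gamma> (h j y)" by (simp add: x)
        then show "(\<gamma> \<circ> s) x = (s \<circ> \<gamma>) x" by (simp add: s_def y_def)
      qed
      then obtain l where l: "\<And>j. s (w j) = w (j + l)"
        using commuting_shift[OF gA w shift k Gamma_aut[OF sG]] by blast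
      have "h i (fst (d i)) = w i" "h j (fst (d i)) = w j"
        using hd[of i] hd[of j] dij by (auto simp: e_def prod_eq_iff)
      then have "s (w i) = w j" by (metis h_inv(1) comp_apply s_def)
      then have "j = i + l" using l[of i] line_eq_iff[OF w] by simp
      moreover have "int t dvd l" using dvd[OF sG l] .
      ultimately show "i = j" using ij(1,2) dvd_imp_le_int[of l "int t"] by fastforce
    qed
    show "f ` {0..<int t} = {(d, \<sigma>). d \<in> edge_reps \<and> \<sigma> \<in> conj_class \<gamma> \<and> nb_path E k d (map_prod \<sigma> \<sigma> d)}"
    proof (intro equalityI subsetI)
      fix x assume "x \<in> f ` {0..<int t}"
      then obtain j where x: "x = f j" by blast
      have "inv_into UNIV (h j) \<circ> \<gamma> \<circ> h j \<in> conj_class \<gamma>"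
        unfolding conj_class_iff using hG g
        by (auto intro!: Gamma_comp Gamma_inv bexI[of _ "inv_into UNIV (h j)"] simp: Gamma_inv_inv)
      moreover have "nb_path E k (d j) (map_prod (inv_into UNIV (h j) \<circ> \<gamma> \<circ> h j) (inv_into UNIV (h j) \<circ> \<gamma> \<circ> h j) (d j))"
      proof -
        have "nb_path E k (e j) (map_prod \<gamma> \<gamma> (e j))"
          unfolding e_def using line_translate_path[OF w shift] .
        from nb_path_aut[OF aut_inv[OF hA[of j]] this] show ?thesis
          unfolding hd[of j, symmetric] by (cases "d j") simp
      qed
      ultimately show "x \<in> {(d, \<sigma>). d \<in> edge_reps \<and> \<sigma> \<in> conj_class \<gamma> \<and> nb_path E k d (map_prod \<sigma> \<sigma> d)}"
        using d by (simp add: x f_def)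
    next
      fix x assume "x \<in> {(d, \<sigma>). d \<in> edge_reps \<and> \<sigma> \<in> conj_class \<gamma> \<and> nb_path E k d (map_prod \<sigma> \<sigma> d)}"
      then obtain c s where x: "x = (c, s)" and c: "c \<in> edge_reps" and s: "s \<in> conj_class \<gamma>"
        and p: "nb_path E k c (map_prod s s c)" by blast
      obtain r where r: "r \<in> \<Gamma>" "s = r \<circ> \<gamma> \<circ> inv_into UNIV r" using s by (auto simp: conj_class_iff)
      note rA = Gamma_aut[OF r(1)]
      define r' where "r' = inv_into UNIV r"
      have r': "r' \<in> \<Gamma>" unfolding r'_def by (rule Gamma_inv[OF r(1)])
      have "nb_path E k (map_prod r' r' c) (map_prod \<gamma> \<gamma> (map_prod r' r' c))"
        using nb_path_aut[OF Gamma_aut[OF r'] p] rA by (cases c) (simp add: r(2) r'_def)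
      from nb_path_translate_on_axis[OF gA w shift k this] obtain j where j: "map_prod r' r' c = e j"
        unfolding e_def by blast
      \<comment> \<open>Brings the index \<open>j\<close> into the range from 0 to
        \<open>t - 1\<close>; \<open>u\<close> commutes with \<gamma> since both orders of
        composition agree at the vertex \<open>w 0\<close>.\<close>
      obtain u where u: "u \<in> \<Gamma>" "\<And>i. u (w i) = w (i + int t * (- (j div int t)))"
        using mult by blast
      define j' where "j' = j mod int t"
      have j': "j' \<in> {0..<int t}" "j + int t * (- (j div int t)) = j'"
        using t by (simp_all add: j'_def minus_mult_div_eq_mod)
      have "map_prod (u \<circ> r') (u \<circ> r') c = map_prod u u (e j)" unfolding j[symmetric] by (cases c) simp
      also have "\<dots> = e j'"
      proof -
        have "j + 1 + int t * (- (j div int t)) = j' + 1" using j'(2) by linarith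
        then have "u (w (j + 1)) = w (j' + 1)" using u(2)[of "j + 1"] by metis
        moreover have "u (w j) = w j'" using u(2)[of j] j'(2) by metis
        ultimately show ?thesis by (simp add: e_def)
      qed
      finally have "e j' = map_prod (u \<circ> r') (u \<circ> r') c" by simp
      from edge_decomp_eqI[OF c Gamma_comp[OF u(1) r'] this]
      have dc: "d j' = c" and hc: "h j' = u \<circ> r'" by (simp_all add: d_def h_def)
      have comm: "u \<circ> \<gamma> = \<gamma> \<circ> u"
        by (rule Gamma_eqI[of _ _ "w 0"]) (use u g shift Gamma_comp in \<open>auto simp: algebra_simps\<close>)
      have "inv_into UNIV (h j') \<circ> \<gamma> \<circ> h j' = s"
      proof
        fix y
        have "h j' (s y) = u (\<gamma> (r' y))" using rA by (simp add: hc r(2) r'_def)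
        also have "\<dots> = \<gamma> (h j' y)" using fun_cong[OF comm, of "r' y"] by (simp add: hc)
        finally show "(inv_into UNIV (h j') \<circ> \<gamma> \<circ> h j') y = s y"
          by (metis h_inv(1) comp_apply)
      qed
      then have "x = f j'" by (simp add: x f_def dc)
      then show "x \<in> f ` {0..<int t}" using j'(1) by blast
    qed
  qed
  then show ?thesis using bij_betw_same_card unfolding t_def by fastforce
qed

section \<open>Conjugacy classes and smooth functions\<close>


text \<open>Taking representatives in the first component picks one pair from each lattice orbit of
  pairs \<open>(e, \<gamma>)\<close>, the action on edges being free.\<close>

definition translate_pairs :: "nat \<Rightarrow> (('v \<times> 'v) \<times> ('v \<Rightarrow> 'v)) set" where
  "translate_pairs k = {(d, \<sigma>). d \<in> edge_reps \<and> \<sigma> \<in> \<Gamma> \<and> nb_path E k d (map_prod \<sigma> \<sigma> d)}"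

text \<open>Freeness recovers \<sigma> from \<open>d\<close> and its translate, so the pairs are
  bounded by the end edges of paths of \<open>k\<close> steps.\<close>

lemma finite_translate_pairs: "finite (translate_pairs k)"
  and card_translate_pairs: "card (translate_pairs k) \<le> card edge_reps * q ^ k"
proof -
  let ?S = "SIGMA d:edge_reps. {f. nb_path E k d f}"
  let ?h = "\<lambda>(d, \<sigma>). (d, map_prod \<sigma> \<sigma> d)"
  have inj: "inj_on ?h (translate_pairs k)"
  proof (rule inj_onI)
    fix x y assume xy: "x \<in> translate_pairs k" "y \<in> translate_pairs k" "?h x = ?h y"
    obtain d \<sigma> d' \<tau> where "x = (d, \<sigma>)" "y = (d', \<tau>)" by (metis surj_pair)
    with xy have *: "x = (d, \<sigma>)" "y = (d, \<tau>)" "\<sigma> \<in> \<Gamma>" "\<tau> \<in> \<Gamma>" "map_prod \<sigma> \<sigma> d = map_prod \<tau> \<tau> d"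
      by (auto simp: translate_pairs_def)
    then have "\<sigma> (fst d) = \<tau> (fst d)" by (metis fst_map_prod)
    then show "x = y" using Gamma_eqI[of \<sigma> \<tau> "fst d"] * by simp
  qed
  have img: "?h ` translate_pairs k \<subseteq> ?S" by (auto simp: translate_pairs_def)
  have S: "finite ?S" using finite_edge_reps nb_path_targets by blast
  have "card (translate_pairs k) \<le> card ?S" using card_inj_on_le[OF inj img S] .
  also have "\<dots> = (\<Sum>d\<in>edge_reps. card {f. nb_path E k d f})"
    using finite_edge_reps nb_path_targets by (intro card_SigmaI) auto
  also have "\<dots> \<le> card edge_reps * q ^ k"
    using sum_bounded_above[of edge_reps "\<lambda>d. card {f. nb_path E k d f}" "q ^ k"] nb_path_targets by simp
  finally show "card (translate_pairs k) \<le> card edge_reps * q ^ k" .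
  show "finite (translate_pairs k)" using inj_on_finite[OF inj img S] .
qed

lemma split_part_cond_conj:
  assumes A: "splitting_image E v A" and g: "\<gamma> \<in> \<Gamma>" and c: "split_part_cond E v A \<gamma> a" and t: "\<tau> \<in> conj_class \<gamma>"
  shows "split_part_cond E v A \<tau> a"
proof -
  obtain h where h: "h \<in> \<Gamma>" "\<tau> = h \<circ> \<gamma> \<circ> inv_into UNIV h" "\<tau> \<in> \<Gamma>" using t by (auto simp: conj_class_iff)
  obtain w where w: "a \<in> A_minus v A" "is_line E w" "\<forall>j. \<gamma> (w j) = w (j + int (displacement E a))"
    using c unfolding split_part_cond_iff[OF A Gamma_aut[OF g]] by blast
  have "is_line E (\<lambda>j. h (w j))" using aut_line[OF Gamma_aut[OF h(1)] w(2)] .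
  moreover have "\<forall>j. \<tau> (h (w j)) = h (w (j + int (displacement E a)))"
    using w(3) Gamma_aut[OF h(1)] by (simp add: h(2))
  ultimately show ?thesis using w(1) unfolding split_part_cond_iff[OF A Gamma_aut[OF h(3)]] by blast
qed

lemma split_classes_eq:
  "split_classes E v A \<Gamma> = {conj_class \<gamma> |\<gamma>. \<gamma> \<in> \<Gamma> \<and> (\<exists>a. split_part_cond E v A \<gamma> a)}"
  by (simp add: split_classes_def conj_class_def)

lemma split_class_rep:
  assumes A: "splitting_image E v A" and c: "c \<in> split_classes E v A \<Gamma>" and r: "r \<in> c"
  shows "r \<in> \<Gamma>" "c = conj_class r" "split_part_cond E v A r (split_part E v A r)"
proof -
  obtain \<gamma> a where g: "c = conj_class \<gamma>" "\<gamma> \<in> \<Gamma>" "split_part_cond E v A \<gamma> a"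
    using c unfolding split_classes_eq by blast
  show rG: "r \<in> \<Gamma>" using r g(1) by (simp add: conj_class_iff)
  show "c = conj_class r" using conj_class_eq r g(1) by simp
  have "split_part_cond E v A r a" using split_part_cond_conj[OF A g(2,3)] r g(1) by simp
  then show "split_part_cond E v A r (split_part E v A r)"
    using split_part_eqI[OF A Gamma_aut[OF rG]] by metis
qed

text \<open>The pairs are sorted by the conjugacy class of \<sigma>. A path of \<open>k\<close>
  steps from an edge to its translate supplies an axis, so each \<sigma> that occurs has
  \<open>a\<close> as its split part. Each class in \<open>C\<close> contributes a positive number
  of pairs, whence \<open>C\<close> is finite.\<close>

lemma sum_split_classes:
  assumes A: "splitting_image E v A" and rep: "\<And>c. c \<in> split_classes E v A \<Gamma> \<Longrightarrow> rep c \<in> c"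
    and a: "a \<in> A_minus v A"
  defines "C \<equiv> {c \<in> split_classes E v A \<Gamma>. split_part E v A (rep c) = a}"
  shows "finite C"
    and "(\<Sum>c\<in>C. displacement E (primitive_root (aut_group E) \<Gamma> (rep c))) = card (translate_pairs (displacement E a))"
proof -
  define k where "k = displacement E a"
  have k: "0 < k" using A_minus_shift(3)[OF A a] displacement_A_minus[OF A a] by (simp add: k_def)
  define P where "P c = {(d, \<sigma>). d \<in> edge_reps \<and> \<sigma> \<in> c \<and> nb_path E k d (map_prod \<sigma> \<sigma> d)}" for c
  have C: "rep c \<in> \<Gamma>" "c = conj_class (rep c)" "split_part_cond E v A (rep c) a" if "c \<in> C" for c
  proof -
    have c: "c \<in> split_classes E v A \<Gamma>" "split_part E v A (rep c) = a" using that by (auto simp: C_def)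
    from split_class_rep[OF A c(1) rep[OF c(1)]] c(2)
    show "rep c \<in> \<Gamma>" "c = conj_class (rep c)" "split_part_cond E v A (rep c) a" by simp_all
  qed
  have card: "card (P c) = displacement E (primitive_root (aut_group E) \<Gamma> (rep c))" "0 < card (P c)" if c: "c \<in> C" for c
  proof -
    obtain w where w: "is_line E w" "\<And>j. rep c (w j) = w (j + int k)"
      using C(3)[OF c] unfolding split_part_cond_iff[OF A Gamma_aut[OF C(1)[OF c]]] k_def by blast
    show card: "card (P c) = displacement E (primitive_root (aut_group E) \<Gamma> (rep c))"
      using card_conj_class_paths[OF C(1)[OF c] w k] C(2)[OF c] by (simp add: P_def)
    show "0 < card (P c)" unfolding card by (rule primitive_root_axis(1)[OF C(1)[OF c] w k])
  qed
  have PC: "conj_class \<sigma> \<in> C" if p: "(d, \<sigma>) \<in> translate_pairs k" for d \<sigma>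
  proof -
    have s: "\<sigma> \<in> \<Gamma>" "nb_path E k d (map_prod \<sigma> \<sigma> d)" using p by (auto simp: translate_pairs_def)
    obtain w where "is_line E w" "\<And>j. \<sigma> (w j) = w (j + int k)"
      using axis_exists[OF Gamma_aut[OF s(1)] k s(2)] by metis
    then have cond: "split_part_cond E v A \<sigma> a"
      unfolding split_part_cond_iff[OF A Gamma_aut[OF s(1)]] using a by (auto simp: k_def)
    then have c: "conj_class \<sigma> \<in> split_classes E v A \<Gamma>" unfolding split_classes_eq using s(1) by blast
    from split_part_cond_conj[OF A s(1) cond rep[OF c]] split_class_rep(1)[OF A c rep[OF c]]
    have "split_part E v A (rep (conj_class \<sigma>)) = a" using split_part_eqI[OF A Gamma_aut] by blast
    then show ?thesis using c by (simp add: C_def)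
  qed
  have sub: "P c \<subseteq> translate_pairs k" if "c \<in> C" for c
    using C(2)[OF that] by (auto simp: P_def translate_pairs_def conj_class_iff)
  have mem: "conj_class \<sigma> = c" if "c \<in> C" "(d, \<sigma>) \<in> P c" for c d \<sigma>
    using C(2)[OF that(1)] that(2) conj_class_eq by (auto simp: P_def)
  have "C \<subseteq> (\<lambda>(d, \<sigma>). conj_class \<sigma>) ` translate_pairs k"
  proof
    fix c assume c: "c \<in> C"
    then have "P c \<noteq> {}" using card(2)[OF c] by auto
    then obtain d \<sigma> where p: "(d, \<sigma>) \<in> P c" by auto
    show "c \<in> (\<lambda>(d, \<sigma>). conj_class \<sigma>) ` translate_pairs k"
      using mem[OF c p] sub[OF c] p by force
  qed
  then show fin: "finite C" by (rule finite_subset) (intro finite_imageI finite_translate_pairs)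
  have eq: "translate_pairs k = (\<Union>c\<in>C. P c)"
  proof (intro equalityI subsetI)
    fix x assume x: "x \<in> translate_pairs k"
    obtain d \<sigma> where ds: "x = (d, \<sigma>)" by fastforce
    then have "x \<in> P (conj_class \<sigma>)" using x conj_class_self by (auto simp: P_def translate_pairs_def)
    then show "x \<in> (\<Union>c\<in>C. P c)" using PC x ds by blast
  qed (use sub in blast)
  have "card (translate_pairs k) = (\<Sum>c\<in>C. card (P c))"
    unfolding eq
  proof (rule card_UN_disjoint[OF fin])
    show "\<forall>c\<in>C. finite (P c)" using sub finite_subset[OF _ finite_translate_pairs] by blast
    show "\<forall>c\<in>C. \<forall>c'\<in>C. c \<noteq> c' \<longrightarrow> P c \<inter> P c' = {}"
    proof (intro ballI impI equals0I)
      fix c c' x assume "c \<in> C" "c' \<in> C" "c \<noteq> c'" "x \<in> P c \<inter> P c'"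
      then show False using mem[of c "fst x" "snd x"] mem[of c' "fst x" "snd x"] by simp
    qed
  qed
  then show "(\<Sum>c\<in>C. displacement E (primitive_root (aut_group E) \<Gamma> (rep c))) = card (translate_pairs (displacement E a))"
    using card(1) by (simp add: k_def)
qed

section \<open>Locally constant functions on the quotient\<close>

abbreviation V :: "(('v \<Rightarrow> 'v) set \<Rightarrow> complex) set" where
  "V \<equiv> smooth_functions E \<Gamma>"

abbreviation R :: "('v \<Rightarrow> 'v) \<Rightarrow> (('v \<Rightarrow> 'v) set \<Rightarrow> complex) \<Rightarrow> (('v \<Rightarrow> 'v) set \<Rightarrow> complex)" where
  "R \<equiv> right_translation E"

abbreviation fixer :: "'v set \<Rightarrow> ('v \<Rightarrow> 'v) set" where
  "fixer \<equiv> pointwise_stabilizer E"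

lemma fixer_iff: "k \<in> fixer F \<longleftrightarrow> k \<in> Aut \<and> (\<forall>x\<in>F. k x = x)"
  by (simp add: pointwise_stabilizer_def)

lemma coset_translate: "\<gamma> \<in> \<Gamma> \<Longrightarrow> coset (\<gamma> \<circ> g) = coset g"
proof (intro equalityI subsetI)
  fix x assume g: "\<gamma> \<in> \<Gamma>" and "x \<in> coset (\<gamma> \<circ> g)"
  then obtain h where "h \<in> \<Gamma>" "x = (h \<circ> \<gamma>) \<circ> g" by (auto simp: coset_eq comp_assoc)
  then show "x \<in> coset g" using g Gamma_comp unfolding coset_eq by blast
next
  fix x assume g: "\<gamma> \<in> \<Gamma>" and "x \<in> coset g"
  then obtain h where h: "h \<in> \<Gamma>" "x = h \<circ> g" by (auto simp: coset_eq)
  then have "x = (h \<circ> inv_into UNIV \<gamma>) \<circ> (\<gamma> \<circ> g)" using Gamma_aut[OF g] by (auto simp: fun_eq_iff)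
  then show "x \<in> coset (\<gamma> \<circ> g)" using h g Gamma_comp Gamma_inv unfolding coset_eq by blast
qed

lemma coset_mult: "coset g #>\<^bsub>aut_group E\<^esub> y = coset (g \<circ> y)"
  by (auto simp: r_coset_def comp_assoc)

lemma rcosets_eq: "rcosets\<^bsub>aut_group E\<^esub> \<Gamma> = coset ` Aut"
  by (auto simp: RCOSETS_def)

lemma R_coset [simp]: "R y f (coset g) = f (coset (g \<circ> y))"
  by (simp add: right_translation_def coset_mult)

text \<open>Right multiplication by \<open>y\<close> is invertible on arbitrary sets of maps, so
  sets that are not cosets stay outside the coset space and extension by zero is respected.\<close>

lemma R_off:
  assumes y: "y \<in> Aut" and c: "c \<notin> coset ` Aut" and f: "\<And>c. c \<notin> coset ` Aut \<Longrightarrow> f c = 0"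
  shows "R y f c = 0"
proof -
  have "c #>\<^bsub>aut_group E\<^esub> y \<notin> coset ` Aut"
  proof
    assume "c #>\<^bsub>aut_group E\<^esub> y \<in> coset ` Aut"
    then obtain g where g: "g \<in> Aut" "c #>\<^bsub>aut_group E\<^esub> y = coset g" by blast
    have "c = (c #>\<^bsub>aut_group E\<^esub> y) #>\<^bsub>aut_group E\<^esub> (inv_into UNIV y)"
    proof -
      have "h \<circ> y \<circ> inv_into UNIV y = h" for h :: "'v \<Rightarrow> 'v" using y by (auto simp: fun_eq_iff)
      then show ?thesis by (auto simp: r_coset_def)
    qed
    then have "c = coset (g \<circ> inv_into UNIV y)" using g(2) coset_mult by simp
    then show False using c g(1) aut_comp aut_inv[OF y] by blast
  qed
  then show ?thesis using f by (simp add: right_translation_def)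
qed

text \<open>By compactness local constancy is uniform: finitely many neighbourhoods cover the
  quotient, and the union of the finite vertex sets belonging to them works at every coset.\<close>

lemma smooth_functions_iff:
  "f \<in> V \<longleftrightarrow> (\<forall>c. c \<notin> coset ` Aut \<longrightarrow> f c = 0) \<and>
     (\<exists>F. finite F \<and> (\<forall>g\<in>Aut. \<forall>k\<in>fixer F. f (coset (g \<circ> k)) = f (coset g)))"
proof -
  have top: "topspace (coset_space E \<Gamma>) = coset ` Aut"
    by (simp add: topspace_coset_space rcosets_eq)
  have "locally_constant_on_topspace (coset_space E \<Gamma>) f \<longleftrightarrow>
    (\<exists>F. finite F \<and> (\<forall>g\<in>Aut. \<forall>k\<in>fixer F. f (coset (g \<circ> k)) = f (coset g)))" (is "?L \<longleftrightarrow> ?R")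
  proof
    assume ?L
    then have L: "\<forall>c\<in>coset ` Aut. \<exists>U. openin (coset_space E \<Gamma>) U \<and> c \<in> U \<and> (\<forall>d\<in>U. f d = f c)"
      unfolding locally_constant_on_topspace_def top .
    have "\<exists>F. finite F \<and> F \<noteq> {} \<and> (\<forall>k\<in>fixer F. f (coset (g \<circ> k)) = f (coset g))" if g: "g \<in> Aut" for g
    proof -
      obtain U where U: "openin (coset_space E \<Gamma>) U" "coset g \<in> U" "\<And>d. d \<in> U \<Longrightarrow> f d = f (coset g)"
        using bspec[OF L imageI[OF g]] by blast
      have "aut_open E {x \<in> Aut. coset x \<in> U}"
        using U(1) unfolding coset_space_def openin_quotient_topology topspace_aut_topology
        by (simp add: openin_aut_topology)
      then obtain F where F: "finite F" "F \<noteq> {}" "g <#\<^bsub>aut_group E\<^esub> fixer F \<subseteq> {x \<in> Aut. coset x \<in> U}"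
        using g U(2) unfolding aut_open_def by blast
      have "f (coset (g \<circ> k)) = f (coset g)" if "k \<in> fixer F" for k
        by (rule U(3)) (use F(3) that in \<open>auto simp: l_coset_def\<close>)
      then show ?thesis using F by blast
    qed
    then obtain F where F: "\<And>g. g \<in> Aut \<Longrightarrow> finite (F g)" "\<And>g. g \<in> Aut \<Longrightarrow> F g \<noteq> {}"
      "\<And>g k. g \<in> Aut \<Longrightarrow> k \<in> fixer (F g) \<Longrightarrow> f (coset (g \<circ> k)) = f (coset g)" by metis
    \<comment> \<open>The double coset of \<open>g\<close> under the lattice and
      \<open>fixer (F g)\<close>, an open neighbourhood on which \<open>f\<close> is
      constant.\<close>
    define Q where "Q g x \<longleftrightarrow> (\<exists>\<gamma>\<in>\<Gamma>. \<exists>k\<in>fixer (F g). x = \<gamma> \<circ> (g \<circ> k))" for g x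
    define U where "U g = coset ` {x \<in> Aut. Q g x}" for g
    have op: "openin (coset_space E \<Gamma>) (U g)" if g: "g \<in> Aut" for g
      unfolding U_def
    proof (rule open_cosets)
      show "Q g (\<gamma> \<circ> x)" if gx: "\<gamma> \<in> \<Gamma>" "Q g x" for \<gamma> x
      proof -
        obtain \<delta> k where k: "\<delta> \<in> \<Gamma>" "k \<in> fixer (F g)" "x = \<delta> \<circ> (g \<circ> k)" using gx(2) Q_def by blast
        then have "\<gamma> \<circ> x = (\<gamma> \<circ> \<delta>) \<circ> (g \<circ> k)" by (simp add: comp_assoc)
        then show ?thesis using k gx(1) Gamma_comp unfolding Q_def by blast
      qed
      show "\<exists>F. finite F \<and> F \<noteq> {} \<and> (\<forall>k\<in>fixer F. Q g (x \<circ> k))" if Qx: "Q g x" for x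
      proof -
        obtain \<delta> k where k: "\<delta> \<in> \<Gamma>" "k \<in> fixer (F g)" "x = \<delta> \<circ> (g \<circ> k)" using Qx Q_def by blast
        have "Q g (x \<circ> l)" if l: "l \<in> fixer (F g)" for l
        proof -
          have "k \<circ> l \<in> fixer (F g)" using k(2) l by (simp add: fixer_iff aut_comp)
          moreover have "x \<circ> l = \<delta> \<circ> (g \<circ> (k \<circ> l))" by (simp add: k(3) comp_assoc)
          ultimately show ?thesis using k(1) unfolding Q_def by blast
        qed
        then show ?thesis using F(1,2)[OF g] by blast
      qed
    qed
    have self: "coset g \<in> U g" if "g \<in> Aut" for g
    proof -
      have "id \<in> fixer (F g)" by (simp add: fixer_iff)
      then have "Q g g" unfolding Q_def using Gamma_id by (intro bexI[of _ id]) simp_all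
      then show ?thesis using that by (auto simp: U_def)
    qed
    have "\<forall>X\<in>U ` Aut. openin (coset_space E \<Gamma>) X" using op by blast
    moreover have "topspace (coset_space E \<Gamma>) \<subseteq> \<Union>(U ` Aut)" unfolding top using self by blast
    ultimately obtain \<F> where "finite \<F>" "\<F> \<subseteq> U ` Aut" "topspace (coset_space E \<Gamma>) \<subseteq> \<Union>\<F>"
      using cocompact unfolding cocompact_in_aut_def compact_space_def compactin_def by meson
    then obtain H where H: "finite H" "H \<subseteq> Aut" "coset ` Aut \<subseteq> \<Union>(U ` H)"
      unfolding top by (metis finite_subset_image)
    have "f (coset (x \<circ> l)) = f (coset x)" if x: "x \<in> Aut" and l: "l \<in> fixer (\<Union>(F ` H))" for x l
    proof -
      obtain g where g: "g \<in> H" "coset x \<in> U g" using H(3) x by blast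
      then obtain x' where x': "coset x = coset x'" "Q g x'" by (auto simp: U_def)
      then obtain \<delta> k where k: "\<delta> \<in> \<Gamma>" "k \<in> fixer (F g)" "x' = \<delta> \<circ> (g \<circ> k)" using Q_def by blast
      have gA: "g \<in> Aut" using g H by blast
      have "k \<circ> l \<in> fixer (F g)" using k(2) l g(1) by (simp add: fixer_iff aut_comp)
      have "coset (x \<circ> l) = coset (x' \<circ> l)" using x'(1) by (metis coset_mult)
      also have "\<dots> = coset (g \<circ> (k \<circ> l))" using coset_translate[OF k(1)] by (simp add: k(3) comp_assoc)
      finally have "f (coset (x \<circ> l)) = f (coset g)" using F(3)[OF gA \<open>k \<circ> l \<in> fixer (F g)\<close>] by simp
      also have "\<dots> = f (coset (g \<circ> k))" using F(3)[OF gA k(2)] by simp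
      also have "\<dots> = f (coset x)" using coset_translate[OF k(1)] x'(1) by (simp add: k(3))
      finally show ?thesis .
    qed
    moreover have "finite (\<Union>(F ` H))" using H F(1) by blast
    ultimately show ?R by blast
  next
    assume ?R
    then obtain F where F: "finite F" "\<And>g k. g \<in> Aut \<Longrightarrow> k \<in> fixer F \<Longrightarrow> f (coset (g \<circ> k)) = f (coset g)"
      by blast
    show ?L
      unfolding locally_constant_on_topspace_def top
    proof (intro ballI)
      fix c assume "c \<in> coset ` Aut"
      then obtain g where g: "g \<in> Aut" "c = coset g" by blast
      let ?U = "coset ` {x \<in> Aut. f (coset x) = f c}"
      have "openin (coset_space E \<Gamma>) ?U"
      proof (rule open_cosets)
        \<comment> \<open>Inserting a vertex supplies the nonempty set that the topology asks for,
          since the given \<open>F\<close> may be empty.\<close>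
        show "\<exists>F. finite F \<and> F \<noteq> {} \<and> (\<forall>k\<in>fixer F. f (coset (x \<circ> k)) = f c)" if "x \<in> Aut" "f (coset x) = f c" for x
          using F(1) F(2)[OF that(1)] that(2)
          by (intro exI[of _ "insert (v 0) F"]) (simp add: fixer_iff)
      qed (simp add: coset_translate)
      then show "\<exists>U. openin (coset_space E \<Gamma>) U \<and> c \<in> U \<and> (\<forall>d\<in>U. f d = f c)"
        using g by (intro exI[of _ ?U]) auto
    qed
  qed
  then show ?thesis by (auto simp: smooth_functions_def top)
qed

lemma smooth_zero_off: "f \<in> V \<Longrightarrow> c \<notin> coset ` Aut \<Longrightarrow> f c = 0"
  by (simp add: smooth_functions_iff)

lemma smooth_fixer:
  assumes "f \<in> V"
  obtains F where "finite F" "\<And>g k. g \<in> Aut \<Longrightarrow> k \<in> fixer F \<Longrightarrow> f (coset (g \<circ> k)) = f (coset g)"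
  using assms by (auto simp: smooth_functions_iff)

lemma smooth_eqI:
  assumes "f \<in> V" "f' \<in> V" "\<And>g. g \<in> Aut \<Longrightarrow> f (coset g) = f' (coset g)"
  shows "f = f'"
  using assms smooth_zero_off by (metis ext imageE)

lemma smooth_0: "0 \<in> V"
  by (auto simp: smooth_functions_iff)

lemma smooth_add:
  assumes "f \<in> V" "f' \<in> V"
  shows "f + f' \<in> V"
proof -
  obtain F where F: "finite F" "\<And>g k. g \<in> Aut \<Longrightarrow> k \<in> fixer F \<Longrightarrow> f (coset (g \<circ> k)) = f (coset g)"
    using smooth_fixer[OF assms(1)] by blast
  obtain F' where F': "finite F'" "\<And>g k. g \<in> Aut \<Longrightarrow> k \<in> fixer F' \<Longrightarrow> f' (coset (g \<circ> k)) = f' (coset g)"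
    using smooth_fixer[OF assms(2)] by blast
  have "(f + f') (coset (g \<circ> k)) = (f + f') (coset g)" if "g \<in> Aut" "k \<in> fixer (F \<union> F')" for g k
    using that F(2)[of g k] F'(2)[of g k] by (simp add: fixer_iff)
  moreover have "(f + f') c = 0" if "c \<notin> coset ` Aut" for c
    using smooth_zero_off[OF assms(1) that] smooth_zero_off[OF assms(2) that] by simp
  moreover have "finite (F \<union> F')" using F F' by simp
  ultimately show ?thesis unfolding smooth_functions_iff by blast
qed

lemma smooth_scale: "f \<in> V \<Longrightarrow> (\<lambda>x. c * f x) \<in> V"
  unfolding smooth_functions_iff by auto

lemma smooth_R:
  assumes f: "f \<in> V" and y: "y \<in> Aut"
  shows "R y f \<in> V"
proof -
  obtain F where F: "finite F" "\<And>g k. g \<in> Aut \<Longrightarrow> k \<in> fixer F \<Longrightarrow> f (coset (g \<circ> k)) = f (coset g)"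
    using smooth_fixer[OF f] by blast
  have "f (coset (g \<circ> k \<circ> y)) = f (coset (g \<circ> y))" if g: "g \<in> Aut" and k: "k \<in> fixer (y ` F)" for g k
  proof -
    have "inv_into UNIV y \<circ> k \<circ> y \<in> fixer F"
      using k y by (auto simp: fixer_iff intro!: aut_comp aut_inv)
    moreover have "g \<circ> k \<circ> y = (g \<circ> y) \<circ> (inv_into UNIV y \<circ> k \<circ> y)" using y by (auto simp: fun_eq_iff)
    ultimately show ?thesis using F(2)[OF aut_comp[OF g y]] by metis
  qed
  then have "\<exists>F. finite F \<and> (\<forall>g\<in>Aut. \<forall>k\<in>fixer F. R y f (coset (g \<circ> k)) = R y f (coset g))"
    using F(1) by (intro exI[of _ "y ` F"]) auto
  then show ?thesis
    unfolding smooth_functions_iff[of "R y f"] using R_off[OF y] smooth_zero_off[OF f] by blast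
qed

end

section \<open>Averaging over stabilizers of rays\<close>

text \<open>Representatives of \<open>H\<close> modulo the elements fixing \<open>F\<close>
  pointwise, one for each restriction to \<open>F\<close>. A sum over them takes the place of an
  integral over \<open>H\<close>.\<close>

definition quotient_reps :: "('a \<Rightarrow> 'a) set \<Rightarrow> 'a set \<Rightarrow> ('a \<Rightarrow> 'a) set" where
  "quotient_reps H F = (\<lambda>\<rho>. SOME s. s \<in> H \<and> restrict s F = \<rho>) ` (\<lambda>s. restrict s F) ` H"

lemma quotient_reps_transversal:
  shows "quotient_reps H F \<subseteq> H"
    and "s \<in> H \<Longrightarrow> \<exists>t\<in>quotient_reps H F. \<forall>x\<in>F. s x = t x"
    and "t \<in> quotient_reps H F \<Longrightarrow> t' \<in> quotient_reps H F \<Longrightarrow> (\<And>x. x \<in> F \<Longrightarrow> t x = t' x) \<Longrightarrow> t = t'"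
proof -
  define r where "r \<rho> = (SOME s. s \<in> H \<and> restrict s F = \<rho>)" for \<rho>
  have r: "r (restrict s F) \<in> H" "restrict (r (restrict s F)) F = restrict s F" if "s \<in> H" for s
    unfolding r_def by (rule someI2[of _ s]; use that in simp)+
  have Q: "quotient_reps H F = (\<lambda>s. r (restrict s F)) ` H"
    by (simp add: quotient_reps_def r_def image_image)
  show "quotient_reps H F \<subseteq> H" unfolding Q using r by blast
  show "\<exists>t\<in>quotient_reps H F. \<forall>x\<in>F. s x = t x" if "s \<in> H"
    unfolding Q using that r(2)[OF that] by (metis imageI restrict_apply')
  show "t = t'" if tt: "t \<in> quotient_reps H F" "t' \<in> quotient_reps H F" "\<And>x. x \<in> F \<Longrightarrow> t x = t' x"
  proof -
    obtain s s' where s: "s \<in> H" "t = r (restrict s F)" "s' \<in> H" "t' = r (restrict s' F)" using tt unfolding Q by blast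
    then have "restrict t F = restrict s F" "restrict t' F = restrict s' F" using r by auto
    moreover have "restrict t F = restrict t' F" using tt(3) by (rule restrict_ext)
    ultimately show ?thesis using s by simp
  qed
qed

text \<open>Translation permutes the restrictions to \<open>F\<close>: on the right because
  \<open>s\<close> maps \<open>F\<close> onto itself, on the left because \<open>s\<close> is
  injective. As \<open>h\<close> sees only restrictions, the sums are unchanged.\<close>

lemma sum_quotient_reps:
  fixes h :: "('a \<Rightarrow> 'a) \<Rightarrow> 'b::comm_monoid_add"
  assumes comp: "\<And>s t. s \<in> H \<Longrightarrow> t \<in> H \<Longrightarrow> s \<circ> t \<in> H" and inj: "\<And>s. s \<in> H \<Longrightarrow> inj s"
    and F: "finite F" "\<And>s. s \<in> H \<Longrightarrow> s ` F = F"
    and h: "\<And>s t. s \<in> H \<Longrightarrow> t \<in> H \<Longrightarrow> (\<And>x. x \<in> F \<Longrightarrow> s x = t x) \<Longrightarrow> h s = h t"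
    and s: "s \<in> H"
  shows "finite (quotient_reps H F)"
    and "(\<Sum>t\<in>quotient_reps H F. h (t \<circ> s)) = (\<Sum>t\<in>quotient_reps H F. h t)"
    and "(\<Sum>t\<in>quotient_reps H F. h (s \<circ> t)) = (\<Sum>t\<in>quotient_reps H F. h t)"
proof -
  let ?T = "quotient_reps H F"
  note T = quotient_reps_transversal[where H = H and F = F]
  have "(\<lambda>s. restrict s F) ` H \<subseteq> F \<rightarrow>\<^sub>E F"
  proof
    fix \<rho> assume "\<rho> \<in> (\<lambda>s. restrict s F) ` H"
    then obtain s where "s \<in> H" "\<rho> = restrict s F" by blast
    then show "\<rho> \<in> F \<rightarrow>\<^sub>E F" using F(2)[of s] by auto
  qed
  then have "finite ((\<lambda>s. restrict s F) ` H)" by (rule finite_subset) (simp add: F(1) finite_PiE)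
  then show fin: "finite ?T" unfolding quotient_reps_def by (rule finite_imageI)
  have gen: "(\<Sum>t\<in>?T. h (p t)) = (\<Sum>t\<in>?T. h t)"
    if p: "\<And>t. t \<in> ?T \<Longrightarrow> p t \<in> H"
      and pinj: "\<And>t t'. t \<in> ?T \<Longrightarrow> t' \<in> ?T \<Longrightarrow> (\<And>x. x \<in> F \<Longrightarrow> p t x = p t' x) \<Longrightarrow> t = t'" for p
  proof -
    have "\<forall>t\<in>?T. \<exists>u\<in>?T. \<forall>x\<in>F. p t x = u x" using T(2) p by blast
    then obtain u where u: "\<And>t. t \<in> ?T \<Longrightarrow> u t \<in> ?T" "\<And>t x. t \<in> ?T \<Longrightarrow> x \<in> F \<Longrightarrow> p t x = u t x"
      by metis
    have "inj_on u ?T"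
    proof (rule inj_onI)
      fix t t' assume "t \<in> ?T" "t' \<in> ?T" "u t = u t'"
      then show "t = t'" using pinj[of t t'] u(2) by metis
    qed
    then have "bij_betw u ?T ?T" using endo_inj_surj[OF fin _ \<open>inj_on u ?T\<close>] u(1) unfolding bij_betw_def by blast
    have "(\<Sum>t\<in>?T. h (p t)) = (\<Sum>t\<in>?T. h (u t))"
    proof (rule sum.cong)
      show "h (p t) = h (u t)" if "t \<in> ?T" for t
        using h[OF p[OF that] subsetD[OF T(1) u(1)[OF that]]] u(2)[OF that] by blast
    qed simp
    also have "\<dots> = (\<Sum>t\<in>?T. h t)" by (rule sum.reindex_bij_betw) fact
    finally show ?thesis .
  qed
  show "(\<Sum>t\<in>?T. h (t \<circ> s)) = (\<Sum>t\<in>?T. h t)"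
  proof (rule gen)
    fix t t' assume t: "t \<in> ?T" "t' \<in> ?T" "\<And>x. x \<in> F \<Longrightarrow> (t \<circ> s) x = (t' \<circ> s) x"
    show "t = t'"
    proof (rule T(3)[OF t(1,2)])
      fix x assume "x \<in> F"
      then obtain y where "y \<in> F" "x = s y" using F(2)[OF s] by blast
      then show "t x = t' x" using t(3)[of y] by simp
    qed
  qed (use T(1) comp s in blast)
  show "(\<Sum>t\<in>?T. h (s \<circ> t)) = (\<Sum>t\<in>?T. h t)"
  proof (rule gen)
    fix t t' assume t: "t \<in> ?T" "t' \<in> ?T" "\<And>x. x \<in> F \<Longrightarrow> (s \<circ> t) x = (s \<circ> t') x"
    show "t = t'" by (rule T(3)[OF t(1,2)]) (use t(3) inj[OF s] in \<open>auto simp: inj_eq\<close>)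
  qed (use T(1) comp s in blast)
qed

context tree
begin

lemma path_dist_aut:
  assumes "g \<in> carrier (aut_group E)"
  shows "path_dist E (g x) (g y) = path_dist E x y"
proof (cases "path_dist E x y")
  case 0
  then have "x = y" using path_dist_eq_Suc_iff nb_path_exists by (metis path_dist_nb_path nat.distinct(1))
  then show ?thesis by simp
next
  case (Suc n)
  then obtain e f where e: "nb_path E n e f" "fst e = x" "snd f = y" using path_dist_eq_Suc_iff by blast
  then show ?thesis using path_dist_nb_path[OF nb_path_aut[OF assms e(1)]] Suc by simp
qed

end

section \<open>Finite stable sets and half-trees\<close>

context tree_line
begin

text \<open>A ball around \<open>x0\<close> containing \<open>F\<close>: finite because the tree is
  locally finite, stable because automorphisms preserve distance.\<close>

lemma stable_finite_superset:
  assumes "finite F"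
  obtains F' where "finite F'" "F \<subseteq> F'" "\<And>s. s \<in> Aut \<Longrightarrow> s x0 = x0 \<Longrightarrow> s ` F' = F'"
proof -
  define r where "r = Max (insert 0 (path_dist E x0 ` F))"
  define B where "B = {x. path_dist E x0 x \<le> r}"
  have "B \<subseteq> insert x0 (\<Union>y\<in>{y. E x0 y}. \<Union>m<r. snd ` {f. nb_path E m (x0, y) f})"
  proof
    fix x assume x: "x \<in> B"
    show "x \<in> insert x0 (\<Union>y\<in>{y. E x0 y}. \<Union>m<r. snd ` {f. nb_path E m (x0, y) f})"
    proof (cases "x = x0")
      case False
      then obtain n e f where p: "nb_path E n e f" "fst e = x0" "snd f = x" using nb_path_exists by metis
      then have "n < r" using x path_dist_nb_path[OF p(1)] by (simp add: B_def)
      moreover have "E x0 (snd e)" "nb_path E n (x0, snd e) f" using nb_path_edges[OF p(1)] p by auto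
      ultimately show ?thesis using p(3) by blast
    qed simp
  qed
  moreover have "finite (insert x0 (\<Union>y\<in>{y. E x0 y}. \<Union>m<r. snd ` {f. nb_path E m (x0, y) f}))"
    using finite_nbrs nb_path_targets by blast
  ultimately have fin: "finite B" by (rule finite_subset)
  have sub: "F \<subseteq> B"
  proof
    fix x assume "x \<in> F"
    then have "path_dist E x0 x \<le> r" unfolding r_def using assms by (intro Max_ge) auto
    then show "x \<in> B" by (simp add: B_def)
  qed
  have st: "s ` B = B" if s: "s \<in> Aut" "s x0 = x0" for s
  proof (rule card_subset_eq[OF fin])
    show "s ` B \<subseteq> B" using path_dist_aut[OF s(1), of x0] s(2) by (auto simp: B_def)
    show "card (s ` B) = card B" using aut_inj[OF s(1)] by (intro card_image) (auto intro: inj_on_subset)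
  qed
  show thesis by (rule that[OF fin sub st])
qed

text \<open>The component of \<open>v n\<close> once the edge from \<open>v n\<close> to
  \<open>v (n + 1)\<close> is removed, described by the geodesics that enter it through this edge so
  that path arguments apply.\<close>

definition half_tree :: "int \<Rightarrow> 'v set" where
  "half_tree n = {x. \<exists>m f. nb_path E m (v (n + 1), v n) f \<and> snd f = x}"

lemma half_tree_aut_iff:
  assumes b: "b \<in> Aut" "b (v n) = v n" "b (v (n + 1)) = v (n + 1)"
  shows "b x \<in> half_tree n \<longleftrightarrow> x \<in> half_tree n"
proof -
  have 1: "g x \<in> half_tree n" if g: "g \<in> Aut" "g (v n) = v n" "g (v (n + 1)) = v (n + 1)" and x: "x \<in> half_tree n" for g x
  proof -
    obtain m f where "nb_path E m (v (n + 1), v n) f" "snd f = x" using x by (auto simp: half_tree_def)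
    then have "nb_path E m (v (n + 1), v n) (map_prod g g f)" "snd (map_prod g g f) = g x"
      using nb_path_aut[OF g(1), of m "(v (n + 1), v n)" f] g by auto
    then show ?thesis unfolding half_tree_def by blast
  qed
  have "inv_into UNIV b (v n) = v n" "inv_into UNIV b (v (n + 1)) = v (n + 1)"
    using aut_inv_apply(1)[OF b(1)] b by metis+
  then show ?thesis using 1[OF b] 1[OF aut_inv[OF b(1)], of "b x"] b(1) by auto
qed

lemma half_tree_boundary:
  assumes "E x y" "x \<in> half_tree n" "y \<notin> half_tree n"
  shows "x = v n \<and> y = v (n + 1)"
proof -
  obtain m f where p: "nb_path E m (v (n + 1), v n) f" "snd f = x" using assms by (auto simp: half_tree_def)
  have y: "y = fst f"
  proof (rule ccontr)
    assume "y \<noteq> fst f"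
    then have "nb_step E f (x, y)" using p assms(1) nb_path_edges[OF p(1)] by (auto simp: nb_step_def)
    then have "nb_path E (Suc m) (v (n + 1), v n) (x, y)" using p(1) nb_path_Suc by blast
    then show False using assms(3) unfolding half_tree_def by (metis (mono_tags, lifting) mem_Collect_eq snd_conv)
  qed
  show ?thesis
  proof (cases m)
    case 0
    then show ?thesis using p y by auto
  next
    case (Suc l)
    then obtain g where "nb_path E l (v (n + 1), v n) g" "nb_step E g f" using p nb_path_Suc by blast
    then have "nb_path E l (v (n + 1), v n) g" "snd g = y" using y by (simp_all add: nb_step_def)
    then have "y \<in> half_tree n" unfolding half_tree_def by blast
    then show ?thesis using assms by blast
  qed
qed

lemma line_notin_half_tree: "m > n \<Longrightarrow> v m \<notin> half_tree n"
proof
  assume "m > n" "v m \<in> half_tree n"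
  then obtain l f where "nb_path E l (v (n + 1), v n) f" "snd f = v m" by (auto simp: half_tree_def)
  from nb_path_between_line[OF line this(1) _ this(2), of "n + 1"] \<open>m > n\<close> show False by simp
qed

text \<open>Rays into the cusp merge with the line. As soon as the ray from \<open>x\<close> runs
  through \<open>v n\<close> and \<open>v (n + 1)\<close>, its reversal is a path entering the
  half-tree.\<close>

lemma half_tree_absorbs:
  assumes "finite F"
  shows "\<exists>n0. \<forall>n\<ge>n0. F \<subseteq> half_tree n"
proof -
  have "\<exists>n0. \<forall>n\<ge>n0. x \<in> half_tree n" for x
  proof -
    define w where "w = ray_from E v x"
    have w: "is_ray E w" "w 0 = x" using ray_from[of x] line_cusp_iff by (auto simp: w_def)
    obtain c i0 where c: "\<And>i. i \<ge> i0 \<Longrightarrow> w i = v (int i + c)" using ray_from(1)[of x] line_cusp_iff w_def by metis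
    have "x \<in> half_tree n" if n: "n \<ge> int i0 + c" for n
    proof -
      define i where "i = nat (n - c)"
      have i: "i \<ge> i0" "int i + c = n" using n by (auto simp: i_def)
      have "nb_path E i (w 0, w (Suc 0)) (w i, w (Suc i))" using ray_nb_path[OF w(1), of i 0] by simp
      from nb_path_rev[OF this] have "nb_path E i (w (Suc i), w i) (w (Suc 0), w 0)" by simp
      moreover have "w i = v n" "w (Suc i) = v (n + 1)" using c[of i] c[of "Suc i"] i by (auto simp: ac_simps)
      ultimately show ?thesis using w(2) unfolding half_tree_def by auto
    qed
    then show ?thesis by blast
  qed
  then obtain n0 where n0: "\<And>x n. n \<ge> n0 x \<Longrightarrow> x \<in> half_tree n" by metis
  show ?thesis
  proof (intro exI allI impI subsetI)
    fix n x assume "n \<ge> Max (insert 0 (n0 ` F))" "x \<in> F"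
    moreover have "n0 x \<le> Max (insert 0 (n0 ` F))" using assms \<open>x \<in> F\<close> by (intro Max_ge) auto
    ultimately show "x \<in> half_tree n" using n0 by simp
  qed
qed

text \<open>The stabilizer of an edge is the product of the groups acting on the two half-trees obtained by
  removing that edge.\<close>

lemma half_tree_cut:
  assumes b: "b \<in> Aut" "b (v n) = v n" "b (v (n + 1)) = v (n + 1)"
  obtains s where "s \<in> ray_fixer n" "\<And>x. x \<in> half_tree n \<Longrightarrow> s x = b x"
proof
  \<comment> \<open>\<open>b\<close> on the half-tree and the identity elsewhere; the two parts are
    joined only by the edge whose ends \<open>b\<close> fixes.\<close>
  define s where "s x = (if x \<in> half_tree n then b x else x)" for x
  have inj: "s x \<noteq> s y" if "x \<noteq> y" for x y
    using that half_tree_aut_iff[OF b] inj_eq[OF aut_inj[OF b(1)]] by (auto simp: s_def)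
  have "s \<in> Aut"
  proof (rule local_injection_aut)
    show "E (s x) (s y)" if "E x y" for x y
    proof -
      consider "x \<in> half_tree n" "y \<in> half_tree n" | "x \<notin> half_tree n" "y \<notin> half_tree n"
        | "x = v n" "y = v (n + 1)" "x \<in> half_tree n" "y \<notin> half_tree n"
        | "y = v n" "x = v (n + 1)" "y \<in> half_tree n" "x \<notin> half_tree n"
        using half_tree_boundary[OF \<open>E x y\<close>] half_tree_boundary[OF E_sym[OF \<open>E x y\<close>]] by blast
      then show ?thesis by cases (use that b aut_adj[OF b(1), of x y] in \<open>auto simp: s_def\<close>)
    qed
  qed (use inj in blast)
  moreover have "s (v m) = v m" if "m \<ge> n" for m
    using that b(2) line_notin_half_tree[of n m] by (cases "m = n") (auto simp: s_def)
  ultimately show "s \<in> ray_fixer n" by (simp add: ray_fixer_def)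
  show "s x = b x" if "x \<in> half_tree n" for x using that by (simp add: s_def)
qed

end

interpretation fun_space: vector_space "\<lambda>(c::complex) (f::'x \<Rightarrow> complex) x. c * f x"
  by unfold_locales (auto simp: fun_eq_iff algebra_simps)

text \<open>In its beta-reduced form this rule reassociates products under an abstraction, so that simp
  loops together with associativity.\<close>

declare fun_space.scale_scale [simp del]

section \<open>Relations of one level and averages\<close>

context tree_lattice
begin

definition rel :: "int \<Rightarrow> (('v \<Rightarrow> 'v) set \<Rightarrow> complex) set" where
  "rel n = fun_space.span {f - R s f |f s. f \<in> V \<and> s \<in> ray_fixer n}"

lemma rel_base: "f \<in> V \<Longrightarrow> s \<in> ray_fixer n \<Longrightarrow> f - R s f \<in> rel n"
  unfolding rel_def by (rule fun_space.span_base) blast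

lemma rel_mono: "n \<le> m \<Longrightarrow> rel n \<subseteq> rel m"
  unfolding rel_def by (rule fun_space.span_mono) (use ray_fixer_mono in blast)

text \<open>A combination of relations uses finitely many elements of \<open>S\<close>, and since
  the groups \<open>ray_fixer n\<close> increase with \<open>n\<close>, one of them contains all of
  these.\<close>

lemma coinvariant_relations_eq: "coinvariant_relations E v \<Gamma> = (\<Union>n. rel n)"
proof -
  have eq: "coinvariant_relations E v \<Gamma> = fun_space.span {f - R s f |f s. f \<in> V \<and> s \<in> horo_subgroup E v}"
    by (simp add: coinvariant_relations_def)
  show ?thesis
  proof (intro equalityI subsetI)
    fix w assume "w \<in> coinvariant_relations E v \<Gamma>"
    then show "w \<in> (\<Union>n. rel n)"
      unfolding eq
    proof (induction rule: fun_space.span_induct_alt)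
      case base
      show ?case using fun_space.span_zero unfolding rel_def by (auto simp: zero_fun_def)
    next
      case (step c x y)
      then obtain f s where x: "x = f - R s f" "f \<in> V" "s \<in> horo_subgroup E v" by blast
      obtain n where n: "s \<in> ray_fixer n" using x(3) unfolding horo_subgroup_eq by blast
      obtain m where m: "y \<in> rel m" using step by blast
      have "x \<in> rel (max n m)" "y \<in> rel (max n m)"
        using rel_mono[of n "max n m"] rel_mono[of m "max n m"] rel_base[OF x(2) n] m x(1) by auto
      then have "(\<lambda>z. c * x z) + y \<in> rel (max n m)"
        unfolding rel_def by (intro fun_space.span_add fun_space.span_scale)
      then show ?case by blast
    qed
  next
    fix w assume "w \<in> (\<Union>n. rel n)"
    then obtain n where "w \<in> rel n" by blast
    moreover have "rel n \<subseteq> coinvariant_relations E v \<Gamma>"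
      unfolding eq rel_def by (rule fun_space.span_mono) (unfold horo_subgroup_eq, blast)
    ultimately show "w \<in> coinvariant_relations E v \<Gamma>" by blast
  qed
qed

text \<open>The integral over the compact group \<open>ray_fixer n\<close> written as a finite sum.
  It has this meaning when \<open>F\<close> is finite and stable under the group and
  \<open>f\<close> satisfies \<open>fixed_by F\<close>.\<close>

definition average :: "int \<Rightarrow> 'v set \<Rightarrow> (('v \<Rightarrow> 'v) set \<Rightarrow> complex) \<Rightarrow> (('v \<Rightarrow> 'v) set \<Rightarrow> complex)" where
  "average n F f = (\<lambda>c. (\<Sum>t\<in>quotient_reps (ray_fixer n) F. R t f c) / of_nat (card (quotient_reps (ray_fixer n) F)))"

definition fixed_by :: "'v set \<Rightarrow> (('v \<Rightarrow> 'v) set \<Rightarrow> complex) \<Rightarrow> bool" where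
  "fixed_by F f \<longleftrightarrow> (\<forall>g\<in>Aut. \<forall>k\<in>fixer F. f (coset (g \<circ> k)) = f (coset g))"

lemma smooth_fixed_by: "f \<in> V \<Longrightarrow> \<exists>F. finite F \<and> fixed_by F f"
  by (simp add: smooth_functions_iff fixed_by_def)

lemma fixed_by_mono: "fixed_by F f \<Longrightarrow> F \<subseteq> F' \<Longrightarrow> fixed_by F' f"
  unfolding fixed_by_def by (meson fixer_iff subsetD)

lemma average_coset:
  "average n F f (coset g) = (\<Sum>t\<in>quotient_reps (ray_fixer n) F. f (coset (g \<circ> t))) / of_nat (card (quotient_reps (ray_fixer n) F))"
  by (simp add: average_def)

lemma average_diff: "average n F (f - f') c = average n F f c - average n F f' c"
  by (simp add: average_def right_translation_def sum_subtractf diff_divide_distrib)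

lemma average_add: "average n F (f + f') c = average n F f c + average n F f' c"
  by (simp add: average_def right_translation_def sum.distrib add_divide_distrib)

lemma average_scale: "average n F (\<lambda>x. a * f x) c = a * average n F f c"
  by (simp add: average_def right_translation_def sum_distrib_left)

context
  fixes n F
  assumes F: "finite F" "\<And>s. s \<in> ray_fixer n \<Longrightarrow> s ` F = F"
begin

lemma fixed_by_agree:
  assumes f: "fixed_by F f" and g: "g \<in> Aut" and st: "s \<in> ray_fixer n" "t \<in> ray_fixer n" "\<And>x. x \<in> F \<Longrightarrow> s x = t x"
  shows "f (coset (g \<circ> s)) = f (coset (g \<circ> t))"
proof -
  have tA: "t \<in> Aut" and sA: "s \<in> Aut" using st ray_fixerD by blast+
  have "inv_into UNIV t \<circ> s \<in> fixer F"
    using st(3) tA sA by (auto simp: fixer_iff intro!: aut_comp aut_inv)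
  moreover have "g \<circ> s = (g \<circ> t) \<circ> (inv_into UNIV t \<circ> s)" using tA by (simp add: fun_eq_iff)
  ultimately show ?thesis using f aut_comp[OF g tA] unfolding fixed_by_def by metis
qed

lemma sum_reps:
  assumes f: "fixed_by F f" and g: "g \<in> Aut" and s: "s \<in> ray_fixer n"
  shows "(\<Sum>t\<in>quotient_reps (ray_fixer n) F. f (coset (g \<circ> (t \<circ> s)))) = (\<Sum>t\<in>quotient_reps (ray_fixer n) F. f (coset (g \<circ> t)))"
    and "(\<Sum>t\<in>quotient_reps (ray_fixer n) F. f (coset (g \<circ> (s \<circ> t)))) = (\<Sum>t\<in>quotient_reps (ray_fixer n) F. f (coset (g \<circ> t)))"
  by (rule sum_quotient_reps[where h = "\<lambda>t. f (coset (g \<circ> t))"];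
      use F s ray_fixer_comp aut_inj[OF ray_fixerD(1)] fixed_by_agree[OF f g] in blast)+

lemma id_ray_fixer: "id \<in> ray_fixer n"
  by (simp add: ray_fixer_def)

lemma card_reps: "finite (quotient_reps (ray_fixer n) F)" "card (quotient_reps (ray_fixer n) F) \<noteq> 0"
proof -
  show "finite (quotient_reps (ray_fixer n) F)"
    by (rule sum_quotient_reps(1)[where h = "\<lambda>_. 0::nat" and s = id])
      (use F ray_fixer_comp aut_inj[OF ray_fixerD(1)] id_ray_fixer in blast)+
  moreover have "quotient_reps (ray_fixer n) F \<noteq> {}"
    using quotient_reps_transversal(2)[OF id_ray_fixer] by blast
  ultimately show "card (quotient_reps (ray_fixer n) F) \<noteq> 0" by simp
qed

lemma average_invariant:
  assumes f: "\<And>g s. g \<in> Aut \<Longrightarrow> s \<in> ray_fixer n \<Longrightarrow> f (coset (g \<circ> s)) = f (coset g)" and g: "g \<in> Aut"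
  shows "average n F f (coset g) = f (coset g)"
proof -
  have "(\<Sum>t\<in>quotient_reps (ray_fixer n) F. f (coset (g \<circ> t))) = (\<Sum>t\<in>quotient_reps (ray_fixer n) F. f (coset g))"
    using quotient_reps_transversal(1) f[OF g] by (intro sum.cong) blast+
  then show ?thesis using card_reps by (simp add: average_coset)
qed

lemma average_translate:
  assumes "fixed_by F f" "g \<in> Aut" "s \<in> ray_fixer n"
  shows "average n F f (coset (g \<circ> s)) = average n F f (coset g)"
  using sum_reps(2)[OF assms] by (simp add: average_coset comp_assoc)

lemma average_R:
  assumes "fixed_by F f" "g \<in> Aut" "s \<in> ray_fixer n"
  shows "average n F (R s f) (coset g) = average n F f (coset g)"
  using sum_reps(1)[OF assms] by (simp add: average_coset comp_assoc)

end

text \<open>Averaging kills \<open>f - R s f\<close> by invariance under translation. How large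
  \<open>F\<close> must be depends on all functions in the linear combination, so the claim is made
  for sufficiently large stable \<open>F\<close>.\<close>

lemma rel_average:
  assumes "w \<in> rel n"
  shows "\<exists>F0. finite F0 \<and> (\<forall>F. finite F \<longrightarrow> F0 \<subseteq> F \<longrightarrow> (\<forall>s\<in>ray_fixer n. s ` F = F) \<longrightarrow>
    (\<forall>g\<in>Aut. average n F w (coset g) = 0))"
  using assms unfolding rel_def
proof (induction rule: fun_space.span_induct_alt)
  case base
  show ?case by (intro exI[of _ "{}"]) (auto simp: average_def right_translation_def)
next
  case (step c x y)
  then obtain f s where x: "x = f - R s f" "f \<in> V" "s \<in> ray_fixer n" by blast
  obtain F0 where F0: "finite F0" "fixed_by F0 f" using smooth_fixed_by[OF x(2)] by blast
  from step(2) obtain F1 where F1: "finite F1" "\<forall>F. finite F \<longrightarrow> F1 \<subseteq> F \<longrightarrow>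
    (\<forall>s\<in>ray_fixer n. s ` F = F) \<longrightarrow> (\<forall>g\<in>Aut. average n F y (coset g) = 0)" by (elim exE conjE)
  show ?case
  proof (intro exI[of _ "F0 \<union> F1"] conjI allI impI ballI)
    fix F g assume F: "finite F" "F0 \<union> F1 \<subseteq> F" "\<forall>s\<in>ray_fixer n. s ` F = F" and g: "g \<in> Aut"
    have st: "\<And>s. s \<in> ray_fixer n \<Longrightarrow> s ` F = F" using F(3) by blast
    have "fixed_by F f" using F0(2) by (rule fixed_by_mono) (use F(2) in blast)
    from average_R[OF F(1) st this g x(3)]
    have "average n F x (coset g) = 0" unfolding x(1) average_diff by simp
    moreover have "average n F y (coset g) = 0" using F1(2)[rule_format, of F g] F g by blast
    ultimately show "average n F ((\<lambda>x'. c * x x') + y) (coset g) = 0"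
      unfolding average_add average_scale by simp
  qed (use F0 F1 in simp)
qed

section \<open>The transfer operator\<close>


definition edge_functions :: "('v \<times> 'v \<Rightarrow> complex) set" where
  "edge_functions = {\<Phi>. (\<forall>e. \<not> E (fst e) (snd e) \<longrightarrow> \<Phi> e = 0) \<and>
     (\<forall>\<gamma>\<in>\<Gamma>. \<forall>e. \<Phi> (map_prod \<gamma> \<gamma> e) = \<Phi> e)}"

text \<open>\<open>r\<close> is the position on the line of the edge being tested, called the level
  below. For \<Phi> in \<open>edge_functions\<close> the value does not depend on the chosen
  representative of the coset.\<close>

definition lift :: "int \<Rightarrow> ('v \<times> 'v \<Rightarrow> complex) \<Rightarrow> (('v \<Rightarrow> 'v) set \<Rightarrow> complex)" where
  "lift r \<Phi> c = (if c \<in> coset ` Aut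
     then let g = SOME g. g \<in> Aut \<and> c = coset g in \<Phi> (g (v r), g (v (r + 1))) else 0)"

lemma edge_functions_0: "\<Phi> \<in> edge_functions \<Longrightarrow> \<not> E x y \<Longrightarrow> \<Phi> (x, y) = 0"
  and edge_functions_inv: "\<Phi> \<in> edge_functions \<Longrightarrow> \<gamma> \<in> \<Gamma> \<Longrightarrow> \<Phi> (\<gamma> x, \<gamma> y) = \<Phi> (x, y)"
  by (auto simp: edge_functions_def)

lemma edge_functionsI:
  assumes "\<And>x y. \<not> E x y \<Longrightarrow> \<Phi> (x, y) = 0"
    and "\<And>\<gamma> x y. \<gamma> \<in> \<Gamma> \<Longrightarrow> E x y \<Longrightarrow> \<Phi> (\<gamma> x, \<gamma> y) = \<Phi> (x, y)"
  shows "\<Phi> \<in> edge_functions"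
proof -
  have "\<Phi> (\<gamma> x, \<gamma> y) = \<Phi> (x, y)" if "\<gamma> \<in> \<Gamma>" for \<gamma> x y
    using assms(1)[of x y] assms(1)[of "\<gamma> x" "\<gamma> y"] assms(2)[OF that, of x y] aut_adj[OF Gamma_aut[OF that], of x y]
    by (cases "E x y") auto
  then show ?thesis using assms(1) by (auto simp: edge_functions_def)
qed

lemma lift_off: "c \<notin> coset ` Aut \<Longrightarrow> lift r \<Phi> c = 0"
  by (simp add: lift_def)

lemma lift_coset:
  assumes "\<Phi> \<in> edge_functions" "g \<in> Aut"
  shows "lift r \<Phi> (coset g) = \<Phi> (g (v r), g (v (r + 1)))"
proof -
  define h where "h = (SOME h. h \<in> Aut \<and> coset g = coset h)"
  have "h \<in> Aut \<and> coset g = coset h" unfolding h_def by (rule someI[of _ g]) (simp add: assms)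
  then obtain \<gamma> where "\<gamma> \<in> \<Gamma>" "g = \<gamma> \<circ> h" using coset_eqD by metis
  then have "\<Phi> (g (v r), g (v (r + 1))) = \<Phi> (h (v r), h (v (r + 1)))"
    using assms(1) by (simp add: edge_functions_inv)
  moreover have "lift r \<Phi> (coset g) = \<Phi> (h (v r), h (v (r + 1)))"
    using assms(2) by (simp add: lift_def h_def Let_def)
  ultimately show ?thesis by simp
qed

lemma lift_smooth:
  assumes "\<Phi> \<in> edge_functions"
  shows "lift r \<Phi> \<in> V"
  unfolding smooth_functions_iff
proof (intro conjI exI[of _ "{v r, v (r + 1)}"] allI impI ballI)
  fix g k assume "g \<in> Aut" "k \<in> fixer {v r, v (r + 1)}"
  then show "lift r \<Phi> (coset (g \<circ> k)) = lift r \<Phi> (coset g)"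
    using assms by (simp add: lift_coset aut_comp fixer_iff)
qed (simp_all add: lift_off)

lemma edge_functions_add: "\<Phi> \<in> edge_functions \<Longrightarrow> \<Psi> \<in> edge_functions \<Longrightarrow> \<Phi> + \<Psi> \<in> edge_functions"
  and edge_functions_scale: "\<Phi> \<in> edge_functions \<Longrightarrow> (\<lambda>e. a * \<Phi> e) \<in> edge_functions"
  by (auto simp: edge_functions_def)

lemma lift_add:
  "\<Phi> \<in> edge_functions \<Longrightarrow> \<Psi> \<in> edge_functions \<Longrightarrow> lift r (\<Phi> + \<Psi>) = lift r \<Phi> + lift r \<Psi>"
  by (rule ext) (simp add: lift_def Let_def)

lemma lift_scale: "lift r (\<lambda>e. a * \<Phi> e) = (\<lambda>c. a * lift r \<Phi> c)"
  by (rule ext) (simp add: lift_def Let_def)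

definition transfer :: "('v \<times> 'v \<Rightarrow> complex) \<Rightarrow> ('v \<times> 'v \<Rightarrow> complex)" where
  "transfer \<Phi> e = (if E (fst e) (snd e) then \<Sum>z\<in>{z. E (fst e) z} - {snd e}. \<Phi> (z, fst e) else 0)"

text \<open>Let \<open>A\<close> be the sum of \<Phi> over the edges into \<open>x\<close>. Then
  \<open>transfer \<Phi> (x, z) = A - \<Phi> (z, x)\<close>, and summing over the
  \<open>q + 1\<close> neighbours \<open>z\<close> gives \<open>q * A\<close>; this recovers
  \<open>A\<close> and then \<Phi>.\<close>

definition transfer_inv :: "('v \<times> 'v \<Rightarrow> complex) \<Rightarrow> ('v \<times> 'v \<Rightarrow> complex)" where
  "transfer_inv \<Phi> e = (if E (fst e) (snd e)
     then (\<Sum>z | E (snd e) z. \<Phi> (snd e, z)) / of_nat q - \<Phi> (snd e, fst e) else 0)"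

lemma nbrs_aut: "g \<in> Aut \<Longrightarrow> {z. E (g x) z} = g ` {z. E x z}"
proof (intro equalityI subsetI)
  fix z assume g: "g \<in> Aut" and z: "z \<in> {z. E (g x) z}"
  then have "E x (inv_into UNIV g z)" using aut_adj[OF g, of x "inv_into UNIV g z"] by simp
  then show "z \<in> g ` {z. E x z}" using g by (metis aut_inv_apply(2) imageI mem_Collect_eq)
qed (auto simp: aut_adj)

lemma transfer_edge:
  assumes "E x y"
  shows "transfer \<Phi> (x, y) = (\<Sum>z | E x z. \<Phi> (z, x)) - \<Phi> (y, x)"
  using assms by (simp add: transfer_def sum_diff1 finite_nbrs)

lemma transfer_edge_functions:
  assumes "\<Phi> \<in> edge_functions"
  shows "transfer \<Phi> \<in> edge_functions"
proof (rule edge_functionsI)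
  fix \<gamma> x y assume g: "\<gamma> \<in> \<Gamma>" and xy: "E x y"
  have "E (\<gamma> x) (\<gamma> y)" using xy aut_adj[OF Gamma_aut[OF g]] by simp
  moreover have "(\<Sum>z | E (\<gamma> x) z. \<Phi> (z, \<gamma> x)) = (\<Sum>z | E x z. \<Phi> (z, x))"
    unfolding nbrs_aut[OF Gamma_aut[OF g]]
    using edge_functions_inv[OF assms g] aut_inj[OF Gamma_aut[OF g]]
    by (subst sum.reindex) (auto intro: inj_on_subset)
  ultimately show "transfer \<Phi> (\<gamma> x, \<gamma> y) = transfer \<Phi> (x, y)"
    using xy edge_functions_inv[OF assms g] by (simp add: transfer_edge)
qed (simp add: transfer_def)

lemma transfer_inv_edge_functions:
  assumes "\<Phi> \<in> edge_functions"
  shows "transfer_inv \<Phi> \<in> edge_functions"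
proof (rule edge_functionsI)
  fix \<gamma> x y assume g: "\<gamma> \<in> \<Gamma>" and xy: "E x y"
  have "E (\<gamma> x) (\<gamma> y)" using xy aut_adj[OF Gamma_aut[OF g]] by simp
  moreover have "(\<Sum>z | E (\<gamma> y) z. \<Phi> (\<gamma> y, z)) = (\<Sum>z | E y z. \<Phi> (y, z))"
    unfolding nbrs_aut[OF Gamma_aut[OF g]]
    using edge_functions_inv[OF assms g] aut_inj[OF Gamma_aut[OF g]]
    by (subst sum.reindex) (auto intro: inj_on_subset)
  ultimately show "transfer_inv \<Phi> (\<gamma> x, \<gamma> y) = transfer_inv \<Phi> (x, y)"
    using xy edge_functions_inv[OF assms g] by (simp add: transfer_inv_def)
qed (simp add: transfer_inv_def)

lemma transfer_transfer_inv:
  assumes "\<Phi> \<in> edge_functions"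
  shows "transfer (transfer_inv \<Phi>) = \<Phi>" "transfer_inv (transfer \<Phi>) = \<Phi>"
proof -
  have q: "of_nat q \<noteq> (0 :: complex)" using q_pos by simp
  have card: "of_nat (card {z. E x z}) = (of_nat q + 1 :: complex)" for x by (simp add: card_nbrs)
  have "transfer (transfer_inv \<Phi>) (x, y) = \<Phi> (x, y)" for x y
  proof (cases "E x y")
    case True
    define B where "B = (\<Sum>z | E x z. \<Phi> (x, z))"
    have "transfer_inv \<Phi> (z, x) = B / of_nat q - \<Phi> (x, z)" if "E x z" for z
      using E_sym[OF that] by (simp add: transfer_inv_def B_def)
    then have "transfer (transfer_inv \<Phi>) (x, y)
      = (\<Sum>z | E x z. B / of_nat q - \<Phi> (x, z)) - (B / of_nat q - \<Phi> (x, y))"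
      using True by (simp add: transfer_edge)
    also have "(\<Sum>z | E x z. B / of_nat q - \<Phi> (x, z)) = (of_nat q + 1) * (B / of_nat q) - B"
      by (simp add: sum_subtractf card B_def[symmetric])
    also have "\<dots> - (B / of_nat q - \<Phi> (x, y)) = \<Phi> (x, y)" using q by (simp add: field_simps)
    finally show ?thesis .
  qed (use edge_functions_0[OF assms] in \<open>simp add: transfer_def\<close>)
  then show "transfer (transfer_inv \<Phi>) = \<Phi>" by auto
  have "transfer_inv (transfer \<Phi>) (y, x) = \<Phi> (y, x)" for x y
  proof (cases "E x y")
    case True
    define A where "A = (\<Sum>z | E x z. \<Phi> (z, x))"
    have t: "transfer \<Phi> (x, z) = A - \<Phi> (z, x)" if "E x z" for z
      using that by (simp add: transfer_edge A_def)
    have "(\<Sum>z | E x z. transfer \<Phi> (x, z)) = (\<Sum>z | E x z. A - \<Phi> (z, x))" using t by simp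
    also have "\<dots> = (of_nat q + 1) * A - A" by (simp add: sum_subtractf card A_def[symmetric])
    also have "\<dots> = of_nat q * A" by (simp add: algebra_simps)
    finally show ?thesis using True E_sym[OF True] q t by (simp add: transfer_inv_def)
  qed (use edge_functions_0[OF assms] E_sym in \<open>auto simp: transfer_inv_def\<close>)
  then show "transfer_inv (transfer \<Phi>) = \<Phi>" by auto
qed

lemma transfer_pow_edge_functions: "\<Phi> \<in> edge_functions \<Longrightarrow> (transfer ^^ k) \<Phi> \<in> edge_functions"
  by (induction k) (simp_all add: transfer_edge_functions)

lemma transfer_pow_inj:
  assumes "\<Phi> \<in> edge_functions" "(transfer ^^ k) \<Phi> = 0"
  shows "\<Phi> = 0"
  using assms(2)
proof (induction k)
  case (Suc k)
  have 0: "transfer_inv 0 = 0" by (rule ext) (simp add: transfer_inv_def)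
  have "transfer ((transfer ^^ k) \<Phi>) = 0" using Suc.prems by (simp only: funpow.simps comp_apply)
  then have "(transfer ^^ k) \<Phi> = 0"
    using transfer_transfer_inv(2)[OF transfer_pow_edge_functions[OF assms(1), of k]] 0 by metis
  then show ?case by (rule Suc.IH)
qed simp

lemma transfer_pow_surj:
  assumes "\<Phi> \<in> edge_functions"
  shows "\<exists>\<Psi>\<in>edge_functions. (transfer ^^ k) \<Psi> = \<Phi>"
  using assms
proof (induction k arbitrary: \<Phi>)
  case (Suc k)
  obtain \<Psi> where "\<Psi> \<in> edge_functions" "(transfer ^^ k) \<Psi> = transfer_inv \<Phi>"
    using Suc.IH[OF transfer_inv_edge_functions[OF Suc.prems]] by blast
  then show ?case using transfer_transfer_inv(1)[OF Suc.prems] by (intro bexI[of _ \<Psi>]) simp_all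
qed auto

section \<open>Passing from one level to the next\<close>

lemma rel_subspace:
  "0 \<in> rel n" "x \<in> rel n \<Longrightarrow> y \<in> rel n \<Longrightarrow> x + y \<in> rel n" "x \<in> rel n \<Longrightarrow> (\<lambda>c. a * x c) \<in> rel n"
  "x \<in> rel n \<Longrightarrow> y \<in> rel n \<Longrightarrow> x - y \<in> rel n"
  unfolding rel_def
  by (intro fun_space.span_zero fun_space.span_add fun_space.span_scale fun_space.span_diff; assumption)+

lemma rel_sum: "(\<And>i. i \<in> I \<Longrightarrow> x i \<in> rel n) \<Longrightarrow> (\<Sum>i\<in>I. x i) \<in> rel n"
  unfolding rel_def by (rule fun_space.span_sum)

lemma sum_fun_apply: "(\<Sum>i\<in>I. x i) c = (\<Sum>i\<in>I. x i c)" for x :: "'i \<Rightarrow> 'c \<Rightarrow> complex"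
  by (induction I rule: infinite_finite_induct) auto

text \<open>The elements of \<open>ray_fixer (r + 1)\<close> permute the \<open>q\<close> neighbours of \<open>v (r + 1)\<close> other than
  \<open>v (r + 2)\<close>; summing over these translates gives the transfer operator.\<close>

lemma lift_transfer:
  assumes "\<Phi> \<in> edge_functions"
  shows "(\<lambda>c. of_nat q * lift r \<Phi> c) - lift (r + 1) (transfer \<Phi>) \<in> rel (r + 1)"
proof -
  define Y where "Y = {y. E (v (r + 1)) y} - {v (r + 2)}"
  have Evv: "E (v (r + 1)) (v (r + 2))" using line_adj_iff[OF line] by simp
  have Y: "finite Y" "card Y = q" using Evv finite_nbrs card_nbrs by (simp_all add: Y_def)
  have "\<exists>s\<in>ray_fixer (r + 1). s (v r) = y" if "y \<in> Y" for y
  proof -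
    have "E y (v (r + 1))" "y \<noteq> v (r + 2)" using that E_sym by (auto simp: Y_def)
    then show ?thesis using ray_fixer_moves by metis
  qed
  then obtain s where s: "\<And>y. y \<in> Y \<Longrightarrow> s y \<in> ray_fixer (r + 1)" "\<And>y. y \<in> Y \<Longrightarrow> s y (v r) = y" by metis
  have sA: "s y \<in> Aut" if "y \<in> Y" for y using s(1)[OF that] by (rule ray_fixerD)
  have eq: "lift (r + 1) (transfer \<Phi>) = (\<Sum>y\<in>Y. R (s y) (lift r \<Phi>))"
  proof
    fix c
    show "lift (r + 1) (transfer \<Phi>) c = (\<Sum>y\<in>Y. R (s y) (lift r \<Phi>)) c"
    proof (cases "c \<in> coset ` Aut")
      case True
      then obtain g where g: "g \<in> Aut" "c = coset g" by blast
      have "lift (r + 1) (transfer \<Phi>) c = transfer \<Phi> (g (v (r + 1)), g (v (r + 2)))"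
        using lift_coset[OF transfer_edge_functions[OF assms] g(1)] g(2) by (simp add: add.assoc)
      also have "\<dots> = (\<Sum>z\<in>{z. E (g (v (r + 1))) z} - {g (v (r + 2))}. \<Phi> (z, g (v (r + 1))))"
        using Evv aut_adj[OF g(1)] by (simp add: transfer_def)
      also have "{z. E (g (v (r + 1))) z} - {g (v (r + 2))} = g ` Y"
        unfolding nbrs_aut[OF g(1)] Y_def using inj_eq[OF aut_inj[OF g(1)]] by auto
      also have "(\<Sum>z\<in>g ` Y. \<Phi> (z, g (v (r + 1)))) = (\<Sum>y\<in>Y. \<Phi> (g y, g (v (r + 1))))"
        using aut_inj[OF g(1)] by (subst sum.reindex) (auto intro: inj_on_subset)
      also have "\<dots> = (\<Sum>y\<in>Y. R (s y) (lift r \<Phi>) c)"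
      proof (rule sum.cong)
        fix y assume y: "y \<in> Y"
        show "\<Phi> (g y, g (v (r + 1))) = R (s y) (lift r \<Phi>) c"
          using lift_coset[OF assms aut_comp[OF g(1) sA[OF y]], of r] s[OF y] ray_fixerD(2)[OF s(1)[OF y], of "r + 1"]
          by (simp add: g(2))
      qed simp
      finally show ?thesis by (simp add: sum_fun_apply)
    next
      case False
      then have "R (s y) (lift r \<Phi>) c = 0" if "y \<in> Y" for y
        using R_off[OF sA[OF that] False] lift_off by blast
      then show ?thesis using False by (simp add: sum_fun_apply lift_off)
    qed
  qed
  have "(\<lambda>c. of_nat q * lift r \<Phi> c) - lift (r + 1) (transfer \<Phi>) = (\<Sum>y\<in>Y. lift r \<Phi> - R (s y) (lift r \<Phi>))"
    unfolding eq by (rule ext) (simp add: sum_fun_apply sum_subtractf Y)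
  also have "\<dots> \<in> rel (r + 1)"
    by (intro rel_sum rel_base lift_smooth assms s)
  finally show ?thesis .
qed

text \<open>The factor \<open>q ^ k\<close> is put on the left in place of dividing the transfer
  operator by \<open>q\<close>; relations of earlier levels are absorbed by
  \<open>rel_mono\<close>.\<close>

lemma lift_transfer_pow:
  assumes "\<Phi> \<in> edge_functions"
  shows "(\<lambda>c. of_nat q ^ k * lift r \<Phi> c) - lift (r + int k) ((transfer ^^ k) \<Phi>) \<in> rel (r + int k)"
proof (induction k)
  case 0
  show ?case using rel_subspace(1) by (simp add: zero_fun_def fun_diff_def)
next
  case (Suc k)
  let ?a = "lift r \<Phi>" and ?b = "lift (r + int k) ((transfer ^^ k) \<Phi>)" and ?c = "lift (r + int k + 1) ((transfer ^^ Suc k) \<Phi>)"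
  have "(\<lambda>c. of_nat q * ((\<lambda>c. of_nat q ^ k * ?a c) - ?b) c) \<in> rel (r + int k + 1)"
    by (rule rel_subspace(3)) (rule subsetD[OF rel_mono Suc], simp)
  moreover have "(\<lambda>c. of_nat q * ?b c) - ?c \<in> rel (r + int k + 1)"
    using lift_transfer[OF transfer_pow_edge_functions[OF assms], of "r + int k" k] by simp
  ultimately have "(\<lambda>c. of_nat q * ((\<lambda>c. of_nat q ^ k * ?a c) - ?b) c) + ((\<lambda>c. of_nat q * ?b c) - ?c) \<in> rel (r + int k + 1)"
    by (rule rel_subspace)
  \<comment> \<open>Telescoping: the lift at level \<open>r + k\<close> cancels.\<close>
  moreover have "(\<lambda>c. x * ((\<lambda>c. y * a c) - b) c) + ((\<lambda>c. x * b c) - d) = (\<lambda>c. x * y * a c) - d"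
    for x y :: complex and a b d :: "('v \<Rightarrow> 'v) set \<Rightarrow> complex"
    by (rule ext) (simp add: algebra_simps)
  ultimately have "(\<lambda>c. of_nat q * of_nat q ^ k * ?a c) - ?c \<in> rel (r + int k + 1)" by metis
  moreover have "r + int (Suc k) = r + int k + 1" by simp
  ultimately show ?case by (metis power_Suc)
qed

text \<open>Write \<open>b = s h\<close> with \<open>s\<close> fixing the ray and \<open>h\<close>
  trivial on the half-tree. The average absorbs \<open>s\<close>. It ignores \<open>h\<close>
  because a conjugate of \<open>h\<close> by an element fixing the ray is again trivial on the
  half-tree, hence on \<open>F0\<close>.\<close>

lemma average_half_tree:
  assumes F: "finite F" "\<And>s. s \<in> ray_fixer n \<Longrightarrow> s ` F = F" and f: "fixed_by F0 f" "F0 \<subseteq> F" "F0 \<subseteq> half_tree n"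
    and g: "g \<in> Aut" and b: "b \<in> Aut" "b (v n) = v n" "b (v (n + 1)) = v (n + 1)"
  shows "average n F f (coset (g \<circ> b)) = average n F f (coset g)"
proof -
  obtain s where s: "s \<in> ray_fixer n" "\<And>x. x \<in> half_tree n \<Longrightarrow> s x = b x"
    using half_tree_cut[OF b] by blast
  have sA: "s \<in> Aut" using ray_fixerD[OF s(1)] by blast
  define h where "h = inv_into UNIV s \<circ> b"
  have h: "h \<in> Aut" "\<And>x. x \<in> half_tree n \<Longrightarrow> h x = x"
    using sA b(1) s(2) by (auto simp: h_def intro!: aut_comp aut_inv) (metis aut_inv_apply(1))
  have "average n F f (coset (g' \<circ> h)) = average n F f (coset g')" if g': "g' \<in> Aut" for g'
  proof -
    have "f (coset (g' \<circ> h \<circ> t)) = f (coset (g' \<circ> t))" if t: "t \<in> ray_fixer n" for t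
    proof -
      have tA: "t \<in> Aut" using ray_fixerD[OF t] by blast
      have tv: "t (v n) = v n" "t (v (n + 1)) = v (n + 1)" using ray_fixerD(2)[OF t] by simp_all
      have "inv_into UNIV t \<circ> h \<circ> t \<in> fixer F0"
        using tA h f(3) half_tree_aut_iff[OF tA tv] by (auto simp: fixer_iff intro!: aut_comp aut_inv)
      moreover have "g' \<circ> h \<circ> t = (g' \<circ> t) \<circ> (inv_into UNIV t \<circ> h \<circ> t)" using tA by (simp add: fun_eq_iff)
      ultimately show ?thesis using f(1) aut_comp[OF g' tA] unfolding fixed_by_def by metis
    qed
    then have "(\<Sum>t\<in>quotient_reps (ray_fixer n) F. f (coset (g' \<circ> h \<circ> t))) = (\<Sum>t\<in>quotient_reps (ray_fixer n) F. f (coset (g' \<circ> t)))"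
      using quotient_reps_transversal(1) by (intro sum.cong) blast+
    then show ?thesis by (simp add: average_coset)
  qed
  from this[OF aut_comp[OF g sA]] have "average n F f (coset (g \<circ> s \<circ> h)) = average n F f (coset (g \<circ> s))" .
  moreover have "g \<circ> s \<circ> h = g \<circ> b" using sA by (simp add: h_def fun_eq_iff)
  moreover have "average n F f (coset (g \<circ> s)) = average n F f (coset g)"
    by (rule average_translate[OF F fixed_by_mono[OF f(1,2)] g s(1)])
  ultimately show ?thesis by metis
qed

text \<open>The difference is the mean of the relations \<open>f - R t f\<close>.\<close>

lemma average_mod_rel:
  assumes F: "finite F" "\<And>s. s \<in> ray_fixer n \<Longrightarrow> s ` F = F" and f: "f \<in> V"
  shows "f - average n F f \<in> rel n"
proof -
  let ?T = "quotient_reps (ray_fixer n) F"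
  have "(\<lambda>c. inverse (of_nat (card ?T)) * (\<Sum>t\<in>?T. f - R t f) c) \<in> rel n"
    using quotient_reps_transversal(1) f by (intro rel_subspace(3) rel_sum rel_base) blast+
  moreover have "f - average n F f = (\<lambda>c. inverse (of_nat (card ?T)) * (\<Sum>t\<in>?T. f - R t f) c)"
    using card_reps(2)[OF F] by (intro ext) (simp add: average_def sum_fun_apply sum_subtractf field_simps)
  ultimately show ?thesis by simp
qed

text \<open>For \<open>n\<close> so large that the finite set governing \<open>f\<close> lies in
  \<open>half_tree n\<close>, the average over \<open>ray_fixer n\<close> depends only on the image
  of the edge at \<open>n\<close>, and every directed edge is such an image.\<close>

lemma smooth_mod_rel:
  assumes f: "f \<in> V"
  obtains n \<Phi> where "\<Phi> \<in> edge_functions" "f - lift (int n) \<Phi> \<in> rel (int n)"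
proof -
  obtain F0 where F0: "finite F0" "fixed_by F0 f" using smooth_fixed_by[OF f] by blast
  obtain n0 where n0: "\<And>n. n \<ge> n0 \<Longrightarrow> F0 \<subseteq> half_tree n" using half_tree_absorbs[OF F0(1)] by blast
  \<comment> \<open>A nonnegative level, so that it is reached from level 0 by an iterate of the
    transfer operator.\<close>
  define n where "n = int (nat n0)"
  have half: "F0 \<subseteq> half_tree n" by (rule n0) (simp add: n_def)
  obtain F where F: "finite F" "F0 \<subseteq> F" "\<And>s. s \<in> Aut \<Longrightarrow> s (v n) = v n \<Longrightarrow> s ` F = F"
    using stable_finite_superset[OF F0(1)] by blast
  have st: "s ` F = F" if "s \<in> ray_fixer n" for s
    by (rule F(3)) (use ray_fixerD[OF that] in auto)
  let ?f = "average n F f"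
  have b: "?f (coset (g \<circ> b)) = ?f (coset g)" if "g \<in> Aut" "b \<in> Aut" "b (v n) = v n" "b (v (n + 1)) = v (n + 1)" for g b
    by (rule average_half_tree[OF F(1) st F0(2) F(2) half that])
  define G where "G e = (SOME g. g \<in> Aut \<and> g (v n) = fst e \<and> g (v (n + 1)) = snd e)" for e
  have G: "G e \<in> Aut" "G e (v n) = fst e" "G e (v (n + 1)) = snd e" if "E (fst e) (snd e)" for e
  proof -
    have "\<exists>g. g \<in> Aut \<and> g (v n) = fst e \<and> g (v (n + 1)) = snd e" using edges_transitive[OF that] by metis
    then have "G e \<in> Aut \<and> G e (v n) = fst e \<and> G e (v (n + 1)) = snd e" unfolding G_def by (rule someI_ex)
    then show "G e \<in> Aut" "G e (v n) = fst e" "G e (v (n + 1)) = snd e" by blast+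
  qed
  define \<Phi> where "\<Phi> e = (if E (fst e) (snd e) then ?f (coset (G e)) else 0)" for e
  have \<Phi>: "\<Phi> (g (v n), g (v (n + 1))) = ?f (coset g)" if g: "g \<in> Aut" for g
  proof -
    let ?e = "(g (v n), g (v (n + 1)))"
    have e: "E (fst ?e) (snd ?e)" using aut_adj[OF g] line_adj_iff[OF line] by simp
    let ?b = "inv_into UNIV g \<circ> G ?e"
    have "?f (coset (g \<circ> ?b)) = ?f (coset g)"
      by (rule b[OF g]) (use G[OF e] g in \<open>auto intro!: aut_comp aut_inv\<close>)
    moreover have "g \<circ> ?b = G ?e" using g by (simp add: fun_eq_iff)
    ultimately show ?thesis using e by (simp add: \<Phi>_def)
  qed
  have EF: "\<Phi> \<in> edge_functions"
  proof (rule edge_functionsI)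
    fix \<gamma> x y assume g: "\<gamma> \<in> \<Gamma>" and xy: "E x y"
    have h: "G (x, y) \<in> Aut" "G (x, y) (v n) = x" "G (x, y) (v (n + 1)) = y" using G[of "(x, y)"] xy by simp_all
    show "\<Phi> (\<gamma> x, \<gamma> y) = \<Phi> (x, y)"
      using \<Phi>[OF aut_comp[OF Gamma_aut[OF g] h(1)]] \<Phi>[OF h(1)] h(2,3) coset_translate[OF g] by simp
  qed (simp add: \<Phi>_def)
  have "lift n \<Phi> = ?f"
  proof
    fix c
    show "lift n \<Phi> c = ?f c"
    proof (cases "c \<in> coset ` Aut")
      case True
      then show ?thesis using lift_coset[OF EF] \<Phi> by auto
    next
      case False
      have "R t f c = 0" if t: "t \<in> quotient_reps (ray_fixer n) F" for t
      proof (rule R_off[OF _ False smooth_zero_off[OF f]])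
        show "t \<in> Aut" using ray_fixerD(1)[OF subsetD[OF quotient_reps_transversal(1) t]] .
      qed
      then show ?thesis using False by (simp add: lift_off average_def)
    qed
  qed
  then have "f - lift n \<Phi> \<in> rel n" using average_mod_rel[OF F(1) st f] by simp
  then show thesis using that[OF EF] unfolding n_def by blast
qed

section \<open>Edge functions as coinvariants\<close>

abbreviation W :: "(('v \<Rightarrow> 'v) set \<Rightarrow> complex) set" where
  "W \<equiv> coinvariant_relations E v \<Gamma>"

lemma rel_W: "rel n \<subseteq> W"
  unfolding coinvariant_relations_eq by blast

lemma W_subspace:
  "0 \<in> W" "x \<in> W \<Longrightarrow> y \<in> W \<Longrightarrow> x + y \<in> W" "x \<in> W \<Longrightarrow> (\<lambda>c. a * x c) \<in> W"
  "x \<in> W \<Longrightarrow> y \<in> W \<Longrightarrow> x - y \<in> W"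
  unfolding coinvariant_relations_def
  by (intro fun_space.span_zero fun_space.span_add fun_space.span_scale fun_space.span_diff; assumption)+

text \<open>Surjectivity of the transfer powers pulls an edge function at level \<open>n\<close>
  back to level 0, at the price of the factor \<open>q ^ n\<close>.\<close>

lemma smooth_mod_W:
  assumes "f \<in> V"
  shows "\<exists>\<Phi>\<in>edge_functions. f - lift 0 \<Phi> \<in> W"
proof -
  obtain n \<Phi> where \<Phi>: "\<Phi> \<in> edge_functions" "f - lift (int n) \<Phi> \<in> rel (int n)" using smooth_mod_rel[OF assms] .
  obtain \<Psi> where \<Psi>: "\<Psi> \<in> edge_functions" "(transfer ^^ n) \<Psi> = \<Phi>" using transfer_pow_surj[OF \<Phi>(1)] by blast
  have "(\<lambda>c. of_nat q ^ n * lift 0 \<Psi> c) - lift (int n) \<Phi> \<in> rel (int n)"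
    using lift_transfer_pow[OF \<Psi>(1), of n 0] \<Psi>(2) by simp
  then have "(f - lift (int n) \<Phi>) - ((\<lambda>c. of_nat q ^ n * lift 0 \<Psi> c) - lift (int n) \<Phi>) \<in> rel (int n)"
    by (rule rel_subspace(4)[OF \<Phi>(2)])
  then have "f - lift 0 (\<lambda>e. of_nat q ^ n * \<Psi> e) \<in> W" using rel_W by (auto simp: lift_scale)
  then show ?thesis using edge_functions_scale[OF \<Psi>(1)] by blast
qed

text \<open>A relation of level \<open>n\<close> remains one when the lift is pushed to that level.
  There the lift is invariant under \<open>ray_fixer n\<close>, so it equals its own average, which
  vanishes; injectivity of the transfer powers finishes.\<close>

lemma lift_in_W:
  assumes \<Phi>: "\<Phi> \<in> edge_functions" and w: "lift 0 \<Phi> \<in> W"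
  shows "\<Phi> = 0"
proof -
  obtain m where m: "lift 0 \<Phi> \<in> rel m" using w unfolding coinvariant_relations_eq by blast
  define n where "n = nat m"
  let ?\<Psi> = "(transfer ^^ n) \<Phi>"
  have \<Psi>: "?\<Psi> \<in> edge_functions" using transfer_pow_edge_functions[OF \<Phi>] .
  have "lift 0 \<Phi> \<in> rel (int n)" by (rule subsetD[OF rel_mono m]) (simp add: n_def)
  then have "(\<lambda>c. of_nat q ^ n * lift 0 \<Phi> c) \<in> rel (int n)" by (rule rel_subspace)
  from rel_subspace(4)[OF this lift_transfer_pow[OF \<Phi>, of n 0, simplified]]
  have "lift (int n) ?\<Psi> \<in> rel (int n)" by simp
  from rel_average[OF this] obtain F0 where F0: "finite F0" "\<forall>F. finite F \<longrightarrow> F0 \<subseteq> F \<longrightarrow>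
    (\<forall>s\<in>ray_fixer (int n). s ` F = F) \<longrightarrow> (\<forall>g\<in>Aut. average (int n) F (lift (int n) ?\<Psi>) (coset g) = 0)"
    by (elim exE conjE)
  obtain F where F: "finite F" "F0 \<subseteq> F" "\<And>s. s \<in> Aut \<Longrightarrow> s (v (int n)) = v (int n) \<Longrightarrow> s ` F = F"
    using stable_finite_superset[OF F0(1)] by blast
  have st: "s ` F = F" if "s \<in> ray_fixer (int n)" for s
    by (rule F(3)) (use ray_fixerD[OF that] in auto)
  have "?\<Psi> (x, y) = 0" for x y
  proof (cases "E x y")
    case True
    then obtain g where g: "g \<in> Aut" "g (v (int n)) = x" "g (v (int n + 1)) = y" using edges_transitive by metis
    have "average (int n) F (lift (int n) ?\<Psi>) (coset g) = lift (int n) ?\<Psi> (coset g)"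
    proof (rule average_invariant[OF F(1) st _ g(1)])
      show "lift (int n) ?\<Psi> (coset (g \<circ> s)) = lift (int n) ?\<Psi> (coset g)" if "g \<in> Aut" "s \<in> ray_fixer (int n)" for g s
        using lift_coset[OF \<Psi> that(1)] lift_coset[OF \<Psi> aut_comp[OF that(1) ray_fixerD(1)[OF that(2)]]]
          ray_fixerD(2)[OF that(2)] by simp
    qed
    moreover have "average (int n) F (lift (int n) ?\<Psi>) (coset g) = 0"
      using F0(2) F(1,2) st g(1) by blast
    ultimately show ?thesis using lift_coset[OF \<Psi> g(1)] g(2,3) by simp
  qed (rule edge_functions_0[OF \<Psi>])
  then have "?\<Psi> = 0" by auto
  then show ?thesis by (rule transfer_pow_inj[OF \<Phi>])
qed

end

section \<open>The trace on the coinvariants\<close>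

lemma finsum_coord:
  fixes Q :: "(complex, 'b) module" and \<psi> :: "'b \<Rightarrow> complex"
  assumes Q: "abelian_monoid Q"
    and smult: "\<And>c x. x \<in> carrier Q \<Longrightarrow> c \<odot>\<^bsub>Q\<^esub> x \<in> carrier Q"
    and add: "\<And>x y. x \<in> carrier Q \<Longrightarrow> y \<in> carrier Q \<Longrightarrow> \<psi> (x \<oplus>\<^bsub>Q\<^esub> y) = \<psi> x + \<psi> y"
    and scale: "\<And>c x. x \<in> carrier Q \<Longrightarrow> \<psi> (c \<odot>\<^bsub>Q\<^esub> x) = c * \<psi> x"
    and B: "finite B" "B \<subseteq> carrier Q"
  shows "\<psi> (\<Oplus>\<^bsub>Q\<^esub>b\<in>B. u b \<odot>\<^bsub>Q\<^esub> b) = (\<Sum>b\<in>B. u b * \<psi> b)"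
proof -
  interpret abelian_monoid Q by (rule Q)
  have "\<psi> \<zero>\<^bsub>Q\<^esub> = 0" using add[of "\<zero>\<^bsub>Q\<^esub>" "\<zero>\<^bsub>Q\<^esub>"] by simp
  show ?thesis
    using B
  proof (induction B rule: finite_induct)
    case (insert b B)
    have "(\<lambda>b. u b \<odot>\<^bsub>Q\<^esub> b) \<in> B \<rightarrow> carrier Q" using insert.prems smult by auto
    moreover from this have "(\<Oplus>\<^bsub>Q\<^esub>b\<in>B. u b \<odot>\<^bsub>Q\<^esub> b) \<in> carrier Q" by (rule finsum_closed)
    ultimately show ?case using insert smult by (simp add: add scale)
  qed (simp add: \<open>\<psi> \<zero>\<^bsub>Q\<^esub> = 0\<close>)
qed

text \<open>The coordinates of \<open>x\<close> in any basis are expressed through the coordinates \<open>\<psi> x\<close>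
  and the basis coefficients of the elements \<open>\<beta> d\<close> dual to them, so that the trace does not
  depend on the basis chosen in \<open>endo_trace\<close>.\<close>

lemma endo_trace_coords:
  fixes Q :: "(complex, 'b) module" and \<psi> :: "'b \<Rightarrow> 'd \<Rightarrow> complex"
  assumes Q: "abelian_monoid Q"
    and smult: "\<And>c x. x \<in> carrier Q \<Longrightarrow> c \<odot>\<^bsub>Q\<^esub> x \<in> carrier Q"
    and D: "finite D"
    and add: "\<And>x y d. x \<in> carrier Q \<Longrightarrow> y \<in> carrier Q \<Longrightarrow> \<psi> (x \<oplus>\<^bsub>Q\<^esub> y) d = \<psi> x d + \<psi> y d"
    and scale: "\<And>c x d. x \<in> carrier Q \<Longrightarrow> \<psi> (c \<odot>\<^bsub>Q\<^esub> x) d = c * \<psi> x d"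
    and inj: "\<And>x y. x \<in> carrier Q \<Longrightarrow> y \<in> carrier Q \<Longrightarrow> (\<And>d. d \<in> D \<Longrightarrow> \<psi> x d = \<psi> y d) \<Longrightarrow> x = y"
    and surj: "\<And>u. \<exists>x\<in>carrier Q. \<forall>d\<in>D. \<psi> x d = u d"
    and T: "\<And>x. x \<in> carrier Q \<Longrightarrow> T x \<in> carrier Q"
    and matrix: "\<And>x d. x \<in> carrier Q \<Longrightarrow> d \<in> D \<Longrightarrow> \<psi> (T x) d = (\<Sum>d'\<in>D. t d d' * \<psi> x d')"
  shows "endo_trace Q T = (\<Sum>d\<in>D. t d d)"
proof -
  interpret abelian_monoid Q by (rule Q)
  have comb: "\<psi> (\<Oplus>\<^bsub>Q\<^esub>b\<in>B. u b \<odot>\<^bsub>Q\<^esub> b) d = (\<Sum>b\<in>B. u b * \<psi> b d)" if "finite B" "B \<subseteq> carrier Q" for B u d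
    using finsum_coord[OF Q smult, of "\<lambda>x. \<psi> x d"] add scale that by blast
  have closed: "(\<Oplus>\<^bsub>Q\<^esub>b\<in>B. u b \<odot>\<^bsub>Q\<^esub> b) \<in> carrier Q" if "B \<subseteq> carrier Q" for B u
    by (rule finsum_closed) (use that smult in auto)
  have "\<exists>x\<in>carrier Q. \<forall>d'\<in>D. \<psi> x d' = (if d' = d then 1 else 0)" for d by (rule surj)
  then obtain \<beta> where \<beta>: "\<And>d. \<beta> d \<in> carrier Q" "\<And>d d'. d' \<in> D \<Longrightarrow> \<psi> (\<beta> d) d' = (if d' = d then 1 else 0)"
    by metis
  have inj\<beta>: "inj_on \<beta> D"
  proof (rule inj_onI)
    fix d d' assume "d \<in> D" "d' \<in> D" "\<beta> d = \<beta> d'"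
    then show "d = d'" using \<beta>(2)[of d d] \<beta>(2)[of d d'] by (auto split: if_splits)
  qed
  have "is_finite_basis Q (\<beta> ` D)"
    unfolding is_finite_basis_def
  proof (intro conjI ballI)
    show sub: "\<beta> ` D \<subseteq> carrier Q" using \<beta>(1) by blast
    show "finite (\<beta> ` D)" using D by simp
    fix x assume x: "x \<in> carrier Q"
    have val: "\<psi> (\<Oplus>\<^bsub>Q\<^esub>b\<in>\<beta> ` D. u b \<odot>\<^bsub>Q\<^esub> b) d = u (\<beta> d)" if "d \<in> D" for u d
    proof -
      have "\<psi> (\<Oplus>\<^bsub>Q\<^esub>b\<in>\<beta> ` D. u b \<odot>\<^bsub>Q\<^esub> b) d = (\<Sum>d'\<in>D. u (\<beta> d') * \<psi> (\<beta> d') d)"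
        using comb[of "\<beta> ` D" u d] D sub by (simp add: sum.reindex[OF inj\<beta>])
      also have "\<dots> = (\<Sum>d'\<in>D. if d' = d then u (\<beta> d') else 0)"
        using \<beta>(2)[OF that] by (intro sum.cong) auto
      finally show ?thesis using D that by simp
    qed
    define u where "u = restrict (\<lambda>b. \<psi> x (inv_into D \<beta> b)) (\<beta> ` D)"
    show "\<exists>!u. u \<in> extensional (\<beta> ` D) \<and> x = (\<Oplus>\<^bsub>Q\<^esub>b\<in>\<beta> ` D. u b \<odot>\<^bsub>Q\<^esub> b)"
    proof (rule ex1I[of _ u], intro conjI)
      show "u \<in> extensional (\<beta> ` D)" by (simp add: u_def)
      show "x = (\<Oplus>\<^bsub>Q\<^esub>b\<in>\<beta> ` D. u b \<odot>\<^bsub>Q\<^esub> b)"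
        by (rule inj[OF x closed[OF sub]]) (simp add: val u_def inv_into_f_f[OF inj\<beta>])
    next
      fix u' assume u': "u' \<in> extensional (\<beta> ` D) \<and> x = (\<Oplus>\<^bsub>Q\<^esub>b\<in>\<beta> ` D. u' b \<odot>\<^bsub>Q\<^esub> b)"
      show "u' = u"
      proof (rule extensionalityI[of _ "\<beta> ` D"])
        fix b assume "b \<in> \<beta> ` D"
        then obtain d where d: "d \<in> D" "b = \<beta> d" by blast
        then have "u' b = \<psi> x d" using val[OF d(1), of u'] u' by simp
        then show "u' b = u b" using d by (simp add: u_def inv_into_f_f[OF inj\<beta>])
      qed (use u' in \<open>simp_all add: u_def\<close>)
    qed
  qed
  define B where "B = (SOME B. is_finite_basis Q B)"
  have "is_finite_basis Q B" unfolding B_def by (rule someI) fact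
  then have B: "finite B" "B \<subseteq> carrier Q"
    and ex1: "\<And>x. x \<in> carrier Q \<Longrightarrow> \<exists>!u. u \<in> extensional B \<and> x = (\<Oplus>\<^bsub>Q\<^esub>b\<in>B. u b \<odot>\<^bsub>Q\<^esub> b)"
    by (auto simp: is_finite_basis_def)
  define c where "c x = basis_coeffs Q B x" for x
  have c: "c x \<in> extensional B" "x = (\<Oplus>\<^bsub>Q\<^esub>b\<in>B. c x b \<odot>\<^bsub>Q\<^esub> b)" if "x \<in> carrier Q" for x
    using theI'[OF ex1[OF that]] by (simp_all add: c_def basis_coeffs_def)
  have c\<psi>: "(\<Sum>b\<in>B. c x b * \<psi> b d) = \<psi> x d" if "x \<in> carrier Q" for x d
    using comb[OF B, of "c x" d] c(2)[OF that] by simp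
  \<comment> \<open>The coefficients of the dual elements, combined with the coordinates of
    \<open>x\<close>, again represent \<open>x\<close>, because all coordinates agree; uniqueness of
    coefficients then gives linearity.\<close>
  have lin: "c x b = (\<Sum>d\<in>D. \<psi> x d * c (\<beta> d) b)" if x: "x \<in> carrier Q" and b: "b \<in> B" for x b
  proof -
    define u where "u = restrict (\<lambda>b. \<Sum>d\<in>D. \<psi> x d * c (\<beta> d) b) B"
    have "x = (\<Oplus>\<^bsub>Q\<^esub>b\<in>B. u b \<odot>\<^bsub>Q\<^esub> b)"
    proof (rule inj[OF x closed[OF B(2)]])
      fix d' assume d': "d' \<in> D"
      have "\<psi> (\<Oplus>\<^bsub>Q\<^esub>b\<in>B. u b \<odot>\<^bsub>Q\<^esub> b) d' = (\<Sum>b\<in>B. \<Sum>d\<in>D. \<psi> x d * (c (\<beta> d) b * \<psi> b d'))"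
        by (simp add: comb[OF B] u_def sum_distrib_right mult.assoc)
      also have "\<dots> = (\<Sum>d\<in>D. \<psi> x d * \<psi> (\<beta> d) d')"
        by (subst sum.swap) (simp add: c\<psi>[OF \<beta>(1)] flip: sum_distrib_left)
      also have "\<dots> = (\<Sum>d\<in>D. if d = d' then \<psi> x d else 0)"
        using \<beta>(2)[OF d'] by (intro sum.cong) auto
      finally show "\<psi> x d' = \<psi> (\<Oplus>\<^bsub>Q\<^esub>b\<in>B. u b \<odot>\<^bsub>Q\<^esub> b) d'" using D d' by simp
    qed
    moreover have "u \<in> extensional B" by (simp add: u_def)
    moreover obtain w where w: "\<And>u. u \<in> extensional B \<and> x = (\<Oplus>\<^bsub>Q\<^esub>b\<in>B. u b \<odot>\<^bsub>Q\<^esub> b) \<Longrightarrow> u = w"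
      using ex1[OF x] by (elim ex1E) blast
    ultimately have "c x = u" using w[of u] w[of "c x"] c[OF x] by simp
    then show ?thesis using b by (simp add: u_def)
  qed
  have "endo_trace Q T = (\<Sum>b\<in>B. c (T b) b)"
    by (simp add: endo_trace_def c_def Let_def B_def)
  also have "\<dots> = (\<Sum>b\<in>B. \<Sum>d\<in>D. \<Sum>d'\<in>D. t d d' * (c (\<beta> d) b * \<psi> b d'))"
  proof (rule sum.cong)
    fix b assume b: "b \<in> B"
    then have bQ: "b \<in> carrier Q" using B(2) by blast
    show "c (T b) b = (\<Sum>d\<in>D. \<Sum>d'\<in>D. t d d' * (c (\<beta> d) b * \<psi> b d'))"
      unfolding lin[OF T[OF bQ] b]
    proof (rule sum.cong)
      fix d assume d: "d \<in> D"
      show "\<psi> (T b) d * c (\<beta> d) b = (\<Sum>d'\<in>D. t d d' * (c (\<beta> d) b * \<psi> b d'))"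
        unfolding matrix[OF bQ d] sum_distrib_right by (intro sum.cong) (simp_all add: ac_simps)
    qed simp
  qed simp
  \<comment> \<open>Summing over \<open>b\<close> first turns the inner factor into the coordinate
    \<open>\<psi> (\<beta> d) d'\<close>, a Kronecker delta.\<close>
  also have "\<dots> = (\<Sum>d\<in>D. \<Sum>d'\<in>D. \<Sum>b\<in>B. t d d' * (c (\<beta> d) b * \<psi> b d'))"
    by (subst sum.swap, rule sum.cong[OF refl], subst sum.swap) simp
  also have "\<dots> = (\<Sum>d\<in>D. \<Sum>d'\<in>D. if d' = d then t d d' else 0)"
    by (intro sum.cong refl) (simp add: c\<psi>[OF \<beta>(1)] \<beta>(2) flip: sum_distrib_left)
  also have "\<dots> = (\<Sum>d\<in>D. t d d)" using D by (intro sum.cong) simp_all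
  finally show ?thesis .
qed

section \<open>Powers of the transfer operator as path counts\<close>

context tree_lattice
begin

lemma finite_sources: "finite {e. nb_path E n e g}"
proof -
  have "{e. nb_path E n e g} \<subseteq> prod.swap ` {f. nb_path E n (prod.swap g) f}"
  proof
    fix e assume "e \<in> {e. nb_path E n e g}"
    then have "nb_path E n (prod.swap g) (prod.swap e)" using nb_path_rev by blast
    then show "e \<in> prod.swap ` {f. nb_path E n (prod.swap g) f}" by (metis imageI mem_Collect_eq swap_swap)
  qed
  then show ?thesis using nb_path_targets finite_subset by blast
qed

lemma transfer_pow_eq:
  assumes "\<Phi> \<in> edge_functions"
  shows "(transfer ^^ k) \<Phi> f = (\<Sum>e | nb_path E k e f. \<Phi> e)"
proof (induction k arbitrary: f)
  case 0
  show ?case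
  proof (cases "E (fst f) (snd f)")
    case True
    then have "{e. nb_path E 0 e f} = {f}" by auto
    then show ?thesis by simp
  next
    case False
    then have "{e. nb_path E 0 e f} = {}" by auto
    then show ?thesis using edge_functions_0[OF assms, of "fst f" "snd f"] False by simp
  qed
next
  case (Suc k)
  show ?case
  proof (cases "E (fst f) (snd f)")
    case True
    let ?S = "{g. nb_step E g f}"
    have S: "?S = (\<lambda>z. (z, fst f)) ` ({z. E (fst f) z} - {snd f})"
      using True E_sym by (auto simp: nb_step_def image_iff)
    have "(transfer ^^ Suc k) \<Phi> f = (\<Sum>z\<in>{z. E (fst f) z} - {snd f}. (transfer ^^ k) \<Phi> (z, fst f))"
      using True by (simp add: transfer_def)
    also have "\<dots> = (\<Sum>g\<in>?S. (transfer ^^ k) \<Phi> g)"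
      unfolding S by (subst sum.reindex) (auto simp: inj_on_def)
    also have "\<dots> = (\<Sum>g\<in>?S. \<Sum>e | nb_path E k e g. \<Phi> e)" using Suc by simp
    \<comment> \<open>Disjoint, since the edges \<open>g\<close> before \<open>f\<close> share their
      end vertex and a geodesic is determined by its end points.\<close>
    also have "\<dots> = sum \<Phi> (\<Union>g\<in>?S. {e. nb_path E k e g})"
    proof (rule sum.UNION_disjoint[symmetric])
      show "finite ?S" unfolding S using finite_nbrs by simp
      show "\<forall>g\<in>?S. \<forall>g'\<in>?S. g \<noteq> g' \<longrightarrow> {e. nb_path E k e g} \<inter> {e. nb_path E k e g'} = {}"
      proof (intro ballI impI equals0I)
        fix g g' e assume g: "g \<in> ?S" "g' \<in> ?S" "g \<noteq> g'" and "e \<in> {e. nb_path E k e g} \<inter> {e. nb_path E k e g'}"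
        then have "nb_path E k e g" "nb_path E k e g'" "snd g = snd g'" by (simp_all add: nb_step_def)
        then show False using nb_path_unique g(3) by blast
      qed
    qed (use finite_sources in blast)
    also have "(\<Union>g\<in>?S. {e. nb_path E k e g}) = {e. nb_path E (Suc k) e f}" by (auto simp: nb_path_Suc)
    finally show ?thesis .
  next
    case False
    then have "{e. nb_path E (Suc k) e f} = {}" using nb_path_edges by blast
    moreover have "(transfer ^^ Suc k) \<Phi> f = 0" using False by (simp add: transfer_def)
    ultimately show ?thesis by (simp only: sum.empty)
  qed
qed

lemma edge_functions_rep:
  assumes "\<Phi> \<in> edge_functions" "E (fst e) (snd e)"
  shows "\<Phi> (edge_rep e) = \<Phi> e"
  using edge_functions_inv[OF assms(1) edge_decomp(2)[OF assms(2)], of "fst (edge_rep e)" "snd (edge_rep e)"]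
    edge_decomp(3)[OF assms(2)] by (metis map_prod_simp prod.collapse)

text \<open>The sources of paths are sorted by orbit, which gives the matrix of the
  \<open>k\<close>-th power in the coordinates indexed by \<open>edge_reps\<close>.\<close>

lemma transfer_pow_matrix:
  assumes "\<Phi> \<in> edge_functions"
  shows "(transfer ^^ k) \<Phi> f = (\<Sum>d\<in>edge_reps. of_nat (card {e. nb_path E k e f \<and> edge_rep e = d}) * \<Phi> d)"
proof -
  have "(transfer ^^ k) \<Phi> f = (\<Sum>e | nb_path E k e f. \<Phi> (edge_rep e))"
    unfolding transfer_pow_eq[OF assms]
  proof (rule sum.cong)
    fix e assume "e \<in> {e. nb_path E k e f}"
    then have "E (fst e) (snd e)" using nb_path_edges by blast
    then show "\<Phi> e = \<Phi> (edge_rep e)" using edge_functions_rep[OF assms] by simp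
  qed simp
  also have "\<dots> = (\<Sum>d\<in>edge_reps. \<Sum>e\<in>{e \<in> {e. nb_path E k e f}. edge_rep e = d}. \<Phi> (edge_rep e))"
  proof (rule sum.group[symmetric])
    show "edge_rep ` {e. nb_path E k e f} \<subseteq> edge_reps" using edge_decomp(1) nb_path_edges by blast
  qed (simp_all add: finite_sources finite_edge_reps)
  also have "\<dots> = (\<Sum>d\<in>edge_reps. of_nat (card {e. nb_path E k e f \<and> edge_rep e = d}) * \<Phi> d)"
    by (intro sum.cong) simp_all
  finally show ?thesis .
qed

text \<open>A source \<open>e\<close> in the orbit of \<open>d\<close> is the image of
  \<open>d\<close> under the inverse of a unique \<sigma>; moving the path by \<sigma> makes it run
  from \<open>d\<close> to its \<sigma>-translate.\<close>

lemma transfer_pow_trace: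
  "(\<Sum>d\<in>edge_reps. card {e. nb_path E k e d \<and> edge_rep e = d}) = card (translate_pairs k)"
proof -
  let ?S = "SIGMA d:edge_reps. {e. nb_path E k e d \<and> edge_rep e = d}"
  have fin: "finite {e. nb_path E k e d \<and> edge_rep e = d}" for d
    by (rule finite_subset[OF _ finite_sources[of k d]]) blast
  have "bij_betw (\<lambda>(d, \<sigma>). (d, map_prod (inv_into UNIV \<sigma>) (inv_into UNIV \<sigma>) d)) (translate_pairs k) ?S"
  proof (rule bij_betwI[where g = "\<lambda>(d, e). (d, inv_into UNIV (edge_elt e))"])
    have tr: "map_prod (inv_into UNIV \<sigma>) (inv_into UNIV \<sigma>) (map_prod \<sigma> \<sigma> d) = d"
      "map_prod \<sigma> \<sigma> (map_prod (inv_into UNIV \<sigma>) (inv_into UNIV \<sigma>) d) = d" if "\<sigma> \<in> \<Gamma>" for \<sigma> d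
      using Gamma_aut[OF that] by (cases d; simp)+
    have rep: "edge_rep (map_prod (inv_into UNIV \<sigma>) (inv_into UNIV \<sigma>) d) = d"
      "edge_elt (map_prod (inv_into UNIV \<sigma>) (inv_into UNIV \<sigma>) d) = inv_into UNIV \<sigma>" if "\<sigma> \<in> \<Gamma>" "d \<in> edge_reps" for \<sigma> d
      using edge_decomp_eqI[OF that(2) Gamma_inv[OF that(1)] refl] by blast+
    show "(\<lambda>(d, \<sigma>). (d, map_prod (inv_into UNIV \<sigma>) (inv_into UNIV \<sigma>) d)) \<in> translate_pairs k \<rightarrow> ?S"
    proof (rule Pi_I)
      fix x assume "x \<in> translate_pairs k"
      then obtain d \<sigma> where x: "x = (d, \<sigma>)" and s: "d \<in> edge_reps" "\<sigma> \<in> \<Gamma>" "nb_path E k d (map_prod \<sigma> \<sigma> d)"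
        unfolding translate_pairs_def by blast
      have "nb_path E k (map_prod (inv_into UNIV \<sigma>) (inv_into UNIV \<sigma>) d) d"
        using nb_path_aut[OF aut_inv[OF Gamma_aut[OF s(2)]] s(3)] tr(1)[OF s(2)] by simp
      then show "(\<lambda>(d, \<sigma>). (d, map_prod (inv_into UNIV \<sigma>) (inv_into UNIV \<sigma>) d)) x \<in> ?S"
        using rep(1)[OF s(2,1)] s(1) by (simp add: x)
    qed
    show "(\<lambda>(d, e). (d, inv_into UNIV (edge_elt e))) \<in> ?S \<rightarrow> translate_pairs k"
    proof (rule Pi_I)
      fix x assume "x \<in> ?S"
      then obtain d e where x: "x = (d, e)" and d: "d \<in> edge_reps" and p: "nb_path E k e d" and r: "edge_rep e = d" by blast
      have e: "E (fst e) (snd e)" using nb_path_edges[OF p] by blast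
      let ?g = "inv_into UNIV (edge_elt e)"
      have "map_prod ?g ?g e = d" using tr(1)[OF edge_decomp(2)[OF e], of d] edge_decomp(3)[OF e] r by simp
      then have "nb_path E k d (map_prod ?g ?g d)"
        using nb_path_aut[OF aut_inv[OF Gamma_aut[OF edge_decomp(2)[OF e]]] p] by simp
      then show "(\<lambda>(d, e). (d, inv_into UNIV (edge_elt e))) x \<in> translate_pairs k"
        using d Gamma_inv[OF edge_decomp(2)[OF e]] by (simp add: x translate_pairs_def)
    qed
    show "(\<lambda>(d, e). (d, inv_into UNIV (edge_elt e))) ((\<lambda>(d, \<sigma>). (d, map_prod (inv_into UNIV \<sigma>) (inv_into UNIV \<sigma>) d)) x) = x"
      if "x \<in> translate_pairs k" for x
      using that rep(2) Gamma_inv_inv by (auto simp: translate_pairs_def)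
    show "(\<lambda>(d, \<sigma>). (d, map_prod (inv_into UNIV \<sigma>) (inv_into UNIV \<sigma>) d)) ((\<lambda>(d, e). (d, inv_into UNIV (edge_elt e))) x) = x"
      if "x \<in> ?S" for x
    proof -
      obtain d e where x: "x = (d, e)" and p: "nb_path E k e d" and r: "edge_rep e = d" using \<open>x \<in> ?S\<close> by blast
      have e: "E (fst e) (snd e)" using nb_path_edges[OF p] by blast
      show ?thesis using edge_decomp(3)[OF e] Gamma_inv_inv[OF edge_decomp(2)[OF e]] by (simp add: x r)
    qed
  qed
  then have "card (translate_pairs k) = card ?S" by (rule bij_betw_same_card)
  also have "\<dots> = (\<Sum>d\<in>edge_reps. card {e. nb_path E k e d \<and> edge_rep e = d})"
    using finite_edge_reps fin by (intro card_SigmaI) auto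
  finally show ?thesis by simp
qed

section \<open>The space of coinvariants in coordinates\<close>

definition W_class :: "(('v \<Rightarrow> 'v) set \<Rightarrow> complex) \<Rightarrow> (('v \<Rightarrow> 'v) set \<Rightarrow> complex) set" where
  "W_class f = {h. h - f \<in> W}"

lemma W_uminus: "f - g \<in> W \<Longrightarrow> g - f \<in> W"
  using W_subspace(4)[OF W_subspace(1), of "f - g"] by simp

lemma W_class_self: "f \<in> W_class f"
  using W_subspace(1) by (simp add: W_class_def)

lemma W_class_eq_iff: "W_class f = W_class g \<longleftrightarrow> f - g \<in> W"
proof
  show "f - g \<in> W" if "W_class f = W_class g"
    using W_class_self[of f] unfolding that by (simp add: W_class_def)
  assume fg: "f - g \<in> W"
  have "h - f \<in> W \<longleftrightarrow> h - g \<in> W" for h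
    using W_subspace(2)[OF _ fg, of "h - f"] W_subspace(4)[OF _ fg, of "h - g"] by auto
  then show "W_class f = W_class g" by (simp add: W_class_def)
qed

lemma W_class_memD: "h \<in> W_class f \<Longrightarrow> W_class f = W_class h"
  using W_class_eq_iff W_uminus by (auto simp: W_class_def)

lemma a_r_coset_W: "W +>\<^bsub>function_module V\<^esub> f = W_class f"
proof -
  have "h \<in> (\<lambda>w. w + f) ` W \<longleftrightarrow> h - f \<in> W" for h
    by (auto intro: image_eqI[of _ _ "h - f"])
  then show ?thesis by (auto simp: a_r_coset_def' function_module_def W_class_def image_iff)
qed

lemma carrier_coinvariants: "carrier (coinvariants E v \<Gamma>) = W_class ` V"
  by (auto simp: coinvariants_def quotient_module_def A_RCOSETS_def' a_r_coset_W)
    (auto simp: function_module_def)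

lemma zero_coinvariants: "\<zero>\<^bsub>coinvariants E v \<Gamma>\<^esub> = W_class 0"
  by (simp add: coinvariants_def quotient_module_def W_class_def)

lemma add_coinvariants: "W_class f \<oplus>\<^bsub>coinvariants E v \<Gamma>\<^esub> W_class g = W_class (f + g)"
proof -
  have "W_class f <+>\<^bsub>function_module V\<^esub> W_class g = W_class (f + g)"
  proof (intro equalityI subsetI)
    fix x assume "x \<in> W_class f <+>\<^bsub>function_module V\<^esub> W_class g"
    then obtain h k where hk: "h - f \<in> W" "k - g \<in> W" "x = h + k"
      by (auto simp: set_add_def' function_module_def W_class_def)
    then have "x - (f + g) = (h - f) + (k - g)" by simp
    then show "x \<in> W_class (f + g)"
      using W_subspace(2)[OF hk(1,2)] by (simp only: W_class_def mem_Collect_eq)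
  next
    fix x assume "x \<in> W_class (f + g)"
    then have "x - g \<in> W_class f" by (simp add: W_class_def diff_diff_eq add.commute)
    moreover have "x = (x - g) + g" by simp
    ultimately have "x \<in> (\<Union>h\<in>W_class f. \<Union>k\<in>W_class g. {h + k})"
      using W_class_self[of g] by blast
    then show "x \<in> W_class f <+>\<^bsub>function_module V\<^esub> W_class g"
      by (simp add: set_add_def' function_module_def)
  qed
  then show ?thesis by (simp add: coinvariants_def quotient_module_def)
qed

lemma smult_coinvariants: "c \<odot>\<^bsub>coinvariants E v \<Gamma>\<^esub> W_class f = W_class (\<lambda>x. c * f x)"
proof -
  have "W_class (\<lambda>x. c * h x) = W_class (\<lambda>x. c * f x)" if "h \<in> W_class f" for h
  proof -
    have "h - f \<in> W" using that by (simp add: W_class_def)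
    then have "(\<lambda>x. c * (h - f) x) \<in> W" by (rule W_subspace(3))
    moreover have "(\<lambda>x. c * (h - f) x) = (\<lambda>x. c * h x) - (\<lambda>x. c * f x)"
      by (rule ext) (simp add: right_diff_distrib)
    ultimately show ?thesis by (simp add: W_class_eq_iff)
  qed
  then have "(\<Union>h\<in>W_class f. W_class (\<lambda>x. c * h x)) = W_class (\<lambda>x. c * f x)"
    using W_class_self[of f] by blast
  moreover have "c \<odot>\<^bsub>coinvariants E v \<Gamma>\<^esub> W_class f = (\<Union>h\<in>W_class f. W_class (\<lambda>x. c * h x))"
    by (simp add: coinvariants_def quotient_module_def a_r_coset_W) (simp add: function_module_def)
  ultimately show ?thesis by simp
qed

lemma abelian_monoid_coinvariants: "abelian_monoid (coinvariants E v \<Gamma>)"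
proof (rule abelian_monoidI)
  let ?Q = "coinvariants E v \<Gamma>"
  fix x y z assume "x \<in> carrier ?Q" "y \<in> carrier ?Q" "z \<in> carrier ?Q"
  then obtain f g h where fgh: "f \<in> V" "x = W_class f" "g \<in> V" "y = W_class g" "h \<in> V" "z = W_class h"
    by (auto simp: carrier_coinvariants)
  show "x \<oplus>\<^bsub>?Q\<^esub> y \<oplus>\<^bsub>?Q\<^esub> z = x \<oplus>\<^bsub>?Q\<^esub> (y \<oplus>\<^bsub>?Q\<^esub> z)"
    by (simp add: fgh add_coinvariants add.assoc)
next
  let ?Q = "coinvariants E v \<Gamma>"
  fix x y assume "x \<in> carrier ?Q" "y \<in> carrier ?Q"
  then obtain f g where fg: "f \<in> V" "x = W_class f" "g \<in> V" "y = W_class g"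
    by (auto simp: carrier_coinvariants)
  show "x \<oplus>\<^bsub>?Q\<^esub> y \<in> carrier ?Q"
    unfolding fg(2,4) add_coinvariants carrier_coinvariants using smooth_add[OF fg(1,3)] by blast
  show "x \<oplus>\<^bsub>?Q\<^esub> y = y \<oplus>\<^bsub>?Q\<^esub> x"
    by (simp add: fg add_coinvariants add.commute)
qed (use smooth_0 in \<open>auto simp: carrier_coinvariants zero_coinvariants add_coinvariants\<close>)

text \<open>Inverse of the isomorphism taking an edge function to the class of its lift at level 0.
  Existence rests on \<open>smooth_mod_W\<close>, uniqueness on \<open>lift_in_W\<close>.\<close>

definition coord :: "(('v \<Rightarrow> 'v) set \<Rightarrow> complex) set \<Rightarrow> 'v \<times> 'v \<Rightarrow> complex" where
  "coord C = (THE \<Phi>. \<Phi> \<in> edge_functions \<and> lift 0 \<Phi> \<in> C)"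

lemma lift_class_unique:
  assumes "\<Phi> \<in> edge_functions" "\<Psi> \<in> edge_functions" "lift 0 \<Phi> \<in> W_class f" "lift 0 \<Psi> \<in> W_class f"
  shows "\<Phi> = \<Psi>"
proof -
  have m: "(\<lambda>e. - 1 * \<Psi> e) \<in> edge_functions" using edge_functions_scale[OF assms(2), of "- 1"] .
  have "lift 0 \<Phi> - lift 0 \<Psi> \<in> W"
    using assms(3,4) W_class_memD W_class_eq_iff by metis
  moreover have "lift 0 (\<Phi> + (\<lambda>e. - 1 * \<Psi> e)) = lift 0 \<Phi> - lift 0 \<Psi>"
    unfolding lift_add[OF assms(1) m] lift_scale by (rule ext) simp
  ultimately have "\<Phi> + (\<lambda>e. - 1 * \<Psi> e) = 0"
    using lift_in_W[OF edge_functions_add[OF assms(1) m]] by simp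
  then have "(\<Phi> + (\<lambda>e. - 1 * \<Psi> e)) e = 0 e" for e by (rule fun_cong)
  then show ?thesis by (intro ext) simp
qed

lemma coord_eqI: "\<Phi> \<in> edge_functions \<Longrightarrow> lift 0 \<Phi> \<in> W_class f \<Longrightarrow> coord (W_class f) = \<Phi>"
  unfolding coord_def using lift_class_unique by (intro the_equality) blast+

lemma coord_mem:
  assumes "f \<in> V"
  shows "coord (W_class f) \<in> edge_functions" "lift 0 (coord (W_class f)) \<in> W_class f"
proof -
  obtain \<Phi> where \<Phi>: "\<Phi> \<in> edge_functions" "f - lift 0 \<Phi> \<in> W" using smooth_mod_W[OF assms] by blast
  then have "lift 0 \<Phi> \<in> W_class f" using W_uminus by (simp add: W_class_def)
  then show "coord (W_class f) \<in> edge_functions" "lift 0 (coord (W_class f)) \<in> W_class f"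
    using coord_eqI[OF \<Phi>(1)] \<Phi>(1) by simp_all
qed

lemma W_class_coord: "f \<in> V \<Longrightarrow> W_class (lift 0 (coord (W_class f))) = W_class f"
  using W_class_memD[OF coord_mem(2)] by simp

lemma coord_add:
  assumes "f \<in> V" "g \<in> V"
  shows "coord (W_class (f + g)) = coord (W_class f) + coord (W_class g)"
proof (rule coord_eqI)
  note m = coord_mem[OF assms(1)] coord_mem[OF assms(2)]
  show "coord (W_class f) + coord (W_class g) \<in> edge_functions" using m by (intro edge_functions_add)
  have "(lift 0 (coord (W_class f)) - f) + (lift 0 (coord (W_class g)) - g) \<in> W"
    by (intro W_subspace(2)) (use m in \<open>simp_all add: W_class_def\<close>)
  moreover have "(lift 0 (coord (W_class f)) - f) + (lift 0 (coord (W_class g)) - g)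
    = lift 0 (coord (W_class f) + coord (W_class g)) - (f + g)"
    unfolding lift_add[OF m(1,3)] by simp
  ultimately show "lift 0 (coord (W_class f) + coord (W_class g)) \<in> W_class (f + g)"
    unfolding W_class_def[of "f + g"] mem_Collect_eq by metis
qed

lemma coord_scale:
  assumes "f \<in> V"
  shows "coord (W_class (\<lambda>x. c * f x)) = (\<lambda>e. c * coord (W_class f) e)"
proof (rule coord_eqI)
  note m = coord_mem[OF assms]
  show "(\<lambda>e. c * coord (W_class f) e) \<in> edge_functions" using m by (intro edge_functions_scale)
  have "lift 0 (coord (W_class f)) - f \<in> W"
    using m(2) unfolding W_class_def[of f] mem_Collect_eq .
  then have "(\<lambda>x. c * (lift 0 (coord (W_class f)) - f) x) \<in> W" by (rule W_subspace(3))
  moreover have "(\<lambda>x. c * (lift 0 (coord (W_class f)) - f) x) = lift 0 (\<lambda>e. c * coord (W_class f) e) - (\<lambda>x. c * f x)"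
    unfolding lift_scale by (rule ext) (simp add: right_diff_distrib)
  ultimately show "lift 0 (\<lambda>e. c * coord (W_class f) e) \<in> W_class (\<lambda>x. c * f x)"
    unfolding W_class_def[of "\<lambda>x. c * f x"] mem_Collect_eq by metis
qed

lemma R_comp: "R y (R z f) = R (y \<circ> z) f"
proof
  have "c #>\<^bsub>aut_group E\<^esub> y #>\<^bsub>aut_group E\<^esub> z = c #>\<^bsub>aut_group E\<^esub> (y \<circ> z)" for c
    by (auto simp: r_coset_def comp_assoc)
  then show "R y (R z f) c = R (y \<circ> z) f c" for c by (simp add: right_translation_def)
qed

lemma R_id: "R id f = f"
  by (rule ext) (simp add: right_translation_def r_coset_def)

lemma R_diff: "R y (f - g) = R y f - R y g"
  by (rule ext) (simp add: right_translation_def)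

text \<open>Conjugation by \<open>a\<close> takes \<open>ray_fixer n\<close> into
  \<open>ray_fixer (n + c)\<close>, so a relation goes to a relation of a shifted level.\<close>

lemma R_W:
  assumes a: "a \<in> Aut" "\<And>j. a (v j) = v (j + c)" and w: "w \<in> W"
  shows "R a w \<in> W"
proof -
  obtain n where "w \<in> rel n" using w unfolding coinvariant_relations_eq by blast
  then show ?thesis
    unfolding rel_def
  proof (induction rule: fun_space.span_induct_alt)
    case base
    have "R a 0 = 0" by (rule ext) (simp add: right_translation_def)
    show ?case unfolding \<open>R a 0 = 0\<close> by (rule W_subspace(1))
  next
    case (step k x y)
    then obtain f s where x: "x = f - R s f" "f \<in> V" "s \<in> ray_fixer n" by blast
    note sA = ray_fixerD(1)[OF x(3)]
    have b: "a \<circ> s \<circ> inv_into UNIV a \<in> ray_fixer (n + c)"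
      unfolding ray_fixer_def
    proof (intro CollectI conjI allI impI)
      fix m assume m: "m \<ge> n + c"
      have "a (v (m - c)) = v m" using a(2) by simp
      then have "inv_into UNIV a (v m) = v (m - c)" using aut_inv_apply(1)[OF a(1)] by metis
      then show "(a \<circ> s \<circ> inv_into UNIV a) (v m) = v m"
        using ray_fixerD(2)[OF x(3), of "m - c"] m a(2) by simp
    qed (intro aut_comp aut_inv a sA)
    have "a \<circ> s \<circ> inv_into UNIV a \<circ> a = a \<circ> s" using a(1) by (simp add: fun_eq_iff)
    then have "R a x = R a f - R (a \<circ> s \<circ> inv_into UNIV a) (R a f)"
      unfolding x(1) R_diff R_comp by simp
    then have "R a x \<in> W" using rel_base[OF smooth_R[OF x(2) a(1)] b] rel_W by auto
    then have "(\<lambda>z. k * R a x z) + R a y \<in> W"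
      using step by (intro W_subspace(2) W_subspace(3))
    moreover have "R a ((\<lambda>z. k * x z) + y) = (\<lambda>z. k * R a x z) + R a y"
      by (rule ext) (simp add: right_translation_def)
    ultimately show ?case by (simp only:)
  qed
qed

text \<open>The inverse of \<open>a\<close> shifts the line as well and so preserves the relations;
  hence the image is a full class and not merely contained in one.\<close>

lemma R_W_class:
  assumes a: "a \<in> Aut" "\<And>j. a (v j) = v (j + c)"
  shows "R a ` W_class f = W_class (R a f)"
proof -
  have ai: "inv_into UNIV a (v j) = v (j + (- c))" for j
    using aut_inv_apply(1)[OF a(1), of "v (j - c)"] a(2)[of "j - c"] by simp
  have inv: "R a (R (inv_into UNIV a) h) = h" "R (inv_into UNIV a) (R a h) = h" for h
  proof -
    have "a \<circ> inv_into UNIV a = id" "inv_into UNIV a \<circ> a = id" using a(1) by (auto simp: fun_eq_iff)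
    then show "R a (R (inv_into UNIV a) h) = h" "R (inv_into UNIV a) (R a h) = h" by (simp_all add: R_comp R_id)
  qed
  show ?thesis
  proof (intro equalityI subsetI)
    fix h assume "h \<in> R a ` W_class f"
    then obtain k where k: "h = R a k" "k - f \<in> W" by (auto simp: W_class_def)
    from R_W[OF a k(2)] show "h \<in> W_class (R a f)" by (simp add: W_class_def k(1) R_diff)
  next
    fix h assume "h \<in> W_class (R a f)"
    then have "R (inv_into UNIV a) (h - R a f) \<in> W"
      using R_W[OF aut_inv[OF a(1)] ai] by (simp add: W_class_def)
    then have "R (inv_into UNIV a) h \<in> W_class f" by (simp add: W_class_def R_diff inv)
    then show "h \<in> R a ` W_class f" using inv(1)[of h] by (metis imageI)
  qed
qed

lemma R_lift:
  assumes a: "a \<in> Aut" "\<And>j. a (v j) = v (j + c)" and \<Phi>: "\<Phi> \<in> edge_functions"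
  shows "R a (lift r \<Phi>) = lift (r + c) \<Phi>"
proof (rule smooth_eqI)
  show "R a (lift r \<Phi>) (coset g) = lift (r + c) \<Phi> (coset g)" if g: "g \<in> Aut" for g
    using lift_coset[OF \<Phi> aut_comp[OF g a(1)], of r] lift_coset[OF \<Phi> g, of "r + c"] a(2)[of r] a(2)[of "r + 1"]
    by (simp add: ac_simps)
qed (intro smooth_R lift_smooth \<Phi> a)+

text \<open>\<open>R a\<close> turns the lift at level 0 into the lift at level \<open>-k\<close>,
  and \<open>k\<close> transfers, each with a factor \<open>1 / q\<close>, bring it back to level 0
  modulo relations. Transfers only raise the level, which is why the shift has to be
  negative.\<close>

lemma trace_coinvariants:
  assumes A: "splitting_image E v A" and a: "a \<in> A_minus v A"
  shows "of_nat q ^ displacement E a * trace_on_coinvariants E v \<Gamma> a = of_nat (card (translate_pairs (displacement E a)))"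
proof -
  define k where "k = displacement E a"
  have aA: "a \<in> Aut" using A_minus_shift(2)[OF A a] .
  have av: "a (v j) = v (j + (- int k))" for j
    using A_minus_shift(3,4)[OF A a] displacement_A_minus[OF A a] by (simp add: k_def)
  have q: "of_nat q ^ k \<noteq> (0 :: complex)" using q_pos by simp
  define t where "t d d' = of_nat (card {e. nb_path E k e d \<and> edge_rep e = d'}) / (of_nat q ^ k :: complex)" for d d'
  let ?Q = "coinvariants E v \<Gamma>"
  have coordR: "coord (W_class (R a f)) = (\<lambda>e. inverse (of_nat q ^ k) * (transfer ^^ k) (coord (W_class f)) e)"
    if f: "f \<in> V" for f
  proof -
    let ?\<Phi> = "coord (W_class f)"
    note m = coord_mem[OF f]
    let ?\<Psi> = "\<lambda>e. inverse (of_nat q ^ k) * (transfer ^^ k) ?\<Phi> e"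
    have "R a (lift 0 ?\<Phi>) \<in> W_class (R a f)" using m(2) R_W_class[OF aA av, of f] by blast
    then have mem: "lift (- int k) ?\<Phi> - R a f \<in> W" using R_lift[OF aA av m(1), of 0] by (simp add: W_class_def)
    have "(\<lambda>c. of_nat q ^ k * lift (- int k) ?\<Phi> c) - lift 0 ((transfer ^^ k) ?\<Phi>) \<in> W"
      using lift_transfer_pow[OF m(1), of k "- int k"] rel_W by auto
    then have "(\<lambda>c. inverse (of_nat q ^ k) * ((\<lambda>c. of_nat q ^ k * lift (- int k) ?\<Phi> c) - lift 0 ((transfer ^^ k) ?\<Phi>)) c) \<in> W"
      by (rule W_subspace(3))
    moreover have "(\<lambda>c. inverse (of_nat q ^ k) * ((\<lambda>c. of_nat q ^ k * lift (- int k) ?\<Phi> c) - lift 0 ((transfer ^^ k) ?\<Phi>)) c)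
      = lift (- int k) ?\<Phi> - lift 0 ?\<Psi>"
      unfolding lift_scale using q by (intro ext) (simp add: field_simps)
    ultimately have "lift (- int k) ?\<Phi> - lift 0 ?\<Psi> \<in> W" by simp
    from W_subspace(4)[OF mem this] have "lift 0 ?\<Psi> \<in> W_class (R a f)" by (simp add: W_class_def)
    then show ?thesis by (rule coord_eqI[OF edge_functions_scale[OF transfer_pow_edge_functions[OF m(1)]]])
  qed
  have "endo_trace ?Q (\<lambda>C. R a ` C) = (\<Sum>d\<in>edge_reps. t d d)"
  proof (rule endo_trace_coords[where \<psi> = coord and t = t])
    show "abelian_monoid ?Q" by (rule abelian_monoid_coinvariants)
    show "finite edge_reps" by (rule finite_edge_reps)
    show "c \<odot>\<^bsub>?Q\<^esub> C \<in> carrier ?Q" if "C \<in> carrier ?Q" for c C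
      using that by (auto simp: carrier_coinvariants smult_coinvariants intro!: imageI smooth_scale)
    show "coord (C \<oplus>\<^bsub>?Q\<^esub> C') d = coord C d + coord C' d" if "C \<in> carrier ?Q" "C' \<in> carrier ?Q" for C C' d
      using that by (auto simp: carrier_coinvariants add_coinvariants coord_add)
    show "coord (c \<odot>\<^bsub>?Q\<^esub> C) d = c * coord C d" if "C \<in> carrier ?Q" for c C d
      using that by (auto simp: carrier_coinvariants smult_coinvariants coord_scale)
    show "C = C'" if C: "C \<in> carrier ?Q" "C' \<in> carrier ?Q" "\<And>d. d \<in> edge_reps \<Longrightarrow> coord C d = coord C' d" for C C'
    proof -
      obtain f g where fg: "f \<in> V" "C = W_class f" "g \<in> V" "C' = W_class g" using C by (auto simp: carrier_coinvariants)
      have "coord C = coord C'"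
      proof
        fix e
        show "coord C e = coord C' e"
        proof (cases "E (fst e) (snd e)")
          case True
          then show ?thesis
            using edge_functions_rep[OF coord_mem(1)[OF fg(1)] True] edge_functions_rep[OF coord_mem(1)[OF fg(3)] True]
              C(3)[OF edge_decomp(1)[OF True]] fg by simp
        next
          case False
          then show ?thesis
            using edge_functions_0[OF coord_mem(1)[OF fg(1)], of "fst e" "snd e"]
              edge_functions_0[OF coord_mem(1)[OF fg(3)], of "fst e" "snd e"] fg by simp
        qed
      qed
      then show ?thesis using W_class_coord[OF fg(1)] W_class_coord[OF fg(3)] fg by metis
    qed
    show "\<exists>C\<in>carrier ?Q. \<forall>d\<in>edge_reps. coord C d = u d" for u
    proof -
      \<comment> \<open>Invariant under the lattice because \<open>edge_rep\<close> depends only on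
        the orbit.\<close>
      define \<Phi> where "\<Phi> e = (if E (fst e) (snd e) then u (edge_rep e) else 0)" for e
      have EF: "\<Phi> \<in> edge_functions"
      proof (rule edge_functionsI)
        fix \<gamma> x y assume g: "\<gamma> \<in> \<Gamma>" and xy: "E x y"
        have "edge_orbit (\<gamma> x, \<gamma> y) = edge_orbit (x, y)"
          by (rule edge_orbit_eq) (use g in \<open>auto simp: edge_orbit_def\<close>)
        then show "\<Phi> (\<gamma> x, \<gamma> y) = \<Phi> (x, y)"
          using xy aut_adj[OF Gamma_aut[OF g]] by (simp add: \<Phi>_def edge_rep_def)
      qed (simp add: \<Phi>_def)
      have "\<Phi> d = u d" if "d \<in> edge_reps" for d
        using edge_decomp_eqI(1)[OF that Gamma_id, of d] edge_reps_edge[OF that] by (simp add: \<Phi>_def prod.map_id0)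
      moreover have "coord (W_class (lift 0 \<Phi>)) = \<Phi>" by (rule coord_eqI[OF EF W_class_self])
      ultimately show ?thesis using lift_smooth[OF EF] by (intro bexI[of _ "W_class (lift 0 \<Phi>)"]) (simp_all add: carrier_coinvariants)
    qed
    show "R a ` C \<in> carrier ?Q" if "C \<in> carrier ?Q" for C
      using that R_W_class[OF aA av] smooth_R[OF _ aA] by (auto simp: carrier_coinvariants)
    show "coord (R a ` C) d = (\<Sum>d'\<in>edge_reps. t d d' * coord C d')" if C: "C \<in> carrier ?Q" "d \<in> edge_reps" for C d
    proof -
      obtain f where f: "f \<in> V" "C = W_class f" using C by (auto simp: carrier_coinvariants)
      have "coord (R a ` C) d = inverse (of_nat q ^ k) * (transfer ^^ k) (coord C) d"
        using coordR[OF f(1)] by (simp add: f(2) R_W_class[OF aA av])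
      also have "\<dots> = (\<Sum>d'\<in>edge_reps. t d d' * coord C d')"
        using transfer_pow_matrix[OF coord_mem(1)[OF f(1)], of k d]
        by (simp add: f(2) t_def sum_distrib_left divide_inverse ac_simps)
      finally show ?thesis .
    qed
  qed
  also have "\<dots> = of_nat (\<Sum>d\<in>edge_reps. card {e. nb_path E k e d \<and> edge_rep e = d}) / of_nat q ^ k"
    by (simp add: t_def sum_divide_distrib)
  finally show ?thesis
    using q unfolding transfer_pow_trace trace_on_coinvariants_def k_def[symmetric] by simp
qed

end

theorem theorem5p1:
  fixes q :: nat
    and E :: "'v \<Rightarrow> 'v \<Rightarrow> bool"
    and v :: "int \<Rightarrow> 'v"
    and A \<Gamma> :: "('v \<Rightarrow> 'v) set"
    and \<phi> :: "('v \<Rightarrow> 'v) \<Rightarrow> complex"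
    and rep :: "('v \<Rightarrow> 'v) set \<Rightarrow> ('v \<Rightarrow> 'v)"
  assumes "1 \<le> q"
    and "is_tree E" and "regular_of_valency E (q + 1)"
    and "is_line E v"
    and "splitting_image E v A"
    and "subgroup \<Gamma> (aut_group E)"
    and "discrete_in_aut E \<Gamma>" and "cocompact_in_aut E \<Gamma>" and "acts_freely E \<Gamma>"
    and "\<And>c. c \<in> split_classes E v A \<Gamma> \<Longrightarrow> rep c \<in> c"
    and "(\<lambda>a. \<phi> a * of_nat q ^ displacement E a) summable_on A_minus v A"
  shows "(\<lambda>a. \<phi> a * of_nat q ^ displacement E a * trace_on_coinvariants E v \<Gamma> a)
           summable_on A_minus v A
       \<and> (\<lambda>c. of_nat (displacement E (primitive_root (aut_group E) \<Gamma> (rep c)))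
              * \<phi> (split_part E v A (rep c)))
           summable_on split_classes E v A \<Gamma>
       \<and> (\<Sum>\<^sub>\<infinity>a\<in>A_minus v A.
             \<phi> a * of_nat q ^ displacement E a * trace_on_coinvariants E v \<Gamma> a)
         = (\<Sum>\<^sub>\<infinity>c\<in>split_classes E v A \<Gamma>.
             of_nat (displacement E (primitive_root (aut_group E) \<Gamma> (rep c)))
             * \<phi> (split_part E v A (rep c)))"
proof -
  interpret tree_lattice E q v \<Gamma>
    by (intro tree_lattice.intro tree_line.intro regular_tree.intro tree.intro regular_tree_axioms.intro
        tree_line_axioms.intro tree_lattice_axioms.intro assms)
  note A = assms(5) and rep = assms(10)
  let ?S = "A_minus v A"
  let ?f = "\<lambda>a. \<phi> a * of_nat q ^ displacement E a * trace_on_coinvariants E v \<Gamma> a"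
  define N where "N a = card (translate_pairs (displacement E a))" for a
  define l where "l c = displacement E (primitive_root (aut_group E) \<Gamma> (rep c))" for c
  define p where "p c = split_part E v A (rep c)" for c
  define C where "C a = {c \<in> split_classes E v A \<Gamma>. p c = a}" for a
  have C: "finite (C a)" "(\<Sum>c\<in>C a. l c) = N a" if "a \<in> ?S" for a
    using sum_split_classes[OF A rep that] by (simp_all add: C_def p_def l_def N_def)
  have lhs: "\<phi> a * of_nat q ^ displacement E a * trace_on_coinvariants E v \<Gamma> a = \<phi> a * of_nat (N a)" if "a \<in> ?S" for a
    using trace_coinvariants[OF A that] by (simp add: N_def mult.assoc)
  \<comment> \<open>Complex summability is absolute, so the hypothesis dominates the trace side up
    to the number of edge orbits.\<close>
  have "(\<lambda>a. norm (\<phi> a * of_nat q ^ displacement E a)) summable_on ?S"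
    using assms(11) by (simp add: summable_on_iff_abs_summable_on_complex)
  then have "(\<lambda>a. real (card edge_reps) * norm (\<phi> a * of_nat q ^ displacement E a)) summable_on ?S"
    by (rule summable_on_cmult_right)
  then have abs: "(\<lambda>a. norm (\<phi> a * of_nat (N a))) summable_on ?S"
  proof (rule Infinite_Sum.abs_summable_on_comparison_test')
    fix a
    have "real (N a) \<le> real (card edge_reps * q ^ displacement E a)"
      unfolding N_def by (rule of_nat_mono[OF card_translate_pairs])
    then have "norm (\<phi> a) * real (N a) \<le> norm (\<phi> a) * (real (card edge_reps) * real q ^ displacement E a)"
      by (intro mult_left_mono) simp_all
    then show "norm (\<phi> a * of_nat (N a)) \<le> real (card edge_reps) * norm (\<phi> a * of_nat q ^ displacement E a)"
      by (simp add: norm_mult norm_power ac_simps)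
  qed
  \<comment> \<open>A double series over \<open>a\<close> and the classes with split part
    \<open>a\<close>. Its fibres are finite and it converges absolutely, so it can be summed by
    \<open>a\<close> or by classes.\<close>
  define F where "F = (\<lambda>(a, c). of_nat (l c) * \<phi> a)"
  have "(\<lambda>x. norm (F x)) summable_on Sigma ?S C"
    unfolding Infinite_Sum.abs_summable_on_Sigma_iff
  proof (intro conjI ballI)
    show "(\<lambda>c. norm (F (a, c))) summable_on C a" if "a \<in> ?S" for a
      using C(1)[OF that] by (rule summable_on_finite)
    have "(\<Sum>\<^sub>\<infinity>c\<in>C a. norm (F (a, c))) = norm (\<phi> a * of_nat (N a))" if "a \<in> ?S" for a
    proof -
      have "(\<Sum>\<^sub>\<infinity>c\<in>C a. norm (F (a, c))) = (\<Sum>c\<in>C a. real (l c) * norm (\<phi> a))"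
        using C(1)[OF that] by (simp add: F_def norm_mult)
      also have "\<dots> = real (N a) * norm (\<phi> a)"
        using C(2)[OF that] by (simp flip: sum_distrib_right of_nat_sum)
      finally show ?thesis by (simp add: norm_mult)
    qed
    then show "(\<lambda>a. norm (\<Sum>\<^sub>\<infinity>c\<in>C a. norm (F (a, c)))) summable_on ?S"
      using abs by (simp cong: summable_on_cong)
  qed
  then have sumF: "F summable_on Sigma ?S C" by (rule abs_summable_summable)
  \<comment> \<open>Each class lies over one \<open>a\<close> only, so the index set of the double
    series is the graph of \<open>p\<close>.\<close>
  have bij: "bij_betw (\<lambda>c. (p c, c)) (split_classes E v A \<Gamma>) (Sigma ?S C)"
  proof (rule bij_betwI[where g = snd])
    show "(\<lambda>c. (p c, c)) \<in> split_classes E v A \<Gamma> \<rightarrow> Sigma ?S C"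
      using split_class_rep(3)[OF A _ rep] by (auto simp: C_def p_def split_part_cond_def)
  qed (auto simp: C_def)
  have FC: "F (p c, c) = of_nat (l c) * \<phi> (p c)" for c by (simp add: F_def)
  have "(\<lambda>a. \<phi> a * of_nat (N a)) summable_on ?S" using abs by (rule abs_summable_summable)
  moreover have "(\<lambda>c. of_nat (l c) * \<phi> (p c)) summable_on split_classes E v A \<Gamma>"
    using summable_on_reindex_bij_betw[OF bij, of F] sumF by (simp add: FC)
  moreover have "(\<Sum>\<^sub>\<infinity>a\<in>?S. \<phi> a * of_nat (N a)) = (\<Sum>\<^sub>\<infinity>c\<in>split_classes E v A \<Gamma>. of_nat (l c) * \<phi> (p c))"
  proof -
    have "(\<Sum>\<^sub>\<infinity>c\<in>C a. F (a, c)) = \<phi> a * of_nat (N a)" if "a \<in> ?S" for a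
    proof -
      have "(\<Sum>\<^sub>\<infinity>c\<in>C a. F (a, c)) = (\<Sum>c\<in>C a. of_nat (l c) * \<phi> a)"
        using C(1)[OF that] by (simp add: F_def)
      also have "\<dots> = of_nat (N a) * \<phi> a"
        using C(2)[OF that] by (simp flip: sum_distrib_right of_nat_sum)
      finally show ?thesis by simp
    qed
    then have "(\<Sum>\<^sub>\<infinity>a\<in>?S. \<phi> a * of_nat (N a)) = (\<Sum>\<^sub>\<infinity>a\<in>?S. \<Sum>\<^sub>\<infinity>c\<in>C a. F (a, c))"
      by (simp cong: infsum_cong)
    also have "\<dots> = infsum F (Sigma ?S C)" by (rule infsum_Sigma_banach[OF sumF])
    also have "\<dots> = (\<Sum>\<^sub>\<infinity>c\<in>split_classes E v A \<Gamma>. F (p c, c))"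
      by (rule infsum_reindex_bij_betw[OF bij, symmetric])
    finally show ?thesis by (simp add: FC)
  qed
  ultimately show ?thesis
    using summable_on_cong[of ?S ?f "\<lambda>a. \<phi> a * of_nat (N a)", OF lhs]
      infsum_cong[of ?S ?f "\<lambda>a. \<phi> a * of_nat (N a)", OF lhs]
    unfolding l_def p_def by simp
qed

end
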